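(* Let $(\pi,\lambda,\tau)$ be a typical point, with $s>1$, let $\chi\in\Gamma_c^{(0)}$, and for $\alpha\in\mathcal A$, $n\le0$ let $\Omega_\alpha^{(n)}=\Omega^{(n)}_\alpha(\pi,\tau,\chi)$ be the associated piecewise affine functions on $[0,q_\alpha(\pi,\tau)]$. Assume that $(\pi,\tau)$ is of dual Roth type. For $\alpha\in\mathcal A$, let $\psi$ be a mean zero function defined on the interval $[0,q_\alpha(\pi,\tau)]$ which is Hölder continuous for some exponent $\eta\in(0,1)$. Then the sequence $$\int_0^{q_\alpha(\pi,\tau)}\psi(x)\,\Omega_\alpha^{(n)}(x)\,dx$$ is convergent as $n\to-\infty$. More precisely, there exist $\delta=\delta(\eta)>0$ and a constant $C(\eta)$ (independent of $\psi,n,n'$) such that, for $n'\le n\le0$, $$\left|\int_0^{q_\alpha(\pi,\tau)}\psi(x)\big(\Omega_\alpha^{(n')}(x)-\Omega_\alpha^{(n)}(x)\big)dx\right|<C(\eta)\,\|\psi\|_{C^\eta}\,\|B(n,0)\|^{-\delta/4}.$$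
   Context: Interval exchange maps. Let $\mathcal A$ be an alphabet with $d\ge2$ letters. Combinatorial data is an irreducible pair $\pi=(\pi_t,\pi_b)$ of bijections $\mathcal A\to\{1,\dots,d\}$ (irreducible: $\pi_t^{-1}(\{1,\dots,k\})\ne\pi_b^{-1}(\{1,\dots,k\})$ for $1\le k<d$). For $\lambda\in(0,\infty)^{\mathcal A}$ the interval exchange map (i.e.m.) $T_{\pi,\lambda}$ acts on $I=(0,\sum_\alpha\lambda_\alpha)$: it translates the intervals $I_\alpha$ of length $\lambda_\alpha$, ordered from left to right by $\pi_t$, onto intervals $I^b_\alpha$ of the same lengths ordered by $\pi_b$. $\Omega_\pi$ is the antisymmetric matrix with $\Omega_{\alpha\beta}=1$ if $\pi_t(\alpha)<\pi_t(\beta),\pi_b(\alpha)>\pi_b(\beta)$, $-1$ if $\pi_t(\alpha)>\pi_t(\beta),\pi_b(\alpha)<\pi_b(\beta)$, $0$ otherwise; its rank is $2g$, and $s:=d-2g+1$. The cone of suspension vectors is $\Theta_\pi=\{\tau\in\mathbb R^{\mathcal A}:\sum_{\pi_t(\alpha)<k}\tau_\alpha>0,\ \sum_{\pi_b(\alpha)<k}\tau_\alpha<0,\ 1<k\le d\}$; for $\tau\in\Theta_\pi$, $M(\pi,\lambda,\tau)$ is the translation surface given by Veech's zippered rectangle construction. Two-sided Rauzy--Veech algorithm. A forward elementary step: let $\pi_t(\alpha_t)=\pi_b(\alpha_b)=d$. If $\lambda_{\alpha_t}>\lambda_{\alpha_b}$ (top type) the winner is $\alpha_t$, the loser $\alpha_b$,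 $\pi_t$ is unchanged and in the bottom row $\alpha_b$ is moved immediately after $\alpha_t$; if $\lambda_{\alpha_t}<\lambda_{\alpha_b}$ (bottom type) the winner is $\alpha_b$, the loser $\alpha_t$, $\pi_b$ is unchanged and in the top row $\alpha_t$ is moved immediately after $\alpha_b$; in both cases the winner's $\lambda$ and $\tau$ entries are diminished by the loser's. The matrix of the step is $B_\gamma=\mathrm{Id}+E_{\text{loser},\text{winner}}$. The backward step (inverse) is of top type if $\sum_\alpha\tau_\alpha<0$ and of bottom type if $\sum_\alpha\tau_\alpha>0$. If $M(\pi,\lambda,\tau)$ has no vertical and no horizontal saddle connections one obtains a sequence $(\pi^{(n)},\lambda^{(n)},\tau^{(n)})_{n\in\mathbb Z}$ with $(\pi^{(0)},\lambda^{(0)},\tau^{(0)})=(\pi,\lambda,\tau)$. $T^{(n)}$ is the i.e.m. with data $(\pi^{(n)},\lambda^{(n)})$, acting on $I^{(n)}$ and exchanging the intervals $I_\alpha^{(n)}$; for $m\le n$, $T^{(n)}$ is the first return map of $T^{(m)}$ to $I^{(n)}\subset I^{(m)}$. Let $\gamma_n$ be the step from index $n-1$ to $n$ and $B(m,n)=B_{\gamma_n}\cdots B_{\gamma_{m+1}}$ ($m\le n$). Norm: $\|B\|=\sum_{\alpha,\beta}|B_{\alpha\beta}|$. The path $\cdots\gamma_{-1}\star\gamma_0$ (the backward rotation number) depends only on $(\pi,\tau)$. A finite path is complete if every letter is the winner of at least one of its arrows; an infinite path is $\infty$-complete if it is a concatenation of infinitely many complete paths. The Zorich time $Z(n)$ is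 the signed count (zero at $n=0$, negative for $n<0$) of maximal blocks of successive steps of the same type between index $0$ and index $n$. Typical point. $(\pi,\lambda,\tau)$ is typical for the natural extension of the Rauzy--Veech dynamics and Oseledets generic for the (extended) Kontsevich--Zorich cocycle $B(m,n)$ acting on $\Gamma(T^{(m)})\simeq\mathbb R^{\mathcal A}$ (functions constant on each $I_\alpha^{(m)}$), with respect to Zorich time; the Lyapunov spectrum consists of $g$ positive, $s-1$ zero and $g$ negative exponents, the largest exponent being simple. $\Gamma_c^{(0)}\subset\Gamma(T^{(0)})$ is the central Oseledets subspace (zero exponent, dimension $s-1$). The $1$-dimensional Oseledets subspace of the largest exponent depends only on $(\pi,\tau)$ and is spanned by a vector with positive entries; $q(\pi,\tau)$ denotes the positive spanning vector of $\ell^2$-norm $1$ (a positive multiple of $-\Omega_\pi\tau$). For $n\le0$ put $q^{(n)}(\pi,\tau)=B(n,0)^{-1}q(\pi,\tau)$ and $\chi^{(n)}=B(n,0)^{-1}\chi$. The functions $\Omega_\alpha^{(n)}$, $n\le0$. Let $B_\alpha(n,0)=\sum_\beta B(n,0)_{\alpha\beta}$, which is the return time of $I_\alpha^{(0)}$ to $I^{(0)}$ under $T^{(n)}$. For $0\le j<B_\alpha(n,0)$ let $\beta(\alpha,j)$ be the letter with $(T^{(n)})^j(I_\alpha^{(0)})\subset I^{(n)}_{\beta(\alpha,j)}$, and for $0\le\ell\le B_\alpha(n,0)$ put $Sq(\ell)=\sum_{0\le j<\ell}q^{(n)}_{\beta(\alpha,j)}(\pi,\tau)$, so $Sq(B_\alpha(n,0))=q_\alpha(\pi,\tau)$.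 Then $\Omega_\alpha^{(n)}$ is the unique continuous function on $[0,q_\alpha(\pi,\tau)]$, affine on each $[Sq(\ell),Sq(\ell+1)]$, with $\Omega_\alpha^{(n)}(Sq(\ell+1))-\Omega_\alpha^{(n)}(Sq(\ell))=\chi^{(n)}_{\beta(\alpha,\ell)}$ (the value of $\chi^{(n)}$ on $(T^{(n)})^\ell(I_\alpha^{(0)})$) and with mean $0$ on $[0,q_\alpha(\pi,\tau)]$. Dual Roth type. $(\pi,\tau)$ is of (weak) dual Roth type if its backward rotation number is defined and $\infty$-complete and, with $\hat n_0=0$ and, for $k\le0$, $\hat n_{k-1}$ the largest $n<\hat n_k$ such that the path $\gamma_{n+1}\star\cdots\star\gamma_{\hat n_k}$ is complete: (a) for every $\varepsilon>0$ there is $C_0>0$ with $\|B(\hat n_{k-1},\hat n_k)\|\le C_0\|B(\hat n_k,0)\|^\varepsilon$ for all $k\le0$; (b) there are $\theta>0$, $C_1>0$ with $\|{}^tB_0(n,0)\|\le C_1\|{}^tB(n,0)\|^{1-\theta}$ for all $n\le0$, where ${}^tB_0(n,0)$ is the restriction of ${}^tB(n,0)$ to the hyperplane $\{v\in\mathbb R^{\mathcal A}:\sum_\alpha v_\alpha(-\Omega_\pi\tau)_\alpha=0\}$.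
   Formalization: The strict inequality is proved for functions ψ not identically zero on the interval, since for ψ = 0 both sides vanish and the strict inequality fails; convergence is proved for all ψ. *)

theory Defs
  imports "HOL-Analysis.Analysis"
begin

section \<open>Combinatorial data and suspension data\<close>

text \<open>
  The alphabet is a finite type \<open>'a\<close> and \<open>d = CARD('a)\<close>.  Combinatorial data is the pair
  \<open>(\<pi>\<^sub>t, \<pi>\<^sub>b)\<close> (top row, bottom row); positions run through \<open>{1..d}\<close>.
\<close>

type_synonym 'a comb = "('a \<Rightarrow> nat) \<times> ('a \<Rightarrow> nat)"

definition comb_data :: "'a::finite comb \<Rightarrow> bool" where
  "comb_data \<pi> \<longleftrightarrow>
     bij_betw (fst \<pi>) UNIV {1..CARD('a)} \<and> bij_betw (snd \<pi>) UNIV {1..CARD('a)}"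

definition irreducible_comb :: "'a::finite comb \<Rightarrow> bool" where
  "irreducible_comb \<pi> \<longleftrightarrow>
     (\<forall>k. 1 \<le> k \<and> k < CARD('a) \<longrightarrow> fst \<pi> -` {1..k} \<noteq> snd \<pi> -` {1..k})"

definition Omega_mat :: "'a::finite comb \<Rightarrow> real^'a^'a" where
  "Omega_mat \<pi> = (\<chi> \<alpha> \<beta>.
     if fst \<pi> \<alpha> < fst \<pi> \<beta> \<and> snd \<pi> \<alpha> > snd \<pi> \<beta> then 1
     else if fst \<pi> \<alpha> > fst \<pi> \<beta> \<and> snd \<pi> \<alpha> < snd \<pi> \<beta> then - 1
     else 0)"

definition genus :: "'a::finite comb \<Rightarrow> nat" where
  "genus \<pi> = rank (Omega_mat \<pi>) div 2"

definition num_sing :: "'a::finite comb \<Rightarrow> nat" where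
  "num_sing \<pi> = CARD('a) + 1 - 2 * genus \<pi>"

definition suspension_cone :: "'a::finite comb \<Rightarrow> (real^'a) set" where
  "suspension_cone \<pi> =
     {\<tau>. \<forall>k. 1 < k \<and> k \<le> CARD('a) \<longrightarrow>
          (\<Sum>\<alpha> | fst \<pi> \<alpha> < k. \<tau> $ \<alpha>) > 0 \<and> (\<Sum>\<alpha> | snd \<pi> \<alpha> < k. \<tau> $ \<alpha>) < 0}"


section \<open>Interval exchange maps\<close>

definition top_interval :: "'a::finite comb \<Rightarrow> real^'a \<Rightarrow> 'a \<Rightarrow> real set" where
  "top_interval \<pi> len \<alpha> =
     {(\<Sum>\<beta> | fst \<pi> \<beta> < fst \<pi> \<alpha>. len $ \<beta>) <..<
      (\<Sum>\<beta> | fst \<pi> \<beta> < fst \<pi> \<alpha>. len $ \<beta>) + len $ \<alpha>}"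

definition translation :: "'a::finite comb \<Rightarrow> real^'a \<Rightarrow> 'a \<Rightarrow> real" where
  "translation \<pi> len \<alpha> =
     (\<Sum>\<beta> | snd \<pi> \<beta> < snd \<pi> \<alpha>. len $ \<beta>) - (\<Sum>\<beta> | fst \<pi> \<beta> < fst \<pi> \<alpha>. len $ \<beta>)"

text \<open>
  The intervals \<open>I\<^sub>\<alpha>\<close> are open and pairwise disjoint, so at most one summand is nonzero.  Outside
  their union, where the map is not defined, the total function below is the identity by convention.
\<close>

definition iem :: "'a::finite comb \<Rightarrow> real^'a \<Rightarrow> real \<Rightarrow> real" where
  "iem \<pi> len x = x + (\<Sum>\<alpha> | x \<in> top_interval \<pi> len \<alpha>. translation \<pi> len \<alpha>)"


section \<open>The two-sided Rauzy--Veech algorithm\<close>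

datatype step_type = Top | Bottom

text \<open>An arrow of the Rauzy diagram: its source together with its type.\<close>

type_synonym 'a arrow = "'a comb \<times> step_type"

definition last_letter :: "('a::finite \<Rightarrow> nat) \<Rightarrow> 'a" where
  "last_letter p = (THE \<alpha>. p \<alpha> = CARD('a))"

fun winner :: "'a::finite arrow \<Rightarrow> 'a" where
  "winner (\<pi>, Top) = last_letter (fst \<pi>)"
| "winner (\<pi>, Bottom) = last_letter (snd \<pi>)"

fun loser :: "'a::finite arrow \<Rightarrow> 'a" where
  "loser (\<pi>, Top) = last_letter (snd \<pi>)"
| "loser (\<pi>, Bottom) = last_letter (fst \<pi>)"

text \<open>The row \<open>p\<close> after its last letter \<open>l\<close> has been moved immediately after the letter \<open>w\<close>.\<close>

definition move_after :: "('a::finite \<Rightarrow> nat) \<Rightarrow> 'a \<Rightarrow> 'a \<Rightarrow> 'a \<Rightarrow> nat" where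
  "move_after p l w \<beta> =
     (if \<beta> = l then p w + 1 else if p \<beta> \<le> p w then p \<beta> else p \<beta> + 1)"

fun arrow_target :: "'a::finite arrow \<Rightarrow> 'a comb" where
  "arrow_target (\<pi>, Top) =
     (fst \<pi>, move_after (snd \<pi>) (loser (\<pi>, Top)) (winner (\<pi>, Top)))"
| "arrow_target (\<pi>, Bottom) =
     (move_after (fst \<pi>) (loser (\<pi>, Bottom)) (winner (\<pi>, Bottom)), snd \<pi>)"

text \<open>
  The inverse operation: the letter standing immediately after \<open>w\<close> in the row \<open>p\<close> is moved to
  the last position.
\<close>

definition next_letter :: "('a::finite \<Rightarrow> nat) \<Rightarrow> 'a \<Rightarrow> 'a" where
  "next_letter p w = (THE \<beta>. p \<beta> = p w + 1)"

definition move_last :: "('a::finite \<Rightarrow> nat) \<Rightarrow> 'a \<Rightarrow> 'a \<Rightarrow> nat" where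
  "move_last p l \<beta> =
     (if \<beta> = l then CARD('a) else if p \<beta> > p l then p \<beta> - 1 else p \<beta>)"

fun arrow_source :: "step_type \<Rightarrow> 'a::finite comb \<Rightarrow> 'a comb" where
  "arrow_source Top \<pi> =
     (fst \<pi>, move_last (snd \<pi>) (next_letter (snd \<pi>) (last_letter (fst \<pi>))))"
| "arrow_source Bottom \<pi> =
     (move_last (fst \<pi>) (next_letter (fst \<pi>) (last_letter (snd \<pi>))), snd \<pi>)"

definition diminish :: "'a::finite arrow \<Rightarrow> real^'a \<Rightarrow> real^'a" where
  "diminish a v = (\<chi> \<alpha>. if \<alpha> = winner a then v $ \<alpha> - v $ loser a else v $ \<alpha>)"

definition augment :: "'a::finite arrow \<Rightarrow> real^'a \<Rightarrow> real^'a" where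
  "augment a v = (\<chi> \<alpha>. if \<alpha> = winner a then v $ \<alpha> + v $ loser a else v $ \<alpha>)"

type_synonym 'a rv_data = "'a comb \<times> (real^'a) \<times> (real^'a)"

definition fwd_arrow :: "'a::finite comb \<Rightarrow> real^'a \<Rightarrow> 'a arrow" where
  "fwd_arrow \<pi> len =
     (\<pi>, if len $ last_letter (fst \<pi>) > len $ last_letter (snd \<pi>) then Top else Bottom)"

definition bwd_arrow :: "'a::finite comb \<Rightarrow> real^'a \<Rightarrow> 'a arrow" where
  "bwd_arrow \<pi> \<tau> =
     (let ty = (if (\<Sum>\<alpha>\<in>UNIV. \<tau> $ \<alpha>) < 0 then Top else Bottom) in (arrow_source ty \<pi>, ty))"

definition fwd_step :: "'a::finite rv_data \<Rightarrow> 'a rv_data" where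
  "fwd_step = (\<lambda>(\<pi>, len, \<tau>).
     (let a = fwd_arrow \<pi> len in (arrow_target a, diminish a len, diminish a \<tau>)))"

definition bwd_step :: "'a::finite rv_data \<Rightarrow> 'a rv_data" where
  "bwd_step = (\<lambda>(\<pi>, len, \<tau>).
     (let a = bwd_arrow \<pi> \<tau> in (fst a, augment a len, augment a \<tau>)))"

definition rv_orbit :: "'a::finite comb \<Rightarrow> real^'a \<Rightarrow> real^'a \<Rightarrow> int \<Rightarrow> 'a rv_data" where
  "rv_orbit \<pi> len \<tau> n =
     (if 0 \<le> n then (fwd_step ^^ nat n) (\<pi>, len, \<tau>) else (bwd_step ^^ nat (- n)) (\<pi>, len, \<tau>))"

text \<open>
  The backward algorithm acts on the pairs \<open>(\<pi>, \<tau>)\<close> alone; by the next lemma this agrees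
  with \<open>bwd_step\<close>.
\<close>

definition bwd_pair :: "'a::finite comb \<times> (real^'a) \<Rightarrow> 'a comb \<times> (real^'a)" where
  "bwd_pair = (\<lambda>(\<pi>, \<tau>). (let a = bwd_arrow \<pi> \<tau> in (fst a, augment a \<tau>)))"

lemma bwd_step_pair:
  "(bwd_step ^^ k) (\<pi>, len, \<tau>) = (\<pi>', len', \<tau>') \<Longrightarrow> (bwd_pair ^^ k) (\<pi>, \<tau>) = (\<pi>', \<tau>')"
proof (induction k arbitrary: \<pi>' len' \<tau>')
  case (Suc k)
  obtain \<pi>1 len1 \<tau>1 where 1: "(bwd_step ^^ k) (\<pi>, len, \<tau>) = (\<pi>1, len1, \<tau>1)"
    by (metis prod_cases3)
  with Suc show ?case
    by (auto simp: bwd_step_def bwd_pair_def Let_def)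
qed simp

text \<open>
  Paths are indexed so that the arrow \<open>\<gamma> n\<close> goes from index \<open>n - 1\<close> to index \<open>n\<close>.
  \<open>backward_path\<close> (only meaningful for \<open>n \<le> 0\<close>) is the backward rotation number.
\<close>

definition backward_path :: "'a::finite comb \<Rightarrow> real^'a \<Rightarrow> int \<Rightarrow> 'a arrow" where
  "backward_path \<pi> \<tau> n =
     (case (bwd_pair ^^ nat (- n)) (\<pi>, \<tau>) of (\<pi>', \<tau>') \<Rightarrow> bwd_arrow \<pi>' \<tau>')"

definition rv_path :: "'a::finite comb \<Rightarrow> real^'a \<Rightarrow> real^'a \<Rightarrow> int \<Rightarrow> 'a arrow" where
  "rv_path \<pi> len \<tau> n =
     (if n \<le> 0 then backward_path \<pi> \<tau> n
      else (case rv_orbit \<pi> len \<tau> (n - 1) of (\<pi>', len', \<tau>') \<Rightarrow> fwd_arrow \<pi>' len'))"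

definition forward_defined :: "'a::finite comb \<Rightarrow> real^'a \<Rightarrow> real^'a \<Rightarrow> bool" where
  "forward_defined \<pi> len \<tau> \<longleftrightarrow>
     (\<forall>n\<ge>0. case rv_orbit \<pi> len \<tau> n of (\<pi>', len', _) \<Rightarrow>
        len' $ last_letter (fst \<pi>') \<noteq> len' $ last_letter (snd \<pi>'))"

definition backward_defined :: "'a::finite comb \<Rightarrow> real^'a \<Rightarrow> bool" where
  "backward_defined \<pi> \<tau> \<longleftrightarrow>
     (\<forall>k. case (bwd_pair ^^ k) (\<pi>, \<tau>) of (_, \<tau>') \<Rightarrow> (\<Sum>\<alpha>\<in>UNIV. \<tau>' $ \<alpha>) \<noteq> 0)"


section \<open>Matrices and complete paths\<close>

definition mat_norm :: "real^'a::finite^'a \<Rightarrow> real" where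
  "mat_norm B = (\<Sum>\<alpha>\<in>UNIV. \<Sum>\<beta>\<in>UNIV. \<bar>B $ \<alpha> $ \<beta>\<bar>)"

definition arrow_matrix :: "'a::finite arrow \<Rightarrow> real^'a^'a" where
  "arrow_matrix a = mat 1 + (\<chi> \<alpha> \<beta>. if \<alpha> = loser a \<and> \<beta> = winner a then 1 else 0)"

primrec path_matrix_from :: "(int \<Rightarrow> 'a::finite arrow) \<Rightarrow> int \<Rightarrow> nat \<Rightarrow> real^'a^'a" where
  "path_matrix_from \<gamma> m 0 = mat 1"
| "path_matrix_from \<gamma> m (Suc k) = arrow_matrix (\<gamma> (m + int k + 1)) ** path_matrix_from \<gamma> m k"

text \<open>\<open>path_matrix \<gamma> m n\<close> is \<open>B(m,n)\<close> for \<open>m \<le> n\<close>.\<close>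

definition path_matrix :: "(int \<Rightarrow> 'a::finite arrow) \<Rightarrow> int \<Rightarrow> int \<Rightarrow> real^'a^'a" where
  "path_matrix \<gamma> m n = path_matrix_from \<gamma> m (nat (n - m))"

text \<open>Completeness of the finite path \<open>\<gamma> (m+1) \<star> \<dots> \<star> \<gamma> n\<close>.\<close>

definition complete_path :: "(int \<Rightarrow> 'a::finite arrow) \<Rightarrow> int \<Rightarrow> int \<Rightarrow> bool" where
  "complete_path \<gamma> m n \<longleftrightarrow> (\<forall>\<alpha>. \<exists>i\<in>{m+1..n}. winner (\<gamma> i) = \<alpha>)"

definition backward_infinity_complete :: "(int \<Rightarrow> 'a::finite arrow) \<Rightarrow> bool" where
  "backward_infinity_complete \<gamma> \<longleftrightarrow>
     (\<exists>m :: nat \<Rightarrow> int. m 0 = 0 \<and>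
        (\<forall>k. m (Suc k) < m k \<and> complete_path \<gamma> (m (Suc k)) (m k)))"


section \<open>Dual Roth type\<close>

text \<open>\<open>n_hat \<gamma> k\<close> is the index usually written as \<open>n\<close>-hat with subscript \<open>-k\<close>.\<close>

primrec n_hat :: "(int \<Rightarrow> 'a::finite arrow) \<Rightarrow> nat \<Rightarrow> int" where
  "n_hat \<gamma> 0 = 0"
| "n_hat \<gamma> (Suc k) = (GREATEST n. n < n_hat \<gamma> k \<and> complete_path \<gamma> n (n_hat \<gamma> k))"

text \<open>Operator norm of the restriction of \<open>A\<close> to the subspace \<open>H\<close>.\<close>

definition restricted_norm :: "real^'a::finite^'a \<Rightarrow> (real^'a) set \<Rightarrow> real" where
  "restricted_norm A H = (SUP v\<in>{v \<in> H. norm v \<le> 1}. norm (A *v v))"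

definition dual_hyperplane :: "'a::finite comb \<Rightarrow> real^'a \<Rightarrow> (real^'a) set" where
  "dual_hyperplane \<pi> \<tau> = {v. (\<Sum>\<alpha>\<in>UNIV. v $ \<alpha> * (- (Omega_mat \<pi> *v \<tau>)) $ \<alpha>) = 0}"

definition dual_Roth_type :: "'a::finite comb \<Rightarrow> real^'a \<Rightarrow> bool" where
  "dual_Roth_type \<pi> \<tau> \<longleftrightarrow>
     (let \<gamma> = backward_path \<pi> \<tau>; B = path_matrix \<gamma> in
        backward_defined \<pi> \<tau> \<and> backward_infinity_complete \<gamma> \<and>
        (\<forall>\<epsilon>>0. \<exists>C\<^sub>0>0. \<forall>k.
           mat_norm (B (n_hat \<gamma> (Suc k)) (n_hat \<gamma> k)) \<le> C\<^sub>0 * mat_norm (B (n_hat \<gamma> k) 0) powr \<epsilon>) \<and>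
        (\<exists>\<theta>>0. \<exists>C\<^sub>1>0. \<forall>n\<le>0.
           restricted_norm (transpose (B n 0)) (dual_hyperplane \<pi> \<tau>)
             \<le> C\<^sub>1 * mat_norm (transpose (B n 0)) powr (1 - \<theta>)))"


section \<open>Zorich time and Oseledets genericity\<close>

text \<open>
  A maximal block of arrows of the same type within \<open>\<gamma> (m+1), \<dots>, \<gamma> n\<close> is counted through
  its first arrow.
\<close>

definition num_blocks :: "(int \<Rightarrow> 'a::finite arrow) \<Rightarrow> int \<Rightarrow> int \<Rightarrow> nat" where
  "num_blocks \<gamma> m n =
     card {i \<in> {m+1..n}. i = m + 1 \<or> snd (\<gamma> i) \<noteq> snd (\<gamma> (i - 1))}"

definition zorich_time :: "(int \<Rightarrow> 'a::finite arrow) \<Rightarrow> int \<Rightarrow> int" where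
  "zorich_time \<gamma> n = (if 0 \<le> n then int (num_blocks \<gamma> 0 n) else - int (num_blocks \<gamma> n 0))"

text \<open>The two-sided cocycle \<open>B(0,n)\<close>, with \<open>B(0,n) = B(n,0)\<inverse>\<close> for \<open>n < 0\<close>.\<close>

definition cocycle :: "(int \<Rightarrow> 'a::finite arrow) \<Rightarrow> int \<Rightarrow> real^'a^'a" where
  "cocycle \<gamma> n = (if 0 \<le> n then path_matrix \<gamma> 0 n else matrix_inv (path_matrix \<gamma> n 0))"

text \<open>
  The vectors whose exponent is \<open>\<theta>\<close> both in the future and in the past.  At an Oseledets generic
  point the nonzero ones among these spaces are the summands of the Oseledets splitting.
\<close>

definition oseledets_space :: "(int \<Rightarrow> 'a::finite arrow) \<Rightarrow> real \<Rightarrow> (real^'a) set" where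
  "oseledets_space \<gamma> \<theta> =
     {v. v = 0 \<or>
         (\<forall>F\<in>{at_top, at_bot}.
            ((\<lambda>n. ln (norm (cocycle \<gamma> n *v v)) / real_of_int (zorich_time \<gamma> n)) \<longlongrightarrow> \<theta>) F)}"

definition lyapunov_spectrum :: "(int \<Rightarrow> 'a::finite arrow) \<Rightarrow> real set" where
  "lyapunov_spectrum \<gamma> = {\<theta>. oseledets_space \<gamma> \<theta> \<noteq> {0}}"

text \<open>
  Oseledets genericity (two-sided Lyapunov regularity): the Oseledets spaces split the whole space,
  and the growth rate of the determinant is the sum of the exponents counted with multiplicity.
\<close>

definition oseledets_generic :: "(int \<Rightarrow> 'a::finite arrow) \<Rightarrow> bool" where
  "oseledets_generic \<gamma> \<longleftrightarrow>
     finite (lyapunov_spectrum \<gamma>) \<and>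
     (\<forall>\<theta>. subspace (oseledets_space \<gamma> \<theta>)) \<and>
     span (\<Union>\<theta>\<in>lyapunov_spectrum \<gamma>. oseledets_space \<gamma> \<theta>) = UNIV \<and>
     (\<Sum>\<theta>\<in>lyapunov_spectrum \<gamma>. dim (oseledets_space \<gamma> \<theta>)) = CARD('a) \<and>
     (\<forall>F\<in>{at_top, at_bot}.
        ((\<lambda>n. ln \<bar>det (cocycle \<gamma> n)\<bar> / real_of_int (zorich_time \<gamma> n))
           \<longlongrightarrow> (\<Sum>\<theta>\<in>lyapunov_spectrum \<gamma>. real (dim (oseledets_space \<gamma> \<theta>)) * \<theta>)) F)"

definition top_exponent :: "(int \<Rightarrow> 'a::finite arrow) \<Rightarrow> real" where
  "top_exponent \<gamma> = Max (lyapunov_spectrum \<gamma>)"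

definition typical_point :: "'a::finite comb \<Rightarrow> real^'a \<Rightarrow> real^'a \<Rightarrow> bool" where
  "typical_point \<pi> len \<tau> \<longleftrightarrow>
     (let \<gamma> = rv_path \<pi> len \<tau>; E = oseledets_space \<gamma>; S = lyapunov_spectrum \<gamma> in
        comb_data \<pi> \<and> irreducible_comb \<pi> \<and> (\<forall>\<alpha>. len $ \<alpha> > 0) \<and> \<tau> \<in> suspension_cone \<pi> \<and>
        forward_defined \<pi> len \<tau> \<and> backward_defined \<pi> \<tau> \<and>
        oseledets_generic \<gamma> \<and>
        (\<Sum>\<theta>\<in>{\<theta> \<in> S. \<theta> > 0}. dim (E \<theta>)) = genus \<pi> \<and>
        dim (E 0) = num_sing \<pi> - 1 \<and>
        (\<Sum>\<theta>\<in>{\<theta> \<in> S. \<theta> < 0}. dim (E \<theta>)) = genus \<pi> \<and>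
        dim (E (top_exponent \<gamma>)) = 1)"

definition central_space :: "'a::finite comb \<Rightarrow> real^'a \<Rightarrow> real^'a \<Rightarrow> (real^'a) set" where
  "central_space \<pi> len \<tau> = oseledets_space (rv_path \<pi> len \<tau>) 0"

text \<open>
  The positive unit vector spanning the Oseledets line of the largest exponent.  At typical points it
  depends on \<open>(\<pi>, \<tau>)\<close> only; the parameter \<open>len\<close> is there because the Oseledets line is
  defined by means of the two-sided cocycle.
\<close>

definition q_vec :: "'a::finite comb \<Rightarrow> real^'a \<Rightarrow> real^'a \<Rightarrow> real^'a" where
  "q_vec \<pi> len \<tau> =
     (let \<gamma> = rv_path \<pi> len \<tau> in
        THE q. (\<forall>\<alpha>. q $ \<alpha> > 0) \<and> norm q = 1 \<and> span {q} = oseledets_space \<gamma> (top_exponent \<gamma>))"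


section \<open>The piecewise affine functions\<close>

definition B_mat :: "'a::finite comb \<Rightarrow> real^'a \<Rightarrow> real^'a \<Rightarrow> int \<Rightarrow> int \<Rightarrow> real^'a^'a" where
  "B_mat \<pi> len \<tau> = path_matrix (rv_path \<pi> len \<tau>)"

text \<open>For \<open>n \<le> 0\<close>, the vector \<open>v\<close> at level \<open>0\<close> pulled back to level \<open>n\<close>.\<close>

definition at_level ::
    "'a::finite comb \<Rightarrow> real^'a \<Rightarrow> real^'a \<Rightarrow> int \<Rightarrow> real^'a \<Rightarrow> real^'a" where
  "at_level \<pi> len \<tau> n v = matrix_inv (B_mat \<pi> len \<tau> n 0) *v v"

text \<open>The entries of \<open>B(n,0)\<close> are nonnegative integers, so the floor only changes the type.\<close>

definition return_time :: "'a::finite comb \<Rightarrow> real^'a \<Rightarrow> real^'a \<Rightarrow> int \<Rightarrow> 'a \<Rightarrow> nat" where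
  "return_time \<pi> len \<tau> n \<alpha> = nat \<lfloor>\<Sum>\<beta>\<in>UNIV. B_mat \<pi> len \<tau> n 0 $ \<alpha> $ \<beta>\<rfloor>"

definition itinerary :: "'a::finite comb \<Rightarrow> real^'a \<Rightarrow> real^'a \<Rightarrow> int \<Rightarrow> 'a \<Rightarrow> nat \<Rightarrow> 'a" where
  "itinerary \<pi> len \<tau> n \<alpha> j =
     (case rv_orbit \<pi> len \<tau> n of (\<pi>', len', _) \<Rightarrow>
        THE \<beta>. (iem \<pi>' len' ^^ j) ` top_interval \<pi> len \<alpha> \<subseteq> top_interval \<pi>' len' \<beta>)"

definition Sq :: "'a::finite comb \<Rightarrow> real^'a \<Rightarrow> real^'a \<Rightarrow> int \<Rightarrow> 'a \<Rightarrow> nat \<Rightarrow> real" where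
  "Sq \<pi> len \<tau> n \<alpha> l =
     (\<Sum>j<l. at_level \<pi> len \<tau> n (q_vec \<pi> len \<tau>) $ itinerary \<pi> len \<tau> n \<alpha> j)"

definition is_Omega_fun ::
    "'a::finite comb \<Rightarrow> real^'a \<Rightarrow> real^'a \<Rightarrow> real^'a \<Rightarrow> int \<Rightarrow> 'a \<Rightarrow> (real \<Rightarrow> real) \<Rightarrow> bool" where
  "is_Omega_fun \<pi> len \<tau> c n \<alpha> f \<longleftrightarrow>
     (let Q = q_vec \<pi> len \<tau> $ \<alpha>; S = Sq \<pi> len \<tau> n \<alpha> in
        continuous_on {0..Q} f \<and>
        (\<forall>l < return_time \<pi> len \<tau> n \<alpha>.
           (\<exists>a b. \<forall>x\<in>{S l..S (Suc l)}. f x = a * x + b) \<and>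
           f (S (Suc l)) - f (S l) = at_level \<pi> len \<tau> n c $ itinerary \<pi> len \<tau> n \<alpha> l) \<and>
        integral {0..Q} f = 0)"

text \<open>\<open>c\<close> is the vector written chi in the literature.  The function is extended by \<open>0\<close> outside
  \<open>[0, q\<^sub>\<alpha>]\<close> to make it unique as a function on the line.\<close>

definition Omega_fun ::
    "'a::finite comb \<Rightarrow> real^'a \<Rightarrow> real^'a \<Rightarrow> real^'a \<Rightarrow> int \<Rightarrow> 'a \<Rightarrow> real \<Rightarrow> real" where
  "Omega_fun \<pi> len \<tau> c n \<alpha> =
     (THE f. is_Omega_fun \<pi> len \<tau> c n \<alpha> f \<and> (\<forall>x. x \<notin> {0..q_vec \<pi> len \<tau> $ \<alpha>} \<longrightarrow> f x = 0))"


section \<open>Hoelder functions\<close>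

definition holder_on :: "real \<Rightarrow> real set \<Rightarrow> (real \<Rightarrow> real) \<Rightarrow> bool" where
  "holder_on \<eta> S \<psi> \<longleftrightarrow> (\<exists>C. \<forall>x\<in>S. \<forall>y\<in>S. \<bar>\<psi> x - \<psi> y\<bar> \<le> C * \<bar>x - y\<bar> powr \<eta>)"

text \<open>The pairs with \<open>x = y\<close> contribute \<open>0 / 0 = 0\<close>.\<close>

definition holder_norm :: "real \<Rightarrow> real set \<Rightarrow> (real \<Rightarrow> real) \<Rightarrow> real" where
  "holder_norm \<eta> S \<psi> =
     (SUP x\<in>S. \<bar>\<psi> x\<bar>) + (SUP (x, y)\<in>S \<times> S. \<bar>\<psi> x - \<psi> y\<bar> / \<bar>x - y\<bar> powr \<eta>)"

end

theory Submission
  imports Defs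
begin

text \<open>
  Levels are counted by \<open>k = -n \<ge> 0\<close>, and \<open>N k\<close> denotes the norm of \<open>B(-k,0)\<close>.  Going from level \<open>-k\<close> to level
  \<open>-(k+1)\<close> replaces the loser by a two-letter word and keeps the other letters.  The functions of the
  theorem at these two levels therefore agree, up to an additive constant, at the nodes of level \<open>-k\<close>, and
  between the nodes they differ by bumps whose shape depends on the letter only.  The constant vanishes
  when integrated against \<open>\<psi>\<close>, which has mean 0.

  To integrate the bumps against \<open>\<psi>\<close>, group the nodes into the intervals of a much coarser level \<open>-m\<close>.  On such
  an interval \<open>\<psi>\<close> is almost constant, so the integral is almost the scalar product of the vector \<open>d\<close> of bump
  integrals with the image of a vector \<open>v\<close> under the transpose of \<open>B(-k,0)\<close>, where \<open>v\<close> encodes the values of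
  \<open>\<psi>\<close> at the nodes of level \<open>-m\<close>.  The component of \<open>v\<close> in the direction of \<open>q\<close> is a Riemann sum of the integral of
  \<open>\<psi>\<close> and thus nearly \<open>0\<close>; on the hyperplane orthogonal to \<open>q\<close> the second condition of dual Roth type gives
  the factor \<open>N k powr - \<theta>\<close>.  Without these two gains the bound would be \<open>N k\<close> times the area of one bump, which
  is about \<open>1\<close>: the lengths \<open>q\<close> at level \<open>-k\<close> are at most \<open>N k powr (-1 + \<epsilon>)\<close> and the heights, governed by the
  central vector, at most \<open>N k powr \<epsilon>\<close>.  The price of the coarse level is a fixed power of \<open>N m\<close>, so \<open>N m\<close> is chosen
  as a small power of \<open>N k\<close> (\<open>step_at_level\<close>, \<open>one_step\<close>).  The steps are summed in \<open>many_steps\<close>.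

  Both the bound on the lengths and the summability rest on the column sums of \<open>B(-k,0)\<close>.  A backward step
  adds the loser's column to the winner's, and along the path a letter that stops winning loses to the
  winner that follows.  Hence the smallest column at least doubles along a complete path, and after a bounded number of
  complete paths every column is at least as large as all columns before (\<open>colsum_balanced\<close>).  With the first condition of dual
  Roth type, all columns have size \<open>N k\<close> up to a factor \<open>N k powr \<epsilon>\<close>, and \<open>q\<close> is the image
  under \<open>B(-k,0)\<close> of the positive vector of the lengths at level \<open>-k\<close>, which is thereby bounded (\<open>positive_orbit_decay\<close>), and there are
  few levels between successive complete times (\<open>sum_N_powr_bounded\<close>).

  Two facts connect this with the Oseledets data.  The heights \<open>h = - \<Omega> \<tau>\<close> stay positive along the backward
  orbit, therefore decay like \<open>1 / N k\<close>, and this is fast enough to force them into the line of the largest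
  exponent (\<open>h_top\<close>); so \<open>q\<close> exists and is the normalised \<open>h\<close>.  Since \<open>N k\<close> grows exponentially in Zorich time, a
  vector of exponent \<open>0\<close> is bounded by small powers of \<open>N k\<close> (\<open>central_small\<close>).  Finally \<open>follows_word\<close> identifies
  the itineraries of the exchange maps with the words produced by the substitutions.
\<close>

section \<open>Rows, the suspension cone and the positive vector of suspension data\<close>

definition is_row :: "('a::finite \<Rightarrow> nat) \<Rightarrow> bool" where
  "is_row p \<longleftrightarrow> bij_betw p UNIV {1..CARD('a)}"

lemma comb_data_row: "comb_data \<pi> \<longleftrightarrow> is_row (fst \<pi>) \<and> is_row (snd \<pi>)"
  by (simp add: comb_data_def is_row_def)

definition row_sum :: "('a::finite \<Rightarrow> nat) \<Rightarrow> real^'a \<Rightarrow> 'a \<Rightarrow> real" where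
  "row_sum p v \<alpha> = (\<Sum>\<beta> | p \<beta> < p \<alpha>. v $ \<beta>)"

lemma row_inj: "is_row p \<Longrightarrow> p \<alpha> = p \<beta> \<longleftrightarrow> \<alpha> = \<beta>"
  by (auto simp: is_row_def bij_betw_def inj_on_def)

lemma row_bounds: "is_row (p :: 'a::finite \<Rightarrow> nat) \<Longrightarrow> 1 \<le> p \<alpha> \<and> p \<alpha> \<le> CARD('a)"
  by (auto simp: is_row_def bij_betw_def)

lemma row_ex:
  assumes "is_row (p :: 'a::finite \<Rightarrow> nat)" "1 \<le> k" "k \<le> CARD('a)"
  obtains \<alpha> where "p \<alpha> = k"
proof -
  have "k \<in> range p" using assms by (simp add: is_row_def bij_betw_def)
  then show ?thesis using that by auto
qed

lemma last_letter_eqI: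
  assumes "is_row (p :: 'a::finite \<Rightarrow> nat)" "p \<alpha> = CARD('a)"
  shows "last_letter p = \<alpha>"
  unfolding last_letter_def
proof (rule the_equality)
  show "x = \<alpha>" if "p x = CARD('a)" for x
    using that assms(2) row_inj[OF assms(1), of x \<alpha>] by simp
qed (fact assms(2))

lemma last_letter_pos:
  assumes "is_row (p :: 'a::finite \<Rightarrow> nat)"
  shows "p (last_letter p) = CARD('a)"
proof -
  obtain \<alpha> where "p \<alpha> = CARD('a)"
    by (rule row_ex[OF assms, of "CARD('a)"]) (simp_all add: Suc_le_eq)
  then show ?thesis using last_letter_eqI[OF assms] by auto
qed

lemma next_letter_pos:
  assumes "is_row (p :: 'a::finite \<Rightarrow> nat)" "p w < CARD('a)"
  shows "p (next_letter p w) = p w + 1"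
proof -
  obtain \<alpha> where \<alpha>: "p \<alpha> = p w + 1"
    using row_ex[OF assms(1), of "p w + 1"] assms(2) by auto
  have "next_letter p w = \<alpha>"
    unfolding next_letter_def
  proof (rule the_equality)
    show "x = \<alpha>" if "p x = p w + 1" for x
      using that \<alpha> row_inj[OF assms(1), of x \<alpha>] by simp
  qed (fact \<alpha>)
  then show ?thesis using \<alpha> by simp
qed

lemma row_move_last:
  assumes "is_row (p :: 'a::finite \<Rightarrow> nat)"
  shows "is_row (move_last p l)"
proof -
  have inj: "inj_on (move_last p l) UNIV"
  proof (rule inj_onI)
    fix x y assume "move_last p l x = move_last p l y"
    then show "x = y"
      using row_bounds[OF assms, of x] row_bounds[OF assms, of y] row_bounds[OF assms, of l]
        row_inj[OF assms, of x y] row_inj[OF assms, of x l] row_inj[OF assms, of y l]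
      unfolding move_last_def by (smt (verit) Suc_diff_1 Suc_pred diff_less less_le_trans linorder_neqE_nat not_less_eq zero_less_one One_nat_def)
  qed
  have sub: "range (move_last p l) \<subseteq> {1..CARD('a)}"
  proof
    fix k assume "k \<in> range (move_last p l)"
    then obtain x where x: "k = move_last p l x" by auto
    show "k \<in> {1..CARD('a)}"
      using row_bounds[OF assms, of x] row_bounds[OF assms, of l] 
      by (auto simp: move_last_def x)
  qed
  have "range (move_last p l) = {1..CARD('a)}"
    by (rule card_subset_eq[OF _ sub]) (simp_all add: card_image[OF inj])
  with inj show ?thesis by (simp add: is_row_def bij_betw_def)
qed

lemma row_sum_last:
  assumes "is_row (p :: 'a::finite \<Rightarrow> nat)" "p w = CARD('a)"
  shows "row_sum p v w = (\<Sum>i\<in>UNIV. v $ i) - v $ w"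
proof -
  have "{\<beta>. p \<beta> < p w} = UNIV - {w}"
  proof (intro set_eqI)
    show "x \<in> {\<beta>. p \<beta> < p w} \<longleftrightarrow> x \<in> UNIV - {w}" for x
      using row_bounds[OF assms(1), of x] row_inj[OF assms(1), of x w] assms(2)
      by (auto simp: order.strict_iff_order)
  qed
  then show ?thesis by (simp add: row_sum_def sum_diff1)
qed

lemma row_sum_next:
  assumes "is_row (p :: 'a::finite \<Rightarrow> nat)" "p l = p w + 1"
  shows "row_sum p v l = row_sum p v w + v $ w"
proof -
  have "{\<beta>. p \<beta> < p l} = insert w {\<beta>. p \<beta> < p w}"
  proof (intro set_eqI)
    show "x \<in> {\<beta>. p \<beta> < p l} \<longleftrightarrow> x \<in> insert w {\<beta>. p \<beta> < p w}" for x
      using row_inj[OF assms(1), of x w] assms(2) by (auto simp: less_Suc_eq)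
  qed
  then show ?thesis by (simp add: row_sum_def)
qed

lemma row_sum_mono:
  assumes "\<And>\<alpha>. v $ \<alpha> \<ge> 0" "p \<alpha> < p \<beta>"
  shows "row_sum p v \<alpha> + v $ \<alpha> \<le> row_sum p v \<beta>"
proof -
  have "row_sum p v \<alpha> + v $ \<alpha> = (\<Sum>\<gamma>\<in>insert \<alpha> {\<gamma>. p \<gamma> < p \<alpha>}. v $ \<gamma>)" by (simp add: row_sum_def)
  also have "\<dots> \<le> row_sum p v \<beta>"
    unfolding row_sum_def using assms by (intro sum_mono2) auto
  finally show ?thesis .
qed

definition add_entry :: "'a::finite \<Rightarrow> 'a \<Rightarrow> real^'a \<Rightarrow> real^'a" where
  "add_entry w l v = (\<chi> \<alpha>. if \<alpha> = w then v $ \<alpha> + v $ l else v $ \<alpha>)"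

lemma sum_add_entry: "(\<Sum>\<alpha>\<in>UNIV. add_entry w l v $ \<alpha>) = (\<Sum>i\<in>UNIV. v $ i) + v $ l"
proof -
  have "(\<Sum>\<alpha>\<in>UNIV. add_entry w l v $ \<alpha>) = (\<Sum>\<alpha>\<in>UNIV. v $ \<alpha> + (if \<alpha> = w then v $ l else 0))"
    by (intro sum.cong) (auto simp: add_entry_def)
  then show ?thesis by (simp add: sum.distrib)
qed

lemma row_sum_add_entry_last:
  assumes "is_row (p :: 'a::finite \<Rightarrow> nat)" "p w = CARD('a)"
  shows "row_sum p (add_entry w l v) \<gamma> = row_sum p v \<gamma>"
  unfolding row_sum_def
proof (rule sum.cong)
  fix \<beta> assume "\<beta> \<in> {\<beta>. p \<beta> < p \<gamma>}"
  then have "\<beta> \<noteq> w" using row_bounds[OF assms(1), of \<gamma>] assms(2) by auto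
  then show "add_entry w l v $ \<beta> = v $ \<beta>" by (simp add: add_entry_def)
qed simp

text \<open>
  In the backward step the letter \<open>l\<close> standing right after the winner \<open>w\<close> leaves its place for the end
  of the row, and the entry of \<open>w\<close> grows by that of \<open>l\<close>: the letters behind \<open>l\<close> lose one summand from
  the sum on their left and get the same amount back from \<open>w\<close>.
\<close>

lemma row_sum_move_last:
  assumes "is_row (p :: 'a::finite \<Rightarrow> nat)" "p l = p w + 1" "\<gamma> \<noteq> l"
  shows "row_sum (move_last p l) (add_entry w l v) \<gamma> = row_sum p v \<gamma>"
proof (cases "p \<gamma> \<le> p w")
  case True
  have "{\<beta>. move_last p l \<beta> < move_last p l \<gamma>} = {\<beta>. p \<beta> < p \<gamma>}"
  proof (intro set_eqI)
    show "x \<in> {\<beta>. move_last p l \<beta> < move_last p l \<gamma>} \<longleftrightarrow> x \<in> {\<beta>. p \<beta> < p \<gamma>}" for x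
      using True assms(2,3) row_inj[OF assms(1), of x l] row_bounds[OF assms(1), of \<gamma>]
      by (auto simp: move_last_def)
  qed
  moreover have "(\<Sum>\<beta> | p \<beta> < p \<gamma>. add_entry w l v $ \<beta>) = (\<Sum>\<beta> | p \<beta> < p \<gamma>. v $ \<beta>)"
    using True by (intro sum.cong) (auto simp: add_entry_def)
  ultimately show ?thesis unfolding row_sum_def by (simp only:)
next
  case False
  then have gt: "p \<gamma> > p l" using assms row_inj[OF assms(1), of \<gamma> l] by (simp)
  have lw: "l \<noteq> w" using assms(2) by auto
  have "{\<beta>. move_last p l \<beta> < move_last p l \<gamma>} = {\<beta>. p \<beta> < p \<gamma>} - {l}"
  proof (intro set_eqI iffI)
    fix x assume "x \<in> {\<beta>. move_last p l \<beta> < move_last p l \<gamma>}"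
    then show "x \<in> {\<beta>. p \<beta> < p \<gamma>} - {l}"
      using gt row_bounds[OF assms(1), of \<gamma>] assms(3)
      by (auto simp: move_last_def split: if_splits)
  next
    fix x assume "x \<in> {\<beta>. p \<beta> < p \<gamma>} - {l}"
    then show "x \<in> {\<beta>. move_last p l \<beta> < move_last p l \<gamma>}"
      using gt row_bounds[OF assms(1), of \<gamma>] assms(3) row_inj[OF assms(1), of x l]
      by (auto simp: move_last_def split: if_splits)
  qed
  then have "row_sum (move_last p l) (add_entry w l v) \<gamma> = (\<Sum>\<beta>\<in>{\<beta>. p \<beta> < p \<gamma>} - {l}. add_entry w l v $ \<beta>)"
    unfolding row_sum_def by (simp only:)
  also have "\<dots> = (\<Sum>\<beta>\<in>{\<beta>. p \<beta> < p \<gamma>} - {l}. v $ \<beta> + (if \<beta> = w then v $ l else 0))"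
    by (intro sum.cong) (auto simp: add_entry_def)
  also have "\<dots> = row_sum p v \<gamma>"
    using gt assms(2) lw by (simp add: row_sum_def sum.distrib sum_diff1)
  finally show ?thesis .
qed

lemma row_sum_move_last_self:
  assumes "is_row (p :: 'a::finite \<Rightarrow> nat)" "p l = p w + 1"
  shows "row_sum (move_last p l) (add_entry w l v) l = (\<Sum>i\<in>UNIV. v $ i)"
proof -
  have "move_last p l l = CARD('a)" by (simp add: move_last_def)
  moreover have "l \<noteq> w" using assms(2) by auto
  ultimately show ?thesis
    using row_sum_last[OF row_move_last[OF assms(1), of l], of l "add_entry w l v"]
    by (simp add: sum_add_entry) (simp add: add_entry_def)
qed

lemma cone_iff:
  assumes "comb_data (\<pi> :: 'a::finite comb)"
  shows "\<tau> \<in> suspension_cone \<pi> \<longleftrightarrow>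
    (\<forall>\<gamma>. fst \<pi> \<gamma> > 1 \<longrightarrow> row_sum (fst \<pi>) \<tau> \<gamma> > 0) \<and> (\<forall>\<gamma>. snd \<pi> \<gamma> > 1 \<longrightarrow> row_sum (snd \<pi>) \<tau> \<gamma> < 0)"
proof -
  have r: "is_row (fst \<pi>)" "is_row (snd \<pi>)" using assms by (auto simp: comb_data_row)
  show ?thesis
  proof
    assume "\<tau> \<in> suspension_cone \<pi>"
    then show "(\<forall>\<gamma>. fst \<pi> \<gamma> > 1 \<longrightarrow> row_sum (fst \<pi>) \<tau> \<gamma> > 0) \<and> (\<forall>\<gamma>. snd \<pi> \<gamma> > 1 \<longrightarrow> row_sum (snd \<pi>) \<tau> \<gamma> < 0)"
      using row_bounds[OF r(1)] row_bounds[OF r(2)] by (auto simp: suspension_cone_def row_sum_def)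
  next
    assume a: "(\<forall>\<gamma>. fst \<pi> \<gamma> > 1 \<longrightarrow> row_sum (fst \<pi>) \<tau> \<gamma> > 0) \<and> (\<forall>\<gamma>. snd \<pi> \<gamma> > 1 \<longrightarrow> row_sum (snd \<pi>) \<tau> \<gamma> < 0)"
    show "\<tau> \<in> suspension_cone \<pi>"
      unfolding suspension_cone_def mem_Collect_eq
    proof (intro allI impI)
      fix k assume k: "1 < k \<and> k \<le> CARD('a)"
      obtain \<alpha> where \<alpha>: "fst \<pi> \<alpha> = k" by (rule row_ex[OF r(1), of k]) (use k in auto)
      obtain \<beta> where \<beta>: "snd \<pi> \<beta> = k" by (rule row_ex[OF r(2), of k]) (use k in auto)
      show "0 < (\<Sum>\<alpha> | fst \<pi> \<alpha> < k. \<tau> $ \<alpha>) \<and> (\<Sum>\<alpha> | snd \<pi> \<alpha> < k. \<tau> $ \<alpha>) < 0"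
        using a[THEN conjunct1, rule_format, of \<alpha>] a[THEN conjunct2, rule_format, of \<beta>] k
        by (simp add: row_sum_def \<alpha> \<beta>)
    qed
  qed
qed

lemma translation_row_sum: "translation \<pi> v \<alpha> = row_sum (snd \<pi>) v \<alpha> - row_sum (fst \<pi>) v \<alpha>"
  by (simp add: translation_def row_sum_def)

text \<open>
  The invariant of the backward algorithm on suspension data.
\<close>

definition suspension_pair :: "'a::finite comb \<times> (real^'a) \<Rightarrow> bool" where
  "suspension_pair = (\<lambda>(\<pi>, \<tau>). comb_data \<pi> \<and> \<tau> \<in> suspension_cone \<pi>)"

text \<open>
  The vector of heights of the zippered rectangles.  Displacement by the i.e.m. formula applied to \<open>\<tau>\<close> is
  linear in the data, so the relation between heights before and after a step is the same computation
  as for the translation lengths of the exchange itself.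
\<close>

definition hvec :: "'a::finite comb \<times> (real^'a) \<Rightarrow> real^'a" where
  "hvec = (\<lambda>(\<pi>, \<tau>). \<chi> \<alpha>. - translation \<pi> \<tau> \<alpha>)"

lemma hvec_eq: 
  assumes "comb_data \<pi>" shows "hvec (\<pi>, \<tau>) = - (Omega_mat \<pi> *v \<tau>)"
proof -
  have r: "is_row (fst \<pi>)" "is_row (snd \<pi>)" using assms by (auto simp: comb_data_row)
  have "(Omega_mat \<pi> *v \<tau>) $ \<alpha> = translation \<pi> \<tau> \<alpha>" for \<alpha>
  proof -
    have "(Omega_mat \<pi> *v \<tau>) $ \<alpha> = (\<Sum>\<beta>\<in>UNIV. (if snd \<pi> \<beta> < snd \<pi> \<alpha> then \<tau> $ \<beta> else 0) - (if fst \<pi> \<beta> < fst \<pi> \<alpha> then \<tau> $ \<beta> else 0))"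
      unfolding matrix_vector_mult_def Omega_mat_def
      using row_inj[OF r(1), of \<alpha>] row_inj[OF r(2), of \<alpha>]
      by (auto intro!: sum.cong simp: not_less order.order_iff_strict)
    also have "\<dots> = translation \<pi> \<tau> \<alpha>"
      by (simp add: translation_def sum_subtractf sum.If_cases)
    finally show ?thesis .
  qed
  then show ?thesis by (simp add: hvec_def vec_eq_iff)
qed

text \<open>
  Summed over all letters but the last one of a row, \<open>\<tau>\<close> is positive for the top row and negative for the
  bottom row.
\<close>

lemma last_letters_differ:
  assumes "suspension_pair (\<pi> :: 'a::finite comb, \<tau>)" "CARD('a) \<ge> 2"
  shows "last_letter (fst \<pi>) \<noteq> last_letter (snd \<pi>)"
proof
  assume eq: "last_letter (fst \<pi>) = last_letter (snd \<pi>)"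
  have c: "comb_data \<pi>" using assms by (simp add: suspension_pair_def)
  have r: "is_row (fst \<pi>)" "is_row (snd \<pi>)" using c by (auto simp: comb_data_row)
  have "row_sum (fst \<pi>) \<tau> (last_letter (fst \<pi>)) > 0" "row_sum (snd \<pi>) \<tau> (last_letter (snd \<pi>)) < 0"
    using assms cone_iff[OF c, of \<tau>] last_letter_pos[OF r(1)] last_letter_pos[OF r(2)]
    by (simp_all add: suspension_pair_def del: One_nat_def)
  then show False
    using row_sum_last[OF r(1) last_letter_pos[OF r(1)], of \<tau>] row_sum_last[OF r(2) last_letter_pos[OF r(2)], of \<tau>] eq
    by simp
qed

text \<open>
  The height of \<open>\<alpha>\<close> is a top partial sum of \<open>\<tau>\<close> minus a bottom one.  In the suspension cone the
  former are positive and the latter negative as soon as they are not empty; both are empty only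
  for a letter which comes first in both rows, and then its \<open>\<tau>\<close> entry would be positive and negative.
\<close>

lemma hvec_pos:
  assumes "suspension_pair (\<pi> :: 'a::finite comb, \<tau>)" "CARD('a) \<ge> 2"
  shows "hvec (\<pi>, \<tau>) $ \<alpha> > 0"
proof -
  have c: "comb_data \<pi>" using assms by (simp add: suspension_pair_def)
  have r: "is_row (fst \<pi>)" "is_row (snd \<pi>)" using c by (auto simp: comb_data_row)
  have cone: "\<tau> \<in> suspension_cone \<pi>" using assms by (simp add: suspension_pair_def)
  have t: "fst \<pi> \<alpha> = 1 \<Longrightarrow> row_sum (fst \<pi>) \<tau> \<alpha> = 0" and b: "snd \<pi> \<alpha> = 1 \<Longrightarrow> row_sum (snd \<pi>) \<tau> \<alpha> = 0"
  proof -
    have "{\<beta>. fst \<pi> \<beta> < 1} = {}" "{\<beta>. snd \<pi> \<beta> < 1} = {}"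
      using row_bounds[OF r(1)] row_bounds[OF r(2)] by (force simp: not_less Suc_le_eq)+
    then show "fst \<pi> \<alpha> = 1 \<Longrightarrow> row_sum (fst \<pi>) \<tau> \<alpha> = 0" "snd \<pi> \<alpha> = 1 \<Longrightarrow> row_sum (snd \<pi>) \<tau> \<alpha> = 0"
      by (simp_all only: row_sum_def sum.empty)
  qed
  have t': "fst \<pi> \<alpha> \<noteq> 1 \<Longrightarrow> row_sum (fst \<pi>) \<tau> \<alpha> > 0" and b': "snd \<pi> \<alpha> \<noteq> 1 \<Longrightarrow> row_sum (snd \<pi>) \<tau> \<alpha> < 0"
    using cone cone_iff[OF c, of \<tau>] row_bounds[OF r(1), of \<alpha>] row_bounds[OF r(2), of \<alpha>] by auto
  have "\<not> (fst \<pi> \<alpha> = 1 \<and> snd \<pi> \<alpha> = 1)"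
  proof
    assume one: "fst \<pi> \<alpha> = 1 \<and> snd \<pi> \<alpha> = 1"
    obtain x where x: "fst \<pi> x = 2" by (rule row_ex[OF r(1), of 2]) (use assms(2) in auto)
    obtain y where y: "snd \<pi> y = 2" by (rule row_ex[OF r(2), of 2]) (use assms(2) in auto)
    have "row_sum (fst \<pi>) \<tau> x = \<tau> $ \<alpha>" "row_sum (snd \<pi>) \<tau> y = \<tau> $ \<alpha>"
      using row_sum_next[OF r(1), of x \<alpha> \<tau>] row_sum_next[OF r(2), of y \<alpha> \<tau>] one x y t b by auto
    moreover have "row_sum (fst \<pi>) \<tau> x > 0" "row_sum (snd \<pi>) \<tau> y < 0"
      using cone cone_iff[OF c, of \<tau>] x y by auto
    ultimately show False by simp
  qed
  then show ?thesis
    using t b t' b' unfolding hvec_def translation_row_sum by (cases "fst \<pi> \<alpha> = 1"; cases "snd \<pi> \<alpha> = 1") auto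
qed

section \<open>The backward step and the first return\<close>

text \<open>
  \<open>\<pi>'\<close> is the source of the arrow of the given type with target \<open>\<pi>\<close>, winner \<open>w\<close> and loser \<open>l\<close>.  Having
  winner and loser as parameters makes the two types mirror images of each other.
\<close>

fun predecessor :: "step_type \<Rightarrow> 'a::finite comb \<Rightarrow> 'a comb \<Rightarrow> 'a \<Rightarrow> 'a \<Rightarrow> bool" where
  "predecessor Top \<pi> \<pi>' w l \<longleftrightarrow> fst \<pi> w = CARD('a) \<and> snd \<pi> l = snd \<pi> w + 1 \<and>
     \<pi>' = (fst \<pi>, move_last (snd \<pi>) l)"
| "predecessor Bottom \<pi> \<pi>' w l \<longleftrightarrow> snd \<pi> w = CARD('a) \<and> fst \<pi> l = fst \<pi> w + 1 \<and>
     \<pi>' = (move_last (fst \<pi>) l, snd \<pi>)"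

lemma predecessor_neq: "predecessor ty \<pi> \<pi>' w l \<Longrightarrow> w \<noteq> l"
  by (cases ty) auto

lemma predecessor_comb:
  "comb_data \<pi> \<Longrightarrow> predecessor ty \<pi> \<pi>' w l \<Longrightarrow> comb_data \<pi>'"
  by (cases ty) (auto simp: comb_data_row row_move_last)

lemma predecessor_winner:
  "comb_data \<pi> \<Longrightarrow> predecessor ty \<pi> \<pi>' w l \<Longrightarrow> winner (\<pi>', ty) = w"
  by (cases ty) (auto simp: comb_data_row last_letter_eqI)

lemma predecessor_loser:
  "comb_data \<pi> \<Longrightarrow> predecessor ty \<pi> \<pi>' w l \<Longrightarrow> loser (\<pi>', ty) = l"
proof -
  have "last_letter (move_last p l) = l" if "is_row p" for p :: "'a \<Rightarrow> nat"
    by (rule last_letter_eqI[OF row_move_last[OF that]]) (simp add: move_last_def)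
  then show "comb_data \<pi> \<Longrightarrow> predecessor ty \<pi> \<pi>' w l \<Longrightarrow> loser (\<pi>', ty) = l"
    by (cases ty) (auto simp: comb_data_row)
qed

lemma predecessor_translation:
  assumes "comb_data \<pi>" "predecessor ty \<pi> \<pi>' w l" "\<beta> \<noteq> l"
  shows "translation \<pi>' (add_entry w l v) \<beta> = translation \<pi> v \<beta>"
  using assms
  by (cases ty) (auto simp: translation_row_sum comb_data_row row_sum_add_entry_last row_sum_move_last)

lemma add_entry_winner: "add_entry w l v $ w = v $ w + v $ l"
  by (simp add: add_entry_def)

text \<open>
  The loser's return to the short interval takes two steps of the longer one, through the intervals of
  loser and winner in some order.
\<close>

lemma predecessor_translation_loser:
  assumes "comb_data \<pi>" "predecessor ty \<pi> \<pi>' w l"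
  shows "translation \<pi>' (add_entry w l v) l + translation \<pi>' (add_entry w l v) w = translation \<pi> v l"
  using assms predecessor_neq[OF assms(2)]
  by (cases ty) (auto simp: translation_row_sum comb_data_row row_sum_add_entry_last row_sum_move_last
      row_sum_move_last_self row_sum_last row_sum_next sum_add_entry add_entry_winner)

lemma predecessor_cone:
  assumes "comb_data \<pi>" "predecessor ty \<pi> \<pi>' w l" "\<tau> \<in> suspension_cone \<pi>"
    and "if ty = Top then (\<Sum>i\<in>UNIV. \<tau> $ i) < 0 else (\<Sum>i\<in>UNIV. \<tau> $ i) > 0"
  shows "add_entry w l \<tau> \<in> suspension_cone \<pi>'"
proof -
  have key: "(\<forall>\<gamma>. move_last p l \<gamma> > 1 \<longrightarrow> P (row_sum (move_last p l) (add_entry w l \<tau>) \<gamma>))"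
    if "is_row p" "p l = p w + 1" "\<forall>\<gamma>. p \<gamma> > 1 \<longrightarrow> P (row_sum p \<tau> \<gamma>)" "P (\<Sum>i\<in>UNIV. \<tau> $ i)" for p P
  proof (intro allI impI)
    fix \<gamma> assume g: "1 < move_last p l \<gamma>"
    show "P (row_sum (move_last p l) (add_entry w l \<tau>) \<gamma>)"
    proof (cases "\<gamma> = l")
      case True
      then show ?thesis using that by (simp add: row_sum_move_last_self)
    next
      case False
      then have "p \<gamma> > 1" using g by (auto simp: move_last_def split: if_splits)
      then show ?thesis using that False by (simp add: row_sum_move_last)
    qed
  qed
  show ?thesis
    using assms key[of "snd \<pi>" "\<lambda>x. x < 0"] key[of "fst \<pi>" "\<lambda>x. x > 0"]
    unfolding cone_iff[OF predecessor_comb[OF assms(1,2)]] cone_iff[OF assms(1)]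
    by (cases ty) (auto simp: comb_data_row row_sum_add_entry_last)
qed

lemma bwd_arrow_predecessor:
  assumes "suspension_pair (\<pi> :: 'a::finite comb, \<tau>)" "CARD('a) \<ge> 2"
  defines "a \<equiv> bwd_arrow \<pi> \<tau>"
  shows "predecessor (snd a) \<pi> (fst a) (winner a) (loser a)"
proof -
  have c: "comb_data \<pi>" using assms by (simp add: suspension_pair_def)
  have r: "is_row (fst \<pi>)" "is_row (snd \<pi>)" using c by (auto simp: comb_data_row)
  note lp = last_letter_pos[OF r(1)] last_letter_pos[OF r(2)]
  note d = last_letters_differ[OF assms(1,2)]
  have "snd \<pi> (last_letter (fst \<pi>)) < CARD('a)"
    using d row_inj[OF r(2), of "last_letter (fst \<pi>)" "last_letter (snd \<pi>)"] row_bounds[OF r(2), of "last_letter (fst \<pi>)"] lp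
    by simp
  note 1 = next_letter_pos[OF r(2) this]
  have "fst \<pi> (last_letter (snd \<pi>)) < CARD('a)"
    using d row_inj[OF r(1), of "last_letter (fst \<pi>)" "last_letter (snd \<pi>)"] row_bounds[OF r(1), of "last_letter (snd \<pi>)"] lp
    by simp
  note 2 = next_letter_pos[OF r(1) this]
  obtain ty where a: "a = (arrow_source ty \<pi>, ty)" by (simp add: a_def bwd_arrow_def Let_def)
  show ?thesis
  proof (cases ty)
    case Top
    then have p: "predecessor Top \<pi> (fst a) (last_letter (fst \<pi>)) (next_letter (snd \<pi>) (last_letter (fst \<pi>)))"
      using 1 lp by (simp add: a)
    show ?thesis
      using p predecessor_winner[OF c p] predecessor_loser[OF c p] by (simp add: a Top)
  next
    case Bottom
    then have p: "predecessor Bottom \<pi> (fst a) (last_letter (snd \<pi>)) (next_letter (fst \<pi>) (last_letter (snd \<pi>)))"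
      using 2 lp by (simp add: a)
    show ?thesis
      using p predecessor_winner[OF c p] predecessor_loser[OF c p] by (simp add: a Bottom)
  qed
qed

lemma augment_add_entry: "augment a v = add_entry (winner a) (loser a) v"
  by (simp add: augment_def add_entry_def)

lemma bwd_pair_suspension:
  assumes "suspension_pair (\<pi> :: 'a::finite comb, \<tau>)" "CARD('a) \<ge> 2" "(\<Sum>i\<in>UNIV. \<tau> $ i) \<noteq> 0"
  shows "suspension_pair (bwd_pair (\<pi>, \<tau>))"
proof -
  define a where "a = bwd_arrow \<pi> \<tau>"
  have p: "predecessor (snd a) \<pi> (fst a) (winner a) (loser a)"
    unfolding a_def by (rule bwd_arrow_predecessor[OF assms(1,2)])
  have z: "comb_data \<pi>" "\<tau> \<in> suspension_cone \<pi>" using assms(1) by (auto simp: suspension_pair_def)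
  have s: "if snd a = Top then (\<Sum>i\<in>UNIV. \<tau> $ i) < 0 else (\<Sum>i\<in>UNIV. \<tau> $ i) > 0"
    using assms(3) by (simp add: a_def bwd_arrow_def Let_def)
  have e: "bwd_pair (\<pi>, \<tau>) = (fst a, add_entry (winner a) (loser a) \<tau>)"
    by (simp add: bwd_pair_def Let_def a_def augment_add_entry)
  show ?thesis
    unfolding e suspension_pair_def
    using predecessor_comb[OF z(1) p] predecessor_cone[OF z(1) p z(2) s] by simp
qed

lemma top_interval_row_sum:
  "top_interval \<pi> v \<alpha> = {row_sum (fst \<pi>) v \<alpha> <..< row_sum (fst \<pi>) v \<alpha> + v $ \<alpha>}"
  by (simp add: top_interval_def row_sum_def)

lemma top_intervals_disjoint:
  assumes "comb_data \<pi>" "\<And>\<alpha>. v $ \<alpha> \<ge> 0" "x \<in> top_interval \<pi> v \<alpha>" "x \<in> top_interval \<pi> v \<beta>"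
  shows "\<alpha> = \<beta>"
proof (rule ccontr)
  assume "\<alpha> \<noteq> \<beta>"
  then have "fst \<pi> \<alpha> < fst \<pi> \<beta> \<or> fst \<pi> \<beta> < fst \<pi> \<alpha>"
    using assms(1) row_inj[of "fst \<pi>" \<alpha> \<beta>] by (auto simp: comb_data_row)
  then show False
    using row_sum_mono[of v "fst \<pi>" \<alpha> \<beta>] row_sum_mono[of v "fst \<pi>" \<beta> \<alpha>] assms(2-4)
    by (auto simp: top_interval_row_sum)
qed

lemma iem_apply:
  assumes "comb_data \<pi>" "\<And>\<alpha>. v $ \<alpha> \<ge> 0" "x \<in> top_interval \<pi> v \<alpha>"
  shows "iem \<pi> v x = x + translation \<pi> v \<alpha>"
proof -
  have "{\<alpha>. x \<in> top_interval \<pi> v \<alpha>} = {\<alpha>}"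
    using top_intervals_disjoint[OF assms(1,2)] assms(3) by blast
  then show ?thesis by (simp add: iem_def)
qed

text \<open>
  The visits to the longer interval during one step on the shorter one.  The loser goes first for the top
  type, where its own top interval is unchanged; for the bottom type its new top interval is the right
  end of the old one of the winner.
\<close>

definition split_word :: "'a::finite arrow \<Rightarrow> 'a \<Rightarrow> 'a list" where
  "split_word a \<beta> = (if \<beta> \<noteq> loser a then [\<beta>] else if snd a = Top then [loser a, winner a] else [winner a, loser a])"

primrec follows :: "'a::finite comb \<Rightarrow> real^'a \<Rightarrow> 'a list \<Rightarrow> real \<Rightarrow> bool" where
  "follows \<pi> v [] x \<longleftrightarrow> True"
| "follows \<pi> v (b # bs) x \<longleftrightarrow> x \<in> top_interval \<pi> v b \<and> follows \<pi> v bs (iem \<pi> v x)"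

lemma follows_append:
  "follows \<pi> v (xs @ ys) x \<longleftrightarrow> follows \<pi> v xs x \<and> follows \<pi> v ys ((iem \<pi> v ^^ length xs) x)"
  by (induction xs arbitrary: x) (auto simp: funpow_swap1)

lemma follows_nth:
  "follows \<pi> v bs x \<Longrightarrow> j < length bs \<Longrightarrow> (iem \<pi> v ^^ j) x \<in> top_interval \<pi> v (bs ! j)"
  by (induction bs arbitrary: x j) (auto simp: funpow_swap1 nth_Cons split: nat.split)

text \<open>
  The exchange on the short interval is the first return map of the exchange on the long one.  Apart from
  the loser, left endpoints and translations agree.  The first image of the loser is the piece by which the
  long interval exceeds the short one; from there the second step completes the translation.
\<close>

lemma predecessor_iem:
  assumes c: "comb_data \<pi>" and p: "predecessor ty \<pi> \<pi>' w l" and pos: "\<And>\<alpha>. v $ \<alpha> > 0"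
    and x: "x \<in> top_interval \<pi> v \<beta>"
  defines "v' \<equiv> add_entry w l v"
  shows "follows \<pi>' v' (split_word (\<pi>', ty) \<beta>) x \<and> 
    (iem \<pi>' v' ^^ length (split_word (\<pi>', ty) \<beta>)) x = iem \<pi> v x"
proof -
  note wl = predecessor_winner[OF c p] predecessor_loser[OF c p]
  note ne = predecessor_neq[OF p]
  have sw: "split_word (\<pi>', ty) \<gamma> = (if \<gamma> \<noteq> l then [\<gamma>] else if ty = Top then [l, w] else [w, l])" for \<gamma>
    by (simp only: split_word_def wl snd_conv)
  note c' = predecessor_comb[OF c p]
  have r: "is_row (fst \<pi>)" "is_row (snd \<pi>)" using c by (auto simp: comb_data_row)
  have pos': "v' $ \<alpha> \<ge> v $ \<alpha>" for \<alpha> using pos[of \<alpha>] pos[of l] by (simp add: v'_def add_entry_def)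
  have nn: "v $ \<alpha> \<ge> 0" "v' $ \<alpha> \<ge> 0" for \<alpha> using pos'[of \<alpha>] pos[of \<alpha>] by simp_all
  have v'w: "v' $ w = v $ w + v $ l" "v' $ l = v $ l" using ne by (simp_all add: v'_def add_entry_def)
  have T: "iem \<pi> v x = x + translation \<pi> v \<beta>" by (rule iem_apply[OF c nn(1) x])
  have T': "y \<in> top_interval \<pi>' v' \<gamma> \<Longrightarrow> iem \<pi>' v' y = y + translation \<pi>' v' \<gamma>" for y \<gamma>
    by (rule iem_apply[OF c' nn(2)])
  have tr: "translation \<pi>' v' l + translation \<pi>' v' w = translation \<pi> v l"
    unfolding v'_def by (rule predecessor_translation_loser[OF c p])
  show ?thesis
  proof (cases "\<beta> = l")
    case False
    have "row_sum (fst \<pi>') v' \<beta> = row_sum (fst \<pi>) v \<beta>"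
      using p r False unfolding v'_def by (cases ty) (auto simp: row_sum_add_entry_last row_sum_move_last)
    then have in': "x \<in> top_interval \<pi>' v' \<beta>"
      using x pos'[of \<beta>] by (auto simp: top_interval_row_sum)
    have "translation \<pi>' v' \<beta> = translation \<pi> v \<beta>"
      unfolding v'_def by (rule predecessor_translation[OF c p False])
    then show ?thesis using in' T'[OF in'] T False by (simp add: sw)
  next
    case True
    show ?thesis
    proof (cases ty)
      case Top
      have s: "row_sum (fst \<pi>') v' \<gamma> = row_sum (fst \<pi>) v \<gamma>" for \<gamma>
        using p r Top unfolding v'_def by (auto simp: row_sum_add_entry_last)
      have in1: "x \<in> top_interval \<pi>' v' l"
        using x pos'[of l] True by (auto simp: top_interval_row_sum s)
      have "translation \<pi>' v' l = (\<Sum>i\<in>UNIV. v $ i) - row_sum (fst \<pi>) v l"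
        using p r Top s by (auto simp: translation_row_sum v'_def row_sum_move_last_self)
      moreover have "row_sum (fst \<pi>) v w = (\<Sum>i\<in>UNIV. v $ i) - v $ w"
        using row_sum_last[OF r(1)] p Top by simp
      ultimately have in2: "x + translation \<pi>' v' l \<in> top_interval \<pi>' v' w"
        using x True pos[of w] by (auto simp: top_interval_row_sum s v'w)
      show ?thesis
        using in1 in2 T'[OF in1] T'[OF in2] tr True T
        by (simp add: sw[unfolded Top] Top numeral_2_eq_2)
    next
      case Bottom
      have "row_sum (fst \<pi>') v' w = row_sum (fst \<pi>) v w" "row_sum (fst \<pi>) v l = row_sum (fst \<pi>) v w + v $ w"
        using p r ne Bottom unfolding v'_def by (auto simp: row_sum_move_last row_sum_next)
      then have in1: "x \<in> top_interval \<pi>' v' w"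
        using x True pos[of w] by (auto simp: top_interval_row_sum v'w)
      have "translation \<pi>' v' w = translation \<pi> v w"
        unfolding v'_def by (rule predecessor_translation[OF c p ne])
      also have "\<dots> = (\<Sum>i\<in>UNIV. v $ i) - v $ w - row_sum (fst \<pi>) v w"
        using p r Bottom by (simp add: translation_row_sum row_sum_last)
      finally have in2: "x + translation \<pi>' v' w \<in> top_interval \<pi>' v' l"
        using x True p r Bottom 
        by (auto simp: top_interval_row_sum v'w) 
           (auto simp: v'_def row_sum_move_last_self row_sum_next)
      show ?thesis
        using in1 in2 T'[OF in1] T'[OF in2] tr True T ne
        by (simp add: sw[unfolded Bottom] Bottom numeral_2_eq_2)
    qed
  qed
qed

lemma predecessor_follows:
  assumes c: "comb_data \<pi>" and p: "predecessor ty \<pi> \<pi>' w l" and pos: "\<And>\<alpha>. v $ \<alpha> > 0"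
  defines "v' \<equiv> add_entry w l v"
  shows "follows \<pi> v bs x \<Longrightarrow> follows \<pi>' v' (concat (map (split_word (\<pi>', ty)) bs)) x"
proof (induction bs arbitrary: x)
  case (Cons b bs)
  then show ?case
    using predecessor_iem[OF c p pos, of x b] by (simp add: follows_append v'_def)
qed simp

section \<open>Matrices and words along a backward path\<close>

lemma mat_norm_nonneg [simp]: "mat_norm X \<ge> 0"
  by (simp add: mat_norm_def sum_nonneg)

lemma entry_le_mat_norm: "\<bar>X $ a $ b\<bar> \<le> mat_norm X"
proof -
  have "\<bar>X $ a $ b\<bar> \<le> (\<Sum>b\<in>UNIV. \<bar>X $ a $ b\<bar>)" by (rule member_le_sum) auto
  also have "\<dots> \<le> mat_norm X" unfolding mat_norm_def by (rule member_le_sum) (auto simp: sum_nonneg)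
  finally show ?thesis .
qed

lemma mat_norm_transpose: "mat_norm (transpose X) = mat_norm X"
  unfolding mat_norm_def transpose_def by (subst sum.swap) simp

lemma mat_norm_mult: "mat_norm (X ** Y) \<le> mat_norm X * mat_norm Y"
proof -
  have "mat_norm (X ** Y) \<le> (\<Sum>a\<in>UNIV. \<Sum>b\<in>UNIV. \<Sum>k\<in>UNIV. \<bar>X$a$k\<bar> * \<bar>Y$k$b\<bar>)"
    unfolding mat_norm_def matrix_matrix_mult_def
    by (intro sum_mono) (auto intro!: order_trans[OF sum_abs] sum_mono simp: abs_mult)
  also have "\<dots> = (\<Sum>a\<in>UNIV. \<Sum>k\<in>UNIV. \<bar>X$a$k\<bar> * (\<Sum>b\<in>UNIV. \<bar>Y$k$b\<bar>))"
    by (simp add: sum_distrib_left) (intro sum.cong refl sum.swap)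
  also have "\<dots> \<le> (\<Sum>a\<in>UNIV. \<Sum>k\<in>UNIV. \<bar>X$a$k\<bar> * mat_norm Y)"
    unfolding mat_norm_def
    by (intro sum_mono mult_left_mono member_le_sum[where f="\<lambda>k. \<Sum>b\<in>UNIV. \<bar>Y$k$b\<bar>"]) (auto simp: sum_nonneg)
  also have "\<dots> = mat_norm X * mat_norm Y"
    by (simp add: mat_norm_def sum_distrib_right)
  finally show ?thesis .
qed

lemma norm_mult_vec_le: "norm (X *v v) \<le> mat_norm X * norm v"
proof -
  have "norm (X *v v) \<le> (\<Sum>a\<in>UNIV. \<bar>(X *v v) $ a\<bar>)" by (rule norm_le_l1_cart)
  also have "\<dots> \<le> (\<Sum>a\<in>UNIV. \<Sum>b\<in>UNIV. \<bar>X$a$b\<bar> * norm v)"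
    unfolding matrix_vector_mult_def
    by (intro sum_mono) (auto intro!: order_trans[OF sum_abs] sum_mono mult_left_mono component_le_norm_cart simp: abs_mult)
  also have "\<dots> = mat_norm X * norm v" by (simp add: mat_norm_def sum_distrib_right)
  finally show ?thesis .
qed

lemma arrow_matrix_mult_vec:
  "(arrow_matrix a *v v) $ b = v $ b + (if b = loser a then v $ winner a else 0)"
proof -
  have "(arrow_matrix a *v v) $ b =
      (\<Sum>j\<in>UNIV. (if b = j then v $ j else 0) + (if j = winner a then (if b = loser a then v $ j else 0) else 0))"
    unfolding matrix_vector_mult_def arrow_matrix_def mat_def
    by (auto intro!: sum.cong simp: algebra_simps)
  then show ?thesis by (simp add: sum.distrib)
qed

lemma arrow_matrix_split_word:
  "(arrow_matrix a *v v) $ b = (\<Sum>x\<leftarrow>split_word a b. v $ x)"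
  by (simp add: arrow_matrix_mult_vec split_word_def)

lemma det_arrow_matrix:
  assumes "winner a \<noteq> loser a"
  shows "det (arrow_matrix a) = 1"
proof -
  have "arrow_matrix a = (\<chi> k. if k = loser a then row (loser a) (mat 1) + 1 *s row (winner a) (mat 1) else row k (mat 1))"
    by (auto simp: arrow_matrix_def vec_eq_iff row_def mat_def)
  then show ?thesis
    using det_row_operation[of "loser a" "winner a" "mat 1 :: real^'a^'a" 1] assms by simp
qed

lemma det_le_power:
  fixes X :: "real^'n^'n"
  assumes "\<And>i j. \<bar>X $ i $ j\<bar> \<le> r"
  shows "\<bar>det X\<bar> \<le> fact CARD('n) * r ^ CARD('n)"
proof -
  have "\<bar>det X\<bar> \<le> (\<Sum>p | p permutes (UNIV :: 'n set). \<bar>of_int (sign p) * (\<Prod>i\<in>UNIV. X $ i $ p i)\<bar>)"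
    unfolding det_def by (rule sum_abs)
  also have "\<dots> \<le> (\<Sum>p | p permutes (UNIV :: 'n set). r ^ CARD('n))"
  proof (rule sum_mono)
    fix p :: "'n \<Rightarrow> 'n"
    have "\<bar>of_int (sign p) * (\<Prod>i\<in>UNIV. X $ i $ p i)\<bar> = (\<Prod>i\<in>UNIV. \<bar>X $ i $ p i\<bar>)"
      by (simp add: abs_mult sign_def abs_prod)
    also have "\<dots> \<le> (\<Prod>i\<in>(UNIV::'n set). r)" using assms by (intro prod_mono) auto
    finally show "\<bar>of_int (sign p) * (\<Prod>i\<in>UNIV. X $ i $ p i)\<bar> \<le> r ^ CARD('n)" by simp
  qed
  also have "\<dots> = fact CARD('n) * r ^ CARD('n)"
    by (simp add: card_permutations[OF refl])
  finally show ?thesis .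
qed

text \<open>
  Cramer's rule: the inverse of a matrix of determinant 1 is bounded by a power of the matrix.  The inverse
  will be taken at a level whose norm is a small power of the norm of interest, which absorbs the exponent.
\<close>

lemma norm_le_of_det_1:
  fixes X :: "real^'n^'n"
  assumes "det X = 1" "mat_norm X \<ge> 1"
  shows "norm v \<le> CARD('n) * fact CARD('n) * mat_norm X ^ CARD('n) * norm (X *v v)"
proof -
  define K where "K = fact CARD('n) * mat_norm X ^ CARD('n)"
  have unit: "norm v \<le> CARD('n) * K" if "norm (X *v v) \<le> 1" for v :: "real^'n"
  proof -
    have "v = (\<chi> k. det (\<chi> i j. if j = k then (X *v v) $ i else X $ i $ j) / det X)"
      using cramer[of X v "X *v v"] assms(1) by simp
    then have "v $ k = det (\<chi> i j. if j = k then (X *v v) $ i else X $ i $ j)" for k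
      using assms(1) by (metis (no_types, lifting) div_by_1 vec_lambda_beta)
    moreover have "\<bar>det (\<chi> i j. if j = k then (X *v v) $ i else X $ i $ j)\<bar> \<le> K" for k
      unfolding K_def
    proof (rule det_le_power)
      fix i j
      have "\<bar>(X *v v) $ i\<bar> \<le> mat_norm X" using component_le_norm_cart[of "X *v v" i] that assms(2) by linarith
      then show "\<bar>(\<chi> i j. if j = k then (X *v v) $ i else X $ i $ j) $ i $ j\<bar> \<le> mat_norm X"
        using entry_le_mat_norm[of X i j] by simp
    qed
    ultimately have "\<bar>v $ k\<bar> \<le> K" for k by simp
    then have "(\<Sum>k\<in>UNIV. \<bar>v $ k\<bar>) \<le> (\<Sum>k\<in>(UNIV::'n set). K)" by (intro sum_mono) auto
    then show ?thesis using norm_le_l1_cart[of v] by simp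
  qed
  show ?thesis
  proof (cases "X *v v = 0")
    case True
    then have "v = 0" 
      using assms(1) by (metis det_nz_iff_inj inj_matrix_vector_mult invertible_det_nz matrix_vector_mul_assoc matrix_left_invertible_ker invertible_left_inverse zero_neq_one)
    then show ?thesis by simp
  next
    case False
    define s where "s = norm (X *v v)"
    have s: "s > 0" using False by (simp add: s_def)
    have "X *v ((1/s) *\<^sub>R v) = (1/s) *\<^sub>R (X *v v)"
      by (simp add: matrix_vector_mult_scaleR)
    then have "norm (X *v ((1/s) *\<^sub>R v)) \<le> 1" using s by (simp add: s_def)
    from unit[OF this] have "norm v / s \<le> CARD('n) * K" using s by simp
    then show ?thesis using s by (simp add: K_def s_def field_simps)
  qed
qed

text \<open>
  The sequence \<open>A i = \<gamma> (- i)\<close> lists the backward path, the arrow \<open>A i\<close> leading from level \<open>-(i+1)\<close> to level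
  \<open>-i\<close>.  Then \<open>word A j k a\<close> is the itinerary of the letter \<open>a\<close> of level \<open>-j\<close> among the letters of level
  \<open>-(j+k)\<close>, and \<open>bmat A j k\<close> below is \<open>B(-(j+k), -j)\<close>, which counts the occurrences of letters in it.
\<close>

primrec word :: "(nat \<Rightarrow> 'a::finite arrow) \<Rightarrow> nat \<Rightarrow> nat \<Rightarrow> 'a \<Rightarrow> 'a list" where
  "word A j 0 a = [a]"
| "word A j (Suc k) a = concat (map (split_word (A (j + k))) (word A j k a))"

primrec bmat :: "(nat \<Rightarrow> 'a::finite arrow) \<Rightarrow> nat \<Rightarrow> nat \<Rightarrow> real^'a^'a" where
  "bmat A j 0 = mat 1"
| "bmat A j (Suc k) = bmat A j k ** arrow_matrix (A (j + k))"

text \<open>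
  Paths are built by prolonging them at their end, whereas the backward algorithm adds arrows at their
  beginning.
\<close>

lemma path_matrix_from_lower:
  "path_matrix_from \<gamma> (m - 1) (Suc k) = path_matrix_from \<gamma> m k ** arrow_matrix (\<gamma> m)"
proof (induction k)
  case (Suc k)
  have "path_matrix_from \<gamma> (m - 1) (Suc (Suc k)) = 
      arrow_matrix (\<gamma> (m + int k + 1)) ** path_matrix_from \<gamma> (m - 1) (Suc k)"
    by (simp add: algebra_simps)
  then show ?case unfolding Suc by (simp add: matrix_mul_assoc)
qed (simp add: matrix_mul_lid)

lemma path_matrix_bmat:
  "path_matrix \<gamma> (- int (j + k)) (- int j) = bmat (\<lambda>i. \<gamma> (- int i)) j k"
proof -
  have "path_matrix_from \<gamma> (- int (j + k)) k = bmat (\<lambda>i. \<gamma> (- int i)) j k"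
  proof (induction k)
    case (Suc k)
    have e: "- int (j + Suc k) = - int (j + k) - 1" by simp
    show ?case unfolding e path_matrix_from_lower Suc by simp
  qed simp
  then show ?thesis by (simp add: path_matrix_def)
qed

lemma bmat_add: "bmat A j (k + l) = bmat A j k ** bmat A (j + k) l"
  by (induction l) (simp_all add: matrix_mul_assoc add.assoc)

lemma word_add: "word A j (k + l) a = concat (map (word A (j + k) l) (word A j k a))"
proof (induction l)
  case 0
  show ?case by (simp add: concat_map_singleton)
next
  case (Suc l)
  have "concat (map f (concat (map g xs))) = concat (map (\<lambda>x. concat (map f (g x))) xs)" 
    for f :: "'a \<Rightarrow> 'a list" and g xs
    by (induction xs) auto
  then show ?case by (simp add: Suc add.assoc)
qed

lemma bmat_word: "(bmat A j k *v v) $ a = (\<Sum>x\<leftarrow>word A j k a. v $ x)"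
proof (induction k arbitrary: v)
  case (Suc k)
  have c: "(\<Sum>x\<leftarrow>concat (map f xs). v $ x) = (\<Sum>y\<leftarrow>xs. \<Sum>x\<leftarrow>f y. v $ x)" for f :: "'a \<Rightarrow> 'a list" and xs
    by (induction xs) auto
  have "(bmat A j (Suc k) *v v) $ a = (\<Sum>y\<leftarrow>word A j k a. (arrow_matrix (A (j + k)) *v v) $ y)"
    by (simp add: matrix_vector_mul_assoc[symmetric] Suc)
  then show ?case by (simp add: arrow_matrix_split_word c)
qed simp

lemma bmat_entry: "bmat A j k $ a $ b = real (count_list (word A j k a) b)"
proof -
  have "bmat A j k $ a $ b = (bmat A j k *v axis b 1) $ a"
    by (simp add: matrix_vector_mult_basis column_def)
  also have "\<dots> = (\<Sum>x\<leftarrow>word A j k a. axis b 1 $ x)" by (rule bmat_word)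
  also have "\<dots> = real (count_list xs b)" if "xs = word A j k a" for xs
    unfolding that[symmetric] by (induction xs) (auto simp: axis_def)
  finally show ?thesis by simp
qed

lemma bmat_row_sum: "(\<Sum>b\<in>UNIV. bmat A j k $ a $ b) = real (length (word A j k a))"
proof -
  have "(\<Sum>b\<in>UNIV. bmat A j k $ a $ b) = (bmat A j k *v (\<chi> i. 1)) $ a"
    by (simp add: matrix_vector_mult_def)
  also have "\<dots> = real (length (word A j k a))" by (simp add: bmat_word sum_list_triv)
  finally show ?thesis .
qed

lemma bmat_nonneg [simp]: "bmat A j k $ a $ b \<ge> 0"
  by (simp add: bmat_entry)

lemma length_word_le: "real (length (word A j k a)) \<le> mat_norm (bmat A j k)"
  unfolding bmat_row_sum[symmetric] mat_norm_def
  by (simp, rule member_le_sum[where f="\<lambda>a. \<Sum>b\<in>UNIV. bmat A j k $ a $ b"]) (auto simp: sum_nonneg)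

definition colsum :: "(nat \<Rightarrow> 'a::finite arrow) \<Rightarrow> nat \<Rightarrow> nat \<Rightarrow> 'a \<Rightarrow> real" where
  "colsum A j k b = (\<Sum>a\<in>UNIV. bmat A j k $ a $ b)"

lemma colsum_0: "colsum A j 0 b = 1"
  by (simp add: colsum_def mat_def)

text \<open>
  One backward step adds the loser's column to the winner's; everything about growth follows from this rule.
\<close>

lemma colsum_Suc: "colsum A j (Suc k) b = colsum A j k b + 
   (if b = winner (A (j + k)) then colsum A j k (loser (A (j + k))) else 0)"
proof -
  have "(X ** arrow_matrix c) $ a $ b = X $ a $ b + (if b = winner c then X $ a $ loser c else 0)" 
    for X :: "real^'a^'a" and c a
  proof -
    have "(X ** arrow_matrix c) $ a $ b =
        (\<Sum>j\<in>UNIV. (if j = b then X $ a $ j else 0) + (if j = loser c then (if b = winner c then X $ a $ j else 0) else 0))"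
      unfolding matrix_matrix_mult_def arrow_matrix_def mat_def
      by (auto intro!: sum.cong simp: algebra_simps)
    then show ?thesis by (simp add: sum.distrib)
  qed
  then show ?thesis by (simp add: colsum_def sum.distrib)
qed

lemma mat_norm_colsum: "mat_norm (bmat A j k) = (\<Sum>b\<in>UNIV. colsum A j k b)"
  unfolding mat_norm_def colsum_def by (subst sum.swap) simp

lemma colsum_ge_1: "colsum A j k b \<ge> 1"
proof (induction k arbitrary: b)
  case (Suc k)
  show ?case using Suc.IH[of b] Suc.IH[of "loser (A (j + k))"] unfolding colsum_Suc by auto
qed (simp add: colsum_0)

lemma colsum_mono: "k \<le> l \<Longrightarrow> colsum A j k b \<le> colsum A j l b"
proof (rule lift_Suc_mono_le[of "\<lambda>k. colsum A j k b"])
  show "colsum A j k b \<le> colsum A j (Suc k) b" for k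
    using colsum_ge_1[of A j k "loser (A (j + k))"] by (simp add: colsum_Suc)
qed

lemma colsum_le_norm: "colsum A j k b \<le> mat_norm (bmat A j k)"
  unfolding mat_norm_colsum using colsum_ge_1[of A j k] by (intro member_le_sum) (auto intro: order_trans[of 0 1])

lemma mat_norm_Suc: 
  "mat_norm (bmat A j (Suc k)) = mat_norm (bmat A j k) + colsum A j k (loser (A (j + k)))"
  by (simp add: mat_norm_colsum colsum_Suc sum.distrib del: bmat.simps)

lemma mat_norm_Suc_le: "mat_norm (bmat A j (Suc k)) \<le> 2 * mat_norm (bmat A j k)"
  using colsum_le_norm[of A j k "loser (A (j + k))"] unfolding mat_norm_Suc by linarith

lemma mat_norm_bmat_ge: "mat_norm (bmat A j k) \<ge> 1 + real k"
proof (induction k)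
  case 0
  have "colsum A j 0 undefined \<le> mat_norm (bmat A j 0)" by (rule colsum_le_norm)
  then show ?case by (simp add: colsum_0)
next
  case (Suc k)
  then show ?case using colsum_ge_1[of A j k "loser (A (j + k))"] by (simp add: mat_norm_Suc del: bmat.simps)
qed

lemma mat_norm_bmat_mono: "k \<le> l \<Longrightarrow> mat_norm (bmat A j k) \<le> mat_norm (bmat A j l)"
  unfolding mat_norm_colsum by (intro sum_mono colsum_mono)

lemma mat_norm_bmat_0: "mat_norm (bmat A j 0 :: real^'a^'a) = CARD('a::finite)"
  by (simp add: mat_norm_colsum colsum_0 del: bmat.simps)

text \<open>
  Completeness of the piece of the backward path between the levels \<open>-t\<close> and \<open>-s\<close>.
\<close>

definition all_win :: "(nat \<Rightarrow> 'a::finite arrow) \<Rightarrow> nat \<Rightarrow> nat \<Rightarrow> bool" where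
  "all_win A s t \<longleftrightarrow> (\<forall>b. \<exists>i\<in>{s..<t}. winner (A i) = b)"

text \<open>
  Each letter wins once, and each win adds a column which is at least as large as the smallest one.
\<close>

lemma colsum_double:
  assumes "all_win A s t" "\<And>b. colsum A 0 s b \<ge> x" "x \<ge> 0"
  shows "colsum A 0 t b \<ge> 2 * x"
proof -
  obtain i where i: "s \<le> i" "i < t" "winner (A i) = b" using assms(1) unfolding all_win_def by (meson atLeastLessThan_iff)
  have "colsum A 0 t b \<ge> colsum A 0 (Suc i) b" using i by (intro colsum_mono) auto
  moreover have "colsum A 0 (Suc i) b = colsum A 0 i b + colsum A 0 i (loser (A i))"
    using i by (simp add: colsum_Suc)
  moreover have "colsum A 0 i c \<ge> x" for c
    using colsum_mono[OF i(1), of A 0 c] assms(2)[of c] by linarith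
  ultimately show ?thesis using assms(2) by (smt (verit, best))
qed

text \<open>
  Call a column large if it is at least \<open>x\<close>; large columns remain large.  When the winner changes between
  consecutive arrows, the later winner (nearer to level 0) beats the earlier one.  In the first complete
  piece some letter with a small column wins, in the second one a letter with a large column; on the way
  from one to the other the winner passes directly from a small to a large column, and at that step the
  small column receives the large one.
\<close>

lemma large_columns_spread:
  fixes A :: "nat \<Rightarrow> 'a::finite arrow"
  assumes chain: "\<And>i. winner (A i) \<noteq> winner (A (Suc i)) \<Longrightarrow> loser (A i) = winner (A (Suc i))"
    and win: "all_win A s t" "all_win A t u"
    and ne: "colsum A 0 s b \<ge> x" and nu: "\<not> (\<forall>b. colsum A 0 s b \<ge> x)"
  shows "{b. colsum A 0 s b \<ge> x} \<subset> {b. colsum A 0 u b \<ge> x}"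
proof -
  define S where "S k = {b. colsum A 0 k b \<ge> x}" for k
  have S_mono: "S k \<subseteq> S l" if "k \<le> l" for k l
    using colsum_mono[OF that, of A 0] unfolding S_def by (auto intro: order_trans)
  obtain c where c: "c \<notin> S s" using nu by (auto simp: S_def)
  have b: "b \<in> S s" using ne by (simp add: S_def)
  obtain i where i: "s \<le> i" "i < t" "winner (A i) = c" using win(1) unfolding all_win_def by (meson atLeastLessThan_iff)
  obtain j where j: "t \<le> j" "j < u" "winner (A j) = b" using win(2) unfolding all_win_def by (meson atLeastLessThan_iff)
  have "S s \<noteq> S u"
  proof
    assume eq: "S s = S u"
    have const: "S k = S s" if "s \<le> k" "k \<le> u" for k
      using S_mono[OF that(1)] S_mono[OF that(2)] eq by blast
    have "winner (A k) \<notin> S s" if "i \<le> k" "k < u" for k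
      using that
    proof (induction k rule: dec_induct)
      case base
      then show ?case using i c by simp
    next
      case (step k)
      show ?case
      proof
        assume w: "winner (A (Suc k)) \<in> S s"
        then have "winner (A k) \<noteq> winner (A (Suc k))" using step by auto
        then have l: "loser (A k) = winner (A (Suc k))" by (rule chain)
        have "colsum A 0 (Suc k) (winner (A k)) \<ge> colsum A 0 k (loser (A k))"
          using colsum_ge_1[of A 0 k "winner (A k)"] by (simp add: colsum_Suc)
        moreover have "loser (A k) \<in> S k" using w l const[of k] step i by auto
        ultimately have "winner (A k) \<in> S (Suc k)" by (simp add: S_def)
        then show False using step const[of "Suc k"] i by auto
      qed
    qed
    from this[of j] show False using i j b by auto
  qed
  moreover have "s \<le> u" using i j by linarith
  ultimately show ?thesis using S_mono[of s u] by (auto simp: S_def)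
qed

text \<open>
  The set of columns at least as large as a given one gains a letter in any two successive complete pieces.
\<close>

lemma colsum_balanced:
  fixes A :: "nat \<Rightarrow> 'a::finite arrow"
  assumes chain: "\<And>i. winner (A i) \<noteq> winner (A (Suc i)) \<Longrightarrow> loser (A i) = winner (A (Suc i))"
    and win: "\<And>k. all_win A (t k) (t (Suc k))" 
  shows "colsum A 0 (t k) b \<le> colsum A 0 (t (k + 2 * CARD('a))) c"
proof -
  define x where "x = colsum A 0 (t k) b"
  define S where "S j = {c. colsum A 0 (t (k + 2 * j)) c \<ge> x}" for j
  have "t k \<le> t (Suc k)" for k using win[of k] unfolding all_win_def by (meson atLeastLessThan_iff le_trans less_imp_le)
  then have t: "mono t" by (simp add: mono_iff_le_Suc)
  have b: "b \<in> S j" for j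
    using colsum_mono[OF monoD[OF t, of k "k + 2 * j"], of A 0 b] by (simp add: S_def x_def)
  have "min CARD('a) (Suc j) \<le> card (S j)" for j
  proof (induction j)
    case 0
    have "card {b} \<le> card (S 0)" using b by (intro card_mono) auto
    then show ?case by simp
  next
    case (Suc j)
    show ?case
    proof (cases "S j = UNIV")
      case True
      have "S j \<subseteq> S (Suc j)"
        using colsum_mono[OF monoD[OF t, of "k + 2 * j" "k + 2 * Suc j"], of A 0] by (auto simp: S_def intro: order_trans)
      then show ?thesis using True by (simp add: top.extremum_unique)
    next
      case False
      have "S j \<subset> S (Suc j)"
        using large_columns_spread[OF chain win[of "k + 2 * j"] win[of "Suc (k + 2 * j)"], where x = x and b = b] b[of j] False
        by (auto simp: S_def)
      then have "card (S j) < card (S (Suc j))" by (intro psubset_card_mono) auto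
      then show ?thesis using Suc by auto
    qed
  qed
  from this[of "CARD('a)"] have "card (S CARD('a)) = CARD('a)"
    using card_mono[of UNIV "S CARD('a)"] by auto
  then have "S CARD('a) = UNIV" by (metis card_subset_eq finite subset_UNIV)
  then show ?thesis by (auto simp: S_def x_def)
qed

section \<open>Growth of the matrices under the first Roth condition\<close>

text \<open>
  The first Roth condition, abstracted from interval exchanges: the \<open>t k\<close> cut the backward path into
  complete pieces whose matrices are small compared with the matrix accumulated so far.
\<close>

locale roth_chain =
  fixes A :: "nat \<Rightarrow> 'a::finite arrow" and t :: "nat \<Rightarrow> nat"
  assumes winner_neq_loser: "winner (A i) \<noteq> loser (A i)"
    and chain: "winner (A i) \<noteq> winner (A (Suc i)) \<Longrightarrow> loser (A i) = winner (A (Suc i))"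
    and t_0: "t 0 = 0"
    and win: "all_win A (t k) (t (Suc k))"
    and roth: "\<epsilon> > 0 \<Longrightarrow> \<exists>C>0. \<forall>k. mat_norm (bmat A (t k) (t (Suc k) - t k)) \<le> C * mat_norm (bmat A 0 (t k)) powr \<epsilon>"
begin

abbreviation N :: "nat \<Rightarrow> real" where
  "N k \<equiv> mat_norm (bmat A 0 k)"

lemma N_ge_1: "N k \<ge> 1"
  using mat_norm_bmat_ge[of k A 0] by simp

lemma N_pos [simp]: "N k > 0"
  using N_ge_1[of k] by simp

lemma det_bmat: "det (bmat A j k) = 1"
  by (induction k) (simp_all add: det_mul det_arrow_matrix winner_neq_loser)

lemma t_less: "t k < t (Suc k)"
  using win[of k] unfolding all_win_def by (meson atLeastLessThan_iff le_less_trans)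

lemma t_mono: "k \<le> l \<Longrightarrow> t k \<le> t l"
  using t_less by (simp add: lift_Suc_mono_le less_imp_le)

lemma t_bracket: obtains k where "t k \<le> n" "n < t (Suc k)"
proof -
  have sm: "strict_mono t" using t_less by (simp add: strict_mono_Suc_iff)
  have ex: "\<exists>k. n < t k" using seq_suble[OF sm, of "Suc n"] by (auto simp: Suc_le_eq)
  define k where "k = (LEAST k. n < t k)"
  have k: "n < t k" unfolding k_def by (rule LeastI_ex[OF ex])
  then have "k \<noteq> 0" using t_0 by (intro notI) simp
  then obtain j where j: "k = Suc j" by (cases k) auto
  have "\<not> n < t j" using not_less_Least[of j "\<lambda>k. n < t k"] j by (simp add: k_def)
  then show ?thesis using that[of j] k j by simp
qed

text \<open>
  Iteration of the Roth condition over a fixed number of pieces.  With \<open>e \<le> \<epsilon>/3\<close> and \<open>e \<le> 1\<close> the exponent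
  \<open>(1 + e)\<^sup>2\<close> is at most \<open>1 + \<epsilon>\<close>.
\<close>

lemma N_jump:
  "\<epsilon> > 0 \<Longrightarrow> \<exists>C>0. \<forall>k. N (t (k + p)) \<le> C * N (t k) powr (1 + \<epsilon>)"
proof (induction p arbitrary: \<epsilon>)
  case 0
  have "N (t k) \<le> 1 * N (t k) powr (1 + \<epsilon>)" for k
    using powr_mono[of 1 "1 + \<epsilon>" "N (t k)"] N_ge_1[of "t k"] 0 by simp
  then show ?case by (metis add_0_right zero_less_one)
next
  case (Suc p)
  define e where "e = min (\<epsilon> / 3) 1"
  have e: "e > 0" "e \<le> 1" "3 * e \<le> \<epsilon>" using Suc.prems by (auto simp: e_def)
  obtain C1 where C1: "C1 > 0" "\<And>k. N (t (k + p)) \<le> C1 * N (t k) powr (1 + e)"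
    using Suc.IH[OF e(1)] by auto
  obtain C2 where C2: "C2 > 0" "\<And>k. mat_norm (bmat A (t k) (t (Suc k) - t k)) \<le> C2 * N (t k) powr e"
    using roth[OF e(1)] by auto
  define C where "C = C2 * C1 powr (1 + e)"
  have "N (t (k + Suc p)) \<le> C * N (t k) powr (1 + \<epsilon>)" for k
  proof -
    let ?m = "k + p"
    have "bmat A 0 (t (Suc ?m)) = bmat A 0 (t ?m) ** bmat A (t ?m) (t (Suc ?m) - t ?m)"
      using bmat_add[of A 0 "t ?m" "t (Suc ?m) - t ?m"] t_less[of ?m] by simp
    then have "N (t (Suc ?m)) \<le> N (t ?m) * mat_norm (bmat A (t ?m) (t (Suc ?m) - t ?m))"
      by (simp add: mat_norm_mult)
    also have "\<dots> \<le> N (t ?m) * (C2 * N (t ?m) powr e)"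
      using C2(2)[of ?m] by (intro mult_left_mono) auto
    also have "\<dots> = C2 * N (t ?m) powr (1 + e)"
      by (simp add: powr_add)
    also have "\<dots> \<le> C2 * (C1 * N (t k) powr (1 + e)) powr (1 + e)"
      using C1(2)[of k] C2(1) e by (intro mult_left_mono powr_mono2) auto
    also have "\<dots> = C * N (t k) powr ((1 + e) * (1 + e))"
      using C1(1) by (simp add: C_def powr_mult powr_powr)
    also have "\<dots> \<le> C * N (t k) powr (1 + \<epsilon>)"
    proof (intro mult_left_mono powr_mono)
      have "(1 + e) * (1 + e) = 1 + 2 * e + e * e" by (simp add: algebra_simps)
      also have "\<dots> \<le> 1 + \<epsilon>"
      proof -
        have "e * e \<le> e * 1" using e by (intro mult_left_mono) auto
        then show ?thesis using e by linarith
      qed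
      finally show "(1 + e) * (1 + e) \<le> 1 + \<epsilon>" .
    qed (use N_ge_1 C1 C2 in \<open>auto simp: C_def\<close>)
    finally show ?thesis by simp
  qed
  moreover have "C > 0" using C1 C2 by (simp add: C_def)
  ultimately show ?case by blast
qed

text \<open>
  All columns are nearly as large as the whole matrix: up to the number of letters, every column
  exceeds the whole matrix of a fixed number of pieces before, and by the Roth condition the matrix has hardly grown since.
\<close>

lemma N_le_colsum:
  assumes "\<epsilon> > 0"
  shows "\<exists>C>0. \<forall>n b. N n \<le> C * colsum A 0 n b powr (1 + \<epsilon>)"
proof -
  define p where "p = 2 * CARD('a)"
  obtain C where C: "C > 0" "\<And>k. N (t (k + Suc p)) \<le> C * N (t k) powr (1 + \<epsilon>)"
    using N_jump[OF assms, of "Suc p"] by auto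
  define D where "D = max (N (t p)) (C * CARD('a) powr (1 + \<epsilon>))"
  have "N n \<le> D * colsum A 0 n b powr (1 + \<epsilon>)" for n b
  proof -
    obtain k where k: "t k \<le> n" "n < t (Suc k)" by (rule t_bracket)
    have pw: "colsum A 0 n b powr (1 + \<epsilon>) \<ge> 1"
      using colsum_ge_1[of A 0 n b] assms by (simp add: ge_one_powr_ge_zero)
    show ?thesis
    proof (cases "k < p")
      case True
      then have "N n \<le> N (t p)" using k t_mono[of "Suc k" p] by (intro mat_norm_bmat_mono) auto
      also have "\<dots> \<le> D * 1" by (simp add: D_def)
      also have "\<dots> \<le> D * colsum A 0 n b powr (1 + \<epsilon>)"
        using pw by (intro mult_left_mono) (auto simp: D_def le_max_iff_disj)
      finally show ?thesis .
    next
      case False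
      (* p complete pieces are enough for the columns of level t m to spread over all letters. *)
      define m where "m = k - p"
      have km: "k = m + p" using False by (simp add: m_def)
      have "N (t m) = (\<Sum>c\<in>UNIV. colsum A 0 (t m) c)" by (rule mat_norm_colsum)
      also have "\<dots> \<le> (\<Sum>c\<in>(UNIV::'a set). colsum A 0 (t k) b)"
        unfolding km p_def using colsum_balanced[of A t m _ b, OF chain win] by (intro sum_mono) simp
      also have "\<dots> \<le> CARD('a) * colsum A 0 n b"
        using colsum_mono[OF k(1), of A 0 b] by simp
      finally have Nm: "N (t m) \<le> CARD('a) * colsum A 0 n b" .
      have "N n \<le> N (t (Suc k))" using k by (intro mat_norm_bmat_mono) auto
      also have "\<dots> \<le> C * N (t m) powr (1 + \<epsilon>)" using C(2)[of m] by (simp add: km)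
      also have "\<dots> \<le> C * (CARD('a) * colsum A 0 n b) powr (1 + \<epsilon>)"
        using Nm C(1) assms by (intro mult_left_mono powr_mono2) auto
      also have "\<dots> = (C * CARD('a) powr (1 + \<epsilon>)) * colsum A 0 n b powr (1 + \<epsilon>)"
        using colsum_ge_1[of A 0 n b] by (simp add: powr_mult)
      also have "\<dots> \<le> D * colsum A 0 n b powr (1 + \<epsilon>)"
        by (intro mult_right_mono) (auto simp: D_def)
      finally show ?thesis .
    qed
  qed
  moreover have "D > 0" using N_pos[of "t p"] by (simp add: D_def less_max_iff_disj)
  ultimately show ?thesis by blast
qed

lemma colsum_t_ge: "colsum A 0 (t k) b \<ge> 2 ^ k"
proof (induction k arbitrary: b)
  case 0
  show ?case using colsum_ge_1[of A 0 "t 0" b] by simp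
next
  case (Suc k)
  show ?case using colsum_double[OF win Suc, of b] by simp
qed

text \<open>
  Along the times \<open>t k\<close> the norm grows at least like \<open>2 ^ k\<close>.  A piece has at most as many arrows as the norm
  of its matrix, since each arrow raises that norm by at least 1; by the Roth condition this number is
  absorbed by half of the exponent.
\<close>

lemma sum_N_powr_bounded:
  assumes "\<delta> > 0"
  shows "\<exists>C>0. \<forall>k l. (\<Sum>i=k..<l. N i powr (- \<delta>)) \<le> C"
proof -
  obtain C where C: "C > 0" "\<And>k. mat_norm (bmat A (t k) (t (Suc k) - t k)) \<le> C * N (t k) powr (\<delta>/2)"
    using roth[of "\<delta>/2"] assms by auto
  (* the sum over the k-th piece is at most C * r ^ k *)
  define r where "r = 2 powr (- \<delta> / 2)"
  have r: "0 < r" "r < 1" using assms by (auto simp: r_def intro: powr_less_one)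
  have block: "(\<Sum>i=t k..<t (Suc k). N i powr (- \<delta>)) \<le> C * r ^ k" for k
  proof -
    have "(\<Sum>i=t k..<t (Suc k). N i powr (- \<delta>)) \<le> (\<Sum>i=t k..<t (Suc k). N (t k) powr (- \<delta>))"
      using assms by (intro sum_mono powr_mono2') (auto intro: mat_norm_bmat_mono)
    also have "\<dots> = real (t (Suc k) - t k) * N (t k) powr (- \<delta>)" by simp
    also have "\<dots> \<le> (C * N (t k) powr (\<delta>/2)) * N (t k) powr (- \<delta>)"
      using mat_norm_bmat_ge[of "t (Suc k) - t k" A "t k"] C(2)[of k] by (intro mult_right_mono) auto
    also have "\<dots> = C * N (t k) powr (- \<delta>/2)"
      by (simp add: powr_add[symmetric])
    also have "\<dots> \<le> C * (2 ^ k) powr (- \<delta>/2)"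
      using assms C(1) colsum_t_ge[of k undefined] colsum_le_norm[of A 0 "t k" undefined]
      by (intro mult_left_mono powr_mono2') auto
    also have "(2 ^ k) powr (- \<delta>/2) = r ^ k"
      by (simp add: r_def powr_realpow[symmetric] powr_powr mult.commute)
    finally show ?thesis .
  qed
  have total: "(\<Sum>i<t K. N i powr (- \<delta>)) \<le> C / (1 - r)" for K
  proof -
    have "(\<Sum>i<t K. N i powr (- \<delta>)) \<le> C * (\<Sum>k<K. r ^ k)"
    proof (induction K)
      case (Suc K)
      have "{..<t (Suc K)} = {..<t K} \<union> {t K..<t (Suc K)}" using t_less[of K] by auto
      then have "(\<Sum>i<t (Suc K). N i powr (- \<delta>)) = (\<Sum>i<t K. N i powr (- \<delta>)) + (\<Sum>i=t K..<t (Suc K). N i powr (- \<delta>))"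
        by (simp add: sum.union_disjoint ivl_disj_int)
      then show ?case using Suc block[of K] by (simp add: algebra_simps)
    qed (simp add: t_0)
    also have "(\<Sum>k<K. r ^ k) \<le> 1 / (1 - r)"
      using sum_gp_strict[of r K] r by (auto intro: divide_right_mono)
    finally show ?thesis using C(1) by (simp add: mult_left_mono)
  qed
  have "(\<Sum>i=k..<l. N i powr (- \<delta>)) \<le> C / (1 - r)" for k l
  proof -
    obtain K where "l < t (Suc K)" using t_bracket[of l] by metis
    then have "(\<Sum>i=k..<l. N i powr (- \<delta>)) \<le> (\<Sum>i<t (Suc K). N i powr (- \<delta>))"
      by (intro sum_mono2) auto
    also have "\<dots> \<le> C / (1 - r)" by (rule total)
    finally show ?thesis .
  qed
  moreover have "C / (1 - r) > 0" using C r by simp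
  ultimately show ?thesis by blast
qed

lemma N_unbounded: "filterlim N at_top sequentially"
proof (rule filterlim_at_top_mono[OF filterlim_real_sequentially])
  show "\<forall>\<^sub>F k in sequentially. real k \<le> N k"
    using mat_norm_bmat_ge[of _ A 0] by (intro always_eventually allI) (smt (verit))
qed

lemma bmat_orbit:
  assumes "\<And>i. v i = arrow_matrix (A i) *v v (Suc i)"
  shows "v j = bmat A j k *v v (j + k)"
proof (induction k)
  case (Suc k)
  then show ?case using assms[of "j + k"] by (simp add: matrix_vector_mul_assoc)
qed simp

text \<open>
  The sum of the entries of \<open>h 0\<close> is the sum of \<open>colsum A 0 k b * h k $ b\<close>, so that no entry of \<open>h k\<close> exceeds a
  constant divided by the corresponding column, and the columns are balanced.
\<close>

lemma positive_orbit_decay: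
  assumes orb: "\<And>i. h i = arrow_matrix (A i) *v h (Suc i)" and pos: "\<And>i b. h i $ b > 0" and "\<epsilon> > 0"
  shows "\<exists>C>0. \<forall>k b. h k $ b \<le> C * N k powr (- 1 + \<epsilon>)"
proof -
  obtain C where C: "C > 0" "\<And>n b. N n \<le> C * colsum A 0 n b powr (1 + \<epsilon>)"
    using N_le_colsum[OF assms(3)] by auto
  define H where "H = (\<Sum>a\<in>UNIV. h 0 $ a)"
  have H: "H > 0" using pos by (auto simp: H_def intro: sum_pos)
  define D where "D = H * C powr (1 / (1 + \<epsilon>))"
  have "h k $ b \<le> D * N k powr (- 1 + \<epsilon>)" for k b
  proof -
    let ?c = "colsum A 0 k b"
    have c1: "?c \<ge> 1" by (rule colsum_ge_1)
    have "?c * h k $ b \<le> (\<Sum>b\<in>UNIV. colsum A 0 k b * h k $ b)"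
      using colsum_ge_1[of A 0 k] pos[of k] 
      by (intro member_le_sum) (auto intro!: mult_nonneg_nonneg intro: order_trans[of 0 1] less_imp_le)
    also have "\<dots> = (\<Sum>a\<in>UNIV. (bmat A 0 k *v h k) $ a)"
      unfolding matrix_vector_mult_def colsum_def
      by (simp add: sum_distrib_right) (rule sum.swap)
    also have "\<dots> = H" using bmat_orbit[OF orb, of 0 k] by (simp add: H_def)
    finally have 1: "h k $ b \<le> H / ?c" using c1 by (simp add: field_simps)
    have "N k powr (1 / (1 + \<epsilon>)) \<le> (C * ?c powr (1 + \<epsilon>)) powr (1 / (1 + \<epsilon>))"
      using C(2)[of k b] assms(3) by (intro powr_mono2) auto
    also have "\<dots> = C powr (1 / (1 + \<epsilon>)) * ?c"
      using C(1) c1 assms(3) by (simp add: powr_mult powr_powr)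
    finally have "N k powr (1 / (1 + \<epsilon>)) \<le> C powr (1 / (1 + \<epsilon>)) * ?c" .
    moreover have "1 / c \<le> K / x" if "x \<le> K * c" "x > 0" "c > 0" for x K c :: real
      using that by (simp add: field_simps)
    ultimately have "1 / ?c \<le> C powr (1 / (1 + \<epsilon>)) / N k powr (1 / (1 + \<epsilon>))"
      using c1 N_pos[of k] by (metis less_le_trans powr_gt_zero zero_less_one less_irrefl)
    also have "\<dots> = C powr (1 / (1 + \<epsilon>)) * N k powr (- (1 / (1 + \<epsilon>)))"
      by (simp only: powr_minus divide_inverse)
    also have "\<dots> \<le> C powr (1 / (1 + \<epsilon>)) * N k powr (- 1 + \<epsilon>)"
    proof (intro mult_left_mono powr_mono N_ge_1)
      have "(1 - \<epsilon>) * (1 + \<epsilon>) \<le> 1" by (simp add: algebra_simps)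
      then show "- (1 / (1 + \<epsilon>)) \<le> - 1 + \<epsilon>" using assms(3) by (simp add: field_simps)
    qed auto
    finally have "H * (1 / ?c) \<le> H * (C powr (1 / (1 + \<epsilon>)) * N k powr (- 1 + \<epsilon>))"
      using H by (intro mult_left_mono) auto
    then show ?thesis using 1 by (simp add: D_def mult.assoc)
  qed
  moreover have "D > 0" using H C by (simp add: D_def)
  ultimately show ?thesis by blast
qed

end

section \<open>Functions tiled along a word\<close>

abbreviation total :: "('a \<Rightarrow> real) \<Rightarrow> 'a list \<Rightarrow> real" where
  "total q bs \<equiv> sum_list (map q bs)"

text \<open>
  The pieces \<open>g b\<close> placed side by side along a word, the letter \<open>b\<close> occupying an interval of length \<open>q b\<close>.
  The pieces are defined on the whole line; a piece that does not return to \<open>0\<close> shifts all that follow, so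
  that the piecewise affine functions of the theorem are tiled functions as well (with ramps as pieces).
\<close>

primrec tile :: "('a \<Rightarrow> real \<Rightarrow> real) \<Rightarrow> ('a \<Rightarrow> real) \<Rightarrow> 'a list \<Rightarrow> real \<Rightarrow> real" where
  "tile g q [] x = 0"
| "tile g q (b # bs) x = g b x + tile g q bs (x - q b)"

text \<open>
  The values of \<open>\<psi>\<close> at the left ends of the intervals of a word that starts at \<open>s\<close>, weighted by letter; for
  \<open>e = q\<close> it is a Riemann sum.
\<close>

primrec sample_sum :: "(real \<Rightarrow> real) \<Rightarrow> ('a \<Rightarrow> real) \<Rightarrow> ('a \<Rightarrow> real) \<Rightarrow> real \<Rightarrow> 'a list \<Rightarrow> real" where
  "sample_sum \<psi> q e s [] = 0"
| "sample_sum \<psi> q e s (b # bs) = \<psi> s * e b + sample_sum \<psi> q e (s + q b) bs"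

lemma total_nonneg: "(\<And>b. q b \<ge> 0) \<Longrightarrow> total q bs \<ge> 0"
  by (induction bs) auto

lemma tile_append: "tile g q (xs @ ys) x = tile g q xs x + tile g q ys (x - total q xs)"
  by (induction xs arbitrary: x) (auto simp: algebra_simps)

text \<open>
  Refining every letter of a word into a word turns a tiled function into a tiling by tiled functions.
\<close>

lemma tile_concat:
  "tile g q (concat (map \<sigma> bs)) x = tile (\<lambda>b. tile g q (\<sigma> b)) (\<lambda>b. total q (\<sigma> b)) bs x"
  by (induction bs arbitrary: x) (auto simp: tile_append)

lemma tile_diff: "tile (\<lambda>b x. g b x - f b x) q bs x = tile g q bs x - tile f q bs x"
  by (induction bs arbitrary: x) auto

lemma tile_continuous:
  assumes "\<And>b. continuous_on UNIV (g b)" shows "continuous_on UNIV (tile g q bs)"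
proof (induction bs)
  case (Cons b bs)
  have "continuous_on UNIV (\<lambda>x. tile g q bs (x - q b))"
    by (rule continuous_on_compose2[OF Cons]) (auto intro: continuous_intros)
  then have "continuous_on UNIV (\<lambda>x. g b x + tile g q bs (x - q b))"
    using assms by (intro continuous_intros)
  then show ?case by simp
qed simp

definition tileable :: "('a \<Rightarrow> real \<Rightarrow> real) \<Rightarrow> ('a \<Rightarrow> real) \<Rightarrow> real \<Rightarrow> bool" where
  "tileable g q K \<longleftrightarrow> (\<forall>b. continuous_on UNIV (g b) \<and> (\<forall>x\<le>0. g b x = 0) \<and> (\<forall>x\<ge>q b. g b x = 0) \<and>
     (\<forall>x. \<bar>g b x\<bar> \<le> K))"

lemma tile_left: "(\<And>b x. x \<le> 0 \<Longrightarrow> g b x = 0) \<Longrightarrow> (\<And>b. q b \<ge> 0) \<Longrightarrow> x \<le> 0 \<Longrightarrow> tile g q bs x = 0"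
proof (induction bs arbitrary: x)
  case (Cons b bs)
  have "x - q b \<le> 0" using Cons.prems(2)[of b] Cons.prems(3) by simp
  then show ?case using Cons by simp
qed simp

lemma tile_tileable:
  assumes "tileable g q K" "\<And>b. q b \<ge> 0" "K \<ge> 0"
  shows "tileable (\<lambda>a. tile g q (\<sigma> a)) (\<lambda>a. total q (\<sigma> a)) K"
proof -
  have g: "continuous_on UNIV (g b)" "x \<le> 0 \<Longrightarrow> g b x = 0" "x \<ge> q b \<Longrightarrow> g b x = 0" "\<bar>g b x\<bar> \<le> K" for b x
    using assms(1) by (auto simp: tileable_def)
  have left: "x \<le> 0 \<Longrightarrow> tile g q bs x = 0" for bs x
    using tile_left[of g q] g(2) assms(2) by blast
  have right: "x \<ge> total q bs \<Longrightarrow> tile g q bs x = 0" for bs x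
  proof (induction bs arbitrary: x)
    case (Cons b bs)
    then show ?case using g(3)[of b x] total_nonneg[of q bs] assms(2) by auto
  qed simp
  have bnd: "\<bar>tile g q bs x\<bar> \<le> K" for bs x
  proof (induction bs arbitrary: x)
    case (Cons b bs)
    show ?case
    proof (cases "x \<le> q b")
      case True
      then show ?thesis using left[of "x - q b" bs] g(4)[of b x] by simp
    next
      case False
      then show ?thesis using g(3)[of b x] Cons[of "x - q b"] by simp
    qed
  qed (use assms(3) in simp)
  show ?thesis
    unfolding tileable_def using left right bnd tile_continuous[of g q, OF g(1)] by blast
qed

lemma integral_shift_0:
  assumes "continuous_on UNIV g" "0 \<le> w"
  shows "integral {s..s + w} (\<lambda>x. g (x - s)) = integral {0..w} (g :: real \<Rightarrow> real)"
proof -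
  have "integral {0..w} ((\<lambda>x. g (x - s)) \<circ> (\<lambda>x. x + s)) = integral {0 + s..w + s} (\<lambda>x. g (x - s))"
    by (rule integral_shift) (auto intro!: continuous_on_compose2[OF assms(1)] continuous_intros)
  then show ?thesis by (simp add: o_def add.commute)
qed

lemma continuous_on_shifted: "continuous_on UNIV g \<Longrightarrow> continuous_on S (\<lambda>x. g (x - s :: real) :: real)"
  by (rule continuous_on_compose2[of UNIV g]) (auto intro: continuous_intros)

definition holder_bound :: "(real \<Rightarrow> real) \<Rightarrow> real \<Rightarrow> real \<Rightarrow> real \<Rightarrow> bool" where
  "holder_bound \<psi> Q \<eta> H \<longleftrightarrow> (\<forall>x\<in>{0..Q}. \<forall>y\<in>{0..Q}. \<bar>\<psi> x - \<psi> y\<bar> \<le> H * \<bar>x - y\<bar> powr \<eta>)"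

lemma piece_integral_approx:
  assumes "continuous_on {0..Q} \<psi>" "holder_bound \<psi> Q \<eta> H" "H \<ge> 0" "\<eta> > 0"
    and g: "continuous_on UNIV g" "\<And>x. \<bar>g x\<bar> \<le> K"
    and "0 \<le> s" "s + w \<le> Q" "0 \<le> w" "w \<le> r"
  shows "\<bar>integral {s..s + w} (\<lambda>x. \<psi> x * g (x - s)) - \<psi> s * integral {0..w} g\<bar> \<le> H * r powr \<eta> * K * w"
proof -
  have c\<psi>: "continuous_on {s..s + w} \<psi>"
    by (rule continuous_on_subset[OF assms(1)]) (use assms in auto)
  note cg = continuous_on_shifted[OF g(1), of "{s..s+w}" s]
  have "integral {s..s + w} (\<lambda>x. \<psi> x * g (x - s)) - \<psi> s * integral {0..w} g = 
     integral {s..s + w} (\<lambda>x. \<psi> x * g (x - s)) - integral {s..s + w} (\<lambda>x. \<psi> s * g (x - s))"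
    by (simp add: integral_shift_0[OF g(1) assms(9)])
  also have "\<dots> = integral {s..s + w} (\<lambda>x. \<psi> x * g (x - s) - \<psi> s * g (x - s))"
    by (intro Henstock_Kurzweil_Integration.integral_diff[symmetric] integrable_continuous_real continuous_intros c\<psi> cg)
  also have "norm \<dots> \<le> (H * r powr \<eta> * K) * (s + w - s)"
  proof (rule integral_bound)
    show "continuous_on {s..s + w} (\<lambda>x. \<psi> x * g (x - s) - \<psi> s * g (x - s))"
      by (intro continuous_intros c\<psi> cg)
    fix x assume x: "x \<in> {s..s + w}"
    have "\<bar>\<psi> x - \<psi> s\<bar> \<le> H * \<bar>x - s\<bar> powr \<eta>"
      using assms(2)[unfolded holder_bound_def, rule_format, of x s] x assms(7,8,9) by auto
    also have "\<dots> \<le> H * r powr \<eta>"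
      using x assms by (intro mult_left_mono powr_mono2) auto
    finally have "\<bar>\<psi> x - \<psi> s\<bar> * \<bar>g (x - s)\<bar> \<le> H * r powr \<eta> * K"
      using g(2) assms(3) by (intro mult_mono) auto
    then show "norm (\<psi> x * g (x - s) - \<psi> s * g (x - s)) \<le> H * r powr \<eta> * K"
      by (simp add: abs_mult[symmetric] left_diff_distrib)
  qed (use assms in auto)
  finally show ?thesis by simp
qed

text \<open>
  On each interval \<open>\<psi>\<close> is replaced by its value at the left end; the error is at most the oscillation of \<open>\<psi>\<close> there
  times height and width of the bump.
\<close>

lemma tile_integral_approx:
  assumes \<psi>: "continuous_on {0..Q} \<psi>" "holder_bound \<psi> Q \<eta> H" "H \<ge> 0" "\<eta> > 0"
    and g: "tileable g q K" and q: "\<And>b. 0 \<le> q b \<and> q b \<le> r"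
    and K: "K \<ge> 0"
  shows "0 \<le> s \<Longrightarrow> s + total q bs \<le> Q \<Longrightarrow>
    \<bar>integral {s..s + total q bs} (\<lambda>x. \<psi> x * tile g q bs (x - s)) - sample_sum \<psi> q (\<lambda>b. integral {0..q b} (g b)) s bs\<bar>
      \<le> H * r powr \<eta> * K * total q bs"
proof (induction bs arbitrary: s)
  case (Cons b bs)
  have gb: "continuous_on UNIV (g b)" "x \<le> 0 \<Longrightarrow> g b x = 0" "x \<ge> q b \<Longrightarrow> g b x = 0" "\<bar>g b x\<bar> \<le> K" for b x
    using g by (auto simp: tileable_def)
  let ?T = "total q bs" and ?s = "s + q b"
  have T: "?T \<ge> 0" using total_nonneg[of q bs] q by auto
  have qb: "0 \<le> q b" "q b \<le> r" using q by auto
  let ?f = "\<lambda>x. \<psi> x * tile g q (b # bs) (x - s)"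
  have ct: "continuous_on S (\<lambda>x. tile g q bs (x - s))" for S s bs
    using continuous_on_shifted[OF tile_continuous[of g q bs]] gb(1) by blast
  have "continuous_on {s..s + total q (b # bs)} ?f"
    by (intro continuous_intros ct continuous_on_subset[OF \<psi>(1)]) (use Cons in auto)
  then have "?f integrable_on {s..?s + ?T}"
    by (intro integrable_continuous_real) (simp add: add.assoc)
  then have "integral {s..?s + ?T} ?f = integral {s..?s} ?f + integral {?s..?s + ?T} ?f"
    using Henstock_Kurzweil_Integration.integral_combine[of s ?s "?s + ?T" ?f] qb T by simp
  moreover have "integral {s..?s} ?f = integral {s..?s} (\<lambda>x. \<psi> x * g b (x - s))"
  proof (rule integral_cong)
    fix x assume "x \<in> {s..?s}"
    then have "tile g q bs (x - s - q b) = 0" using gb(2) q by (intro tile_left) auto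
    then show "?f x = \<psi> x * g b (x - s)" by simp
  qed
  moreover have "integral {?s..?s + ?T} ?f = integral {?s..?s + ?T} (\<lambda>x. \<psi> x * tile g q bs (x - ?s))"
    by (rule integral_cong) (use gb(3)[of b] in \<open>auto simp: algebra_simps\<close>)
  moreover have "\<bar>integral {s..?s} (\<lambda>x. \<psi> x * g b (x - s)) - \<psi> s * integral {0..q b} (g b)\<bar> \<le> H * r powr \<eta> * K * q b"
    by (rule piece_integral_approx[OF \<psi> gb(1) gb(4)]) (use Cons.prems qb T in auto)
  moreover have "\<bar>integral {?s..?s + ?T} (\<lambda>x. \<psi> x * tile g q bs (x - ?s)) - sample_sum \<psi> q (\<lambda>b. integral {0..q b} (g b)) ?s bs\<bar>
      \<le> H * r powr \<eta> * K * ?T"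
    by (rule Cons.IH) (use Cons.prems qb in auto)
  ultimately show ?case by (simp add: add.assoc distrib_left)
qed simp

lemma integral_approx:
  assumes \<psi>: "continuous_on {0..Q} \<psi>" "holder_bound \<psi> Q \<eta> H" "H \<ge> 0" "\<eta> > 0"
    and q: "\<And>b. 0 \<le> q b \<and> q b \<le> r"
  shows "0 \<le> s \<Longrightarrow> s + total q bs \<le> Q \<Longrightarrow>
    \<bar>integral {s..s + total q bs} \<psi> - sample_sum \<psi> q q s bs\<bar> \<le> H * r powr \<eta> * total q bs"
proof (induction bs arbitrary: s)
  case (Cons b bs)
  let ?T = "total q bs" and ?s = "s + q b"
  have T: "?T \<ge> 0" using total_nonneg[of q bs] q by auto
  have qb: "0 \<le> q b" "q b \<le> r" using q by auto
  have "continuous_on {s..?s + ?T} \<psi>"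
    by (rule continuous_on_subset[OF \<psi>(1)]) (use Cons in auto)
  then have "integral {s..?s + ?T} \<psi> = integral {s..?s} \<psi> + integral {?s..?s + ?T} \<psi>"
    using Henstock_Kurzweil_Integration.integral_combine[of s ?s "?s + ?T" \<psi>] qb T 
    by (simp add: integrable_continuous_real)
  moreover have "\<bar>integral {s..?s} \<psi> - \<psi> s * q b\<bar> \<le> H * r powr \<eta> * q b"
    using piece_integral_approx[OF \<psi>, of "\<lambda>_. 1" 1 s "q b" r] Cons.prems qb T by simp
  moreover have "\<bar>integral {?s..?s + ?T} \<psi> - sample_sum \<psi> q q ?s bs\<bar> \<le> H * r powr \<eta> * ?T"
    by (rule Cons.IH) (use Cons.prems qb in auto)
  ultimately show ?case by (simp add: add.assoc distrib_left)
qed simp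

lemma sample_sum_linear:
  fixes e :: "'a::finite \<Rightarrow> real"
  shows "sample_sum \<psi> q e s bs = (\<Sum>b\<in>UNIV. sample_sum \<psi> q (\<lambda>x. if x = b then 1 else 0) s bs * e b)"
proof (induction bs arbitrary: s)
  case (Cons a bs)
  have "(\<Sum>b\<in>UNIV. sample_sum \<psi> q (\<lambda>x. if x = b then 1 else 0) s (a # bs) * e b)
     = (\<Sum>b\<in>UNIV. (if a = b then \<psi> s * e b else 0) + sample_sum \<psi> q (\<lambda>x. if x = b then 1 else 0) (s + q a) bs * e b)"
    by (intro sum.cong) (auto simp: algebra_simps)
  then show ?case by (simp add: sum.distrib Cons)
qed simp

lemma sample_sum_bound:
  assumes "\<And>x. x \<in> {0..Q} \<Longrightarrow> \<bar>\<psi> x\<bar> \<le> M" "\<And>b. \<bar>e b\<bar> \<le> 1" "\<And>b. q b \<ge> 0"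
  shows "0 \<le> s \<Longrightarrow> s + total q bs \<le> Q \<Longrightarrow> \<bar>sample_sum \<psi> q e s bs\<bar> \<le> M * length bs"
proof (induction bs arbitrary: s)
  case (Cons b bs)
  have "0 \<le> q b" "0 \<le> total q bs" using assms(3) total_nonneg[of q bs] by auto
  then have "\<bar>\<psi> s\<bar> * \<bar>e b\<bar> \<le> M * 1" using Cons.prems assms(1)[of s]
    by (intro mult_mono assms(2)) auto
  moreover have "\<bar>sample_sum \<psi> q e (s + q b) bs\<bar> \<le> M * length bs"
    using Cons \<open>0 \<le> q b\<close> by auto
  ultimately show ?case by (simp add: algebra_simps abs_mult[symmetric]) 
qed simp

lemma tile_integral:
  fixes q :: "'a::finite \<Rightarrow> real"
  assumes g: "tileable g q K" and q: "\<And>b. 0 \<le> q b" and K: "K \<ge> 0"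
  shows "integral {0..total q bs} (tile g q bs) = total (\<lambda>b. integral {0..q b} (g b)) bs"
proof -
  have s1: "sample_sum (\<lambda>_. 1) q e s bs = total e bs" for e s by (induction bs arbitrary: s) auto
  have "0 \<le> q b \<and> q b \<le> Max (range q)" for b using q by auto
  then have "\<bar>integral {0..0 + total q bs} (\<lambda>x. 1 * tile g q bs (x - 0)) - sample_sum (\<lambda>_. 1) q (\<lambda>b. integral {0..q b} (g b)) 0 bs\<bar>
     \<le> 0 * Max (range q) powr 1 * K * total q bs"
    by (intro tile_integral_approx[OF _ _ _ _ g _ K, of "total q bs"]) (auto simp: holder_bound_def)
  then show ?thesis by (simp add: s1)
qed

text \<open>
  The affine function rising from \<open>0\<close> to \<open>c b\<close> on \<open>[0, q b]\<close>, continued by constants.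
\<close>

definition ramp :: "('a \<Rightarrow> real) \<Rightarrow> ('a \<Rightarrow> real) \<Rightarrow> 'a \<Rightarrow> real \<Rightarrow> real" where
  "ramp c q b x = c b * max 0 (min 1 (x / q b))"

lemma ramp_left: "q b > 0 \<Longrightarrow> x \<le> 0 \<Longrightarrow> ramp c q b x = 0"
  by (simp add: ramp_def divide_nonpos_pos min_def)

lemma ramp_right: "q b > 0 \<Longrightarrow> x \<ge> q b \<Longrightarrow> ramp c q b x = c b"
  by (simp add: ramp_def min_def)

lemma ramp_mid: "q b > 0 \<Longrightarrow> 0 \<le> x \<Longrightarrow> x \<le> q b \<Longrightarrow> ramp c q b x = c b * (x / q b)"
  by (simp add: ramp_def min_def)

lemma ramp_bound: "\<bar>ramp c q b x\<bar> \<le> \<bar>c b\<bar>"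
  by (simp add: ramp_def abs_mult mult_left_le)

lemma ramp_continuous: "continuous_on UNIV (ramp c q b)"
  unfolding ramp_def divide_inverse by (intro continuous_intros)

lemma tile_ramp_left: "(\<And>b. q b > 0) \<Longrightarrow> x \<le> 0 \<Longrightarrow> tile (ramp c q) q bs x = 0"
  by (rule tile_left) (auto simp: ramp_left less_imp_le)

lemma tile_ramp_right: "(\<And>b. q b > 0) \<Longrightarrow> x \<ge> total q bs \<Longrightarrow> tile (ramp c q) q bs x = total c bs"
proof (induction bs arbitrary: x)
  case (Cons b bs)
  have "total q bs \<ge> 0" using Cons.prems(1) by (intro total_nonneg) (simp add: less_imp_le)
  then show ?case using Cons by (simp add: ramp_right)
qed simp

lemma tile_ramp_at:
  assumes q: "\<And>b. q b > 0"
  shows "l < length bs \<Longrightarrow> total q (take l bs) \<le> x \<Longrightarrow> x \<le> total q (take (Suc l) bs) \<Longrightarrow>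
    tile (ramp c q) q bs x = total c (take l bs) + c (bs ! l) * ((x - total q (take l bs)) / q (bs ! l))"
proof (induction bs arbitrary: l x)
  case (Cons b bs)
  show ?case
  proof (cases l)
    case 0
    then show ?thesis using Cons.prems tile_ramp_left[of q "x - q b" c bs] q by (simp add: ramp_mid)
  next
    case (Suc k)
    have "total q (take k bs) \<ge> 0" using q by (intro total_nonneg) (simp add: less_imp_le)
    then have "ramp c q b x = c b" using Cons.prems Suc q by (intro ramp_right) auto
    moreover have "tile (ramp c q) q bs (x - q b) = total c (take k bs) + c (bs ! k) * ((x - q b - total q (take k bs)) / q (bs ! k))"
      by (rule Cons.IH) (use Cons.prems Suc in auto)
    ultimately show ?thesis using Suc by (simp add: algebra_simps)
  qed
qed simp

text \<open>
  The ramp of a letter and the broken line along its refinement have the same end points, hence differ by a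
  bump; for words of length at most 2 the bump has height at most \<open>4 X\<close>.
\<close>

lemma ramp_refinement_tileable:
  assumes "\<And>b. q' b > 0" "\<And>b. q b = total q' (\<sigma> b)" "\<And>b. c b = total c' (\<sigma> b)" "\<And>b. \<sigma> b \<noteq> []"
    and "\<And>b. \<bar>c' b\<bar> \<le> X" "\<And>b. length (\<sigma> b) \<le> 2"
  shows "tileable (\<lambda>b x. tile (ramp c' q') q' (\<sigma> b) x - ramp c q b x) q (4 * X)"
proof -
  have q: "q b > 0" for b
  proof -
    obtain y ys where y: "\<sigma> b = y # ys" using assms(4)[of b] by (cases "\<sigma> b") auto
    have "total q' ys \<ge> 0" using assms(1) by (intro total_nonneg) (simp add: less_imp_le)
    then show ?thesis using assms(1)[of y] by (simp add: assms(2) y)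
  qed
  have X: "X \<ge> 0" using assms(5)[of undefined] by linarith
  have tb: "\<bar>tile (ramp c' q') q' bs x\<bar> \<le> X * length bs" for bs x
  proof (induction bs arbitrary: x)
    case (Cons b bs)
    have "\<bar>tile (ramp c' q') q' bs (x - q' b)\<bar> \<le> X * length bs" by (rule Cons.IH)
    then have "\<bar>tile (ramp c' q') q' (b # bs) x\<bar> \<le> X + X * length bs"
      using ramp_bound[of c' q' b x] assms(5)[of b] unfolding tile.simps by linarith
    then show ?case by (simp add: algebra_simps)
  qed simp
  have cb: "\<bar>total c' bs\<bar> \<le> X * length bs" for bs
  proof (induction bs)
    case (Cons b bs)
    then show ?case using assms(5)[of b] by (simp add: algebra_simps)
  qed simp
  have l: "X * length (\<sigma> b) \<le> 2 * X" for b
    using mult_left_mono[of "real (length (\<sigma> b))" 2 X] assms(6)[of b] X by simp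
  have "\<bar>tile (ramp c' q') q' (\<sigma> b) x - ramp c q b x\<bar> \<le> 4 * X" for b x
    using tb[of "\<sigma> b" x] ramp_bound[of c q b x] cb[of "\<sigma> b"] l[of b] assms(3)[of b] by linarith
  moreover have "continuous_on UNIV (\<lambda>x. tile (ramp c' q') q' (\<sigma> b) x - ramp c q b x)" for b
    by (intro continuous_intros tile_continuous ramp_continuous)
  ultimately show ?thesis
    using q assms(1-3) by (auto simp: tileable_def tile_ramp_left ramp_left ramp_right tile_ramp_right)
qed

section \<open>Integrals against Hoelder functions: one step and many steps\<close>

text \<open>
  The hypotheses of the estimate, freed from interval exchanges: a positive orbit \<open>q\<close> of vectors, a
  subexponentially small orbit \<open>c\<close> (the central vector at all levels) and the second Roth condition on the
  hyperplane orthogonal to \<open>q 0\<close>.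
\<close>

locale dual_roth_chain = roth_chain A t for A :: "nat \<Rightarrow> 'a::finite arrow" and t +
  fixes q c :: "nat \<Rightarrow> real^'a"
  assumes q_orbit: "q i = arrow_matrix (A i) *v q (Suc i)"
    and q_pos: "q i $ b > 0"
    and norm_q_0: "norm (q 0) = 1"
    and c_orbit: "c i = arrow_matrix (A i) *v c (Suc i)"
    and c_small: "\<epsilon> > 0 \<Longrightarrow> \<exists>C>0. \<forall>k. norm (c k) \<le> C * N k powr \<epsilon>"
    and dual: "\<exists>\<theta>>0. \<exists>C>0. \<forall>k v. v \<bullet> q 0 = 0 \<longrightarrow>
      norm (transpose (bmat A 0 k) *v v) \<le> C * N k powr (1 - \<theta>) * norm v"
begin

text \<open>
  The function of the theorem at level \<open>-k\<close>, normalised to vanish at \<open>0\<close> instead of having mean 0.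
\<close>

definition F :: "nat \<Rightarrow> 'a \<Rightarrow> real \<Rightarrow> real" where
  "F k a = tile (ramp (($) (c k)) (($) (q k))) (($) (q k)) (word A 0 k a)"

text \<open>
  What one backward step changes above an interval of the letter \<open>b\<close> of level \<open>-k\<close>.
\<close>

definition defect :: "nat \<Rightarrow> 'a \<Rightarrow> real \<Rightarrow> real" where
  "defect k b x = tile (ramp (($) (c (Suc k))) (($) (q (Suc k)))) (($) (q (Suc k))) (split_word (A k) b) x
      - ramp (($) (c k)) (($) (q k)) b x"

lemma total_q: "total (($) (q (j + k))) (word A j k a) = q j $ a"
  using bmat_orbit[OF q_orbit, of j k] bmat_word[of A j k "q (j + k)" a] by simp

lemma split_orbit: "v i = arrow_matrix (A i) *v v (Suc i) \<Longrightarrow> v i $ b = total (($) (v (Suc i))) (split_word (A i) b)"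
  by (metis arrow_matrix_split_word)

lemma F_continuous: "continuous_on S (F k a)"
  unfolding F_def by (rule continuous_on_subset[OF tile_continuous[OF ramp_continuous]]) simp

lemma F_Suc: "F (Suc k) a x - F k a x = tile (defect k) (($) (q k)) (word A 0 k a) x"
proof -
  have "F (Suc k) a x = tile (\<lambda>b. tile (ramp (($) (c (Suc k))) (($) (q (Suc k)))) (($) (q (Suc k))) (split_word (A k) b))
      (($) (q k)) (word A 0 k a) x"
    unfolding F_def word.simps tile_concat split_orbit[of q k, OF q_orbit] by simp
  then show ?thesis unfolding defect_def tile_diff by (simp add: F_def)
qed

lemma defect_tileable:
  assumes "\<And>b. \<bar>c (Suc k) $ b\<bar> \<le> X"
  shows "tileable (defect k) (($) (q k)) (4 * X)"
  unfolding defect_def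
  using q_pos split_orbit[of q k, OF q_orbit] split_orbit[of c k, OF c_orbit] assms
  by (intro ramp_refinement_tileable) (auto simp: split_word_def)

lemma q_0_le_1: "q 0 $ a \<le> 1"
  using component_le_norm_cart[of "q 0" a] norm_q_0 by linarith

lemma N_transpose_inverse:
  obtains v where "u = transpose (bmat A 0 m) *v v" 
    "norm v \<le> CARD('a) * fact CARD('a) * N m ^ CARD('a) * norm u"
proof -
  have d: "det (transpose (bmat A 0 m)) = 1" by (simp add: det_bmat)
  then have "invertible (transpose (bmat A 0 m))" by (simp add: invertible_det_nz)
  then obtain B where "transpose (bmat A 0 m) ** B = mat 1" by (auto simp: invertible_def)
  then have u: "u = transpose (bmat A 0 m) *v (B *v u)" by (simp add: matrix_vector_mul_assoc)
  show ?thesis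
    using that[OF u] norm_le_of_det_1[OF d, of "B *v u"] N_ge_1[of m] u by (simp add: mat_norm_transpose)
qed

text \<open>
  The intervals of level \<open>-i\<close> are grouped into those of level \<open>-m\<close>.  Up to the oscillation of \<open>\<psi>\<close> on the
  latter, the integral is \<open>u \<bullet> B(-i,-m) d\<close>, with \<open>d\<close> the integrals of the bumps and \<open>u $ g\<close> the sum of the values
  of \<open>\<psi>\<close> at the left ends of the intervals of type \<open>g\<close>.  Writing \<open>u\<close> as the image of \<open>v\<close> under the transpose of \<open>B(-m,0)\<close>, the
  transpose of \<open>B(-i,-m)\<close> maps \<open>u\<close> to the image of \<open>v\<close> under the transpose of \<open>B(-i,0)\<close>, to which the second
  Roth condition applies after removal of the component of \<open>v\<close> along \<open>q 0\<close>.  That component is \<open>u \<bullet> q m\<close>, a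
  Riemann sum for the integral of \<open>\<psi>\<close>, which is \<open>0\<close>.
\<close>

lemma step_at_level:
  fixes X r r' D H M \<eta> :: real
  assumes mi: "m \<le> i" and X: "\<And>b. \<bar>c (Suc i) $ b\<bar> \<le> X"
    and r: "\<And>b. q m $ b \<le> r" and r': "\<And>b. q i $ b \<le> r'"
    and dualC: "\<And>v. v \<bullet> q 0 = 0 \<Longrightarrow> norm (transpose (bmat A 0 i) *v v) \<le> D * norm v" "D \<ge> 0"
    and \<psi>: "continuous_on {0..q 0 $ a} \<psi>" "holder_bound \<psi> (q 0 $ a) \<eta> H" "H \<ge> 0" "\<eta> > 0"
      "\<And>x. x \<in> {0..q 0 $ a} \<Longrightarrow> \<bar>\<psi> x\<bar> \<le> M" "integral {0..q 0 $ a} \<psi> = 0"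
  shows "\<bar>integral {0..q 0 $ a} (\<lambda>x. \<psi> x * (F (Suc i) a x - F i a x))\<bar> \<le>
    4 * X * (H * r powr \<eta>) + 
    CARD('a) * (4 * X * r') * (D * (2 * (CARD('a) * fact CARD('a) * N m ^ CARD('a) * (CARD('a) * (M * N m)))) + N i * (H * r powr \<eta>))"
proof -
  let ?Q = "q 0 $ a" and ?qm = "($) (q m)" and ?qi = "($) (q i)" and ?W = "word A 0 m a"
  (* k counts the steps between the two levels; \<Phi> are the bumps of level i collected over a letter of level m *)
  define k where "k = i - m"
  have i: "i = m + k" using mi by (simp add: k_def)
  have X0: "X \<ge> 0" using X[of undefined] by linarith
  have qm0: "0 \<le> q m $ b" "0 \<le> q i $ b" for b using q_pos by (auto intro: less_imp_le)
  have r0: "r \<ge> 0" "r' \<ge> 0" using r[of undefined] r'[of undefined] qm0[of undefined] by linarith+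
  have M0: "M \<ge> 0" using \<psi>(5)[of 0] q_pos[of 0 a] by (metis abs_ge_zero atLeastAtMost_iff less_imp_le order_refl order_trans)
  have tdefect: "tileable (defect i) ?qi (4 * X)" by (rule defect_tileable[OF X])
  define \<Phi> where "\<Phi> g = tile (defect i) ?qi (word A m k g)" for g
  have qmg: "q m $ g = total ?qi (word A m k g)" for g using total_q[of m k g] i by simp
  have t\<Phi>: "tileable \<Phi> ?qm (4 * X)"
    using tile_tileable[OF tdefect, where \<sigma> = "word A m k"] qm0 X0 unfolding \<Phi>_def[symmetric] qmg[symmetric] by simp
  define d :: "real^'a" where "d = (\<chi> b. integral {0..q i $ b} (defect i b))"
  have e: "integral {0..q m $ g} (\<Phi> g) = (bmat A m k *v d) $ g" for g
    using tile_integral[OF tdefect, of "word A m k g"] qm0 X0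
    by (simp add: \<Phi>_def bmat_word d_def qmg)
  define u :: "real^'a" where "u = (\<chi> b. sample_sum \<psi> ?qm (\<lambda>x. if x = b then 1 else 0) 0 ?W)"
  have Q: "?Q = total ?qm ?W" using total_q[of 0 m a] by simp
  have qmr: "0 \<le> q m $ b \<and> q m $ b \<le> r" for b using qm0 r by auto
  have eq: "F (Suc i) a x - F i a x = tile \<Phi> ?qm ?W x" for x
  proof -
    have "word A 0 i a = concat (map (word A m k) ?W)" using word_add[of A 0 m k a] i by simp
    then have "F (Suc i) a x - F i a x = tile (\<lambda>b. tile (defect i) ?qi (word A m k b)) (\<lambda>b. total ?qi (word A m k b)) ?W x"
      unfolding F_Suc by (simp only: tile_concat)
    then show ?thesis unfolding qmg[symmetric] \<Phi>_def[symmetric] .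
  qed
  have approx: "\<bar>integral {0..0 + total ?qm ?W} (\<lambda>x. \<psi> x * tile \<Phi> ?qm ?W (x - 0)) - sample_sum \<psi> ?qm (\<lambda>g. integral {0..q m $ g} (\<Phi> g)) 0 ?W\<bar>
      \<le> H * r powr \<eta> * (4 * X) * total ?qm ?W"
    by (rule tile_integral_approx[OF \<psi>(1-4) t\<Phi> qmr]) (use X0 Q in auto)
  have sample_u: "sample_sum \<psi> ?qm e 0 ?W = u \<bullet> (\<chi> g. e g)" for e
    unfolding sample_sum_linear[of \<psi> ?qm e] by (simp add: u_def inner_vec_def)
  have I1: "\<bar>integral {0..?Q} (\<lambda>x. \<psi> x * (F (Suc i) a x - F i a x)) - u \<bullet> (bmat A m k *v d)\<bar> \<le> H * r powr \<eta> * (4 * X) * ?Q"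
    using approx by (simp add: eq sample_u e Q)
  have I2: "\<bar>u \<bullet> q m\<bar> \<le> H * r powr \<eta> * ?Q"
  proof -
    have "\<bar>integral {0..0 + total ?qm ?W} \<psi> - sample_sum \<psi> ?qm ?qm 0 ?W\<bar> \<le> H * r powr \<eta> * total ?qm ?W"
      by (rule integral_approx[OF \<psi>(1-4) qmr]) (use Q in auto)
    then show ?thesis using \<psi>(6) by (simp add: sample_u Q[symmetric])
  qed
  have Hr: "H * r powr \<eta> \<ge> 0" using \<psi> by simp
  have Q1: "H * r powr \<eta> * ?Q \<le> H * r powr \<eta>" using mult_left_mono[OF q_0_le_1 Hr] by simp
  obtain v where v: "u = transpose (bmat A 0 m) *v v" 
      "norm v \<le> CARD('a) * fact CARD('a) * N m ^ CARD('a) * norm u"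
    by (rule N_transpose_inverse)
  have "norm u \<le> (\<Sum>b\<in>UNIV. \<bar>u $ b\<bar>)" by (rule norm_le_l1_cart)
  also have "\<dots> \<le> (\<Sum>b\<in>(UNIV::'a set). M * N m)"
  proof (rule sum_mono)
    fix b
    have "\<bar>u $ b\<bar> \<le> M * length ?W"
      unfolding u_def vec_lambda_beta by (rule sample_sum_bound[OF \<psi>(5)]) (use Q qm0 in auto)
    also have "\<dots> \<le> M * N m" using length_word_le[of A 0 m a] M0 by (rule mult_left_mono)
    finally show "\<bar>u $ b\<bar> \<le> M * N m" .
  qed
  finally have u: "norm u \<le> CARD('a) * (M * N m)" by simp
  define V where "V = CARD('a) * fact CARD('a) * N m ^ CARD('a) * (CARD('a) * (M * N m))"
  have "norm v \<le> V" unfolding V_def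
    by (rule order_trans[OF v(2)]) (intro mult_left_mono u; simp)
  define s where "s = v \<bullet> q 0"
  (* remove the component along q 0, where the transposed matrices may expand at full rate *)
  define v0 where "v0 = v - s *\<^sub>R q 0"
  have "v0 \<bullet> q 0 = 0" using norm_q_0 by (simp add: v0_def s_def inner_diff_left norm_eq_1)
  have "\<bar>s\<bar> \<le> norm v" using Cauchy_Schwarz_ineq2[of v "q 0"] norm_q_0 by (simp add: s_def)
  then have "norm v0 \<le> 2 * V"
    using norm_triangle_ineq4[of v "s *\<^sub>R q 0"] norm_q_0 \<open>norm v \<le> V\<close> by (simp add: v0_def)
  have "s = u \<bullet> q m"
    using bmat_orbit[OF q_orbit, of 0 m] by (simp add: s_def v(1) dot_lmul_matrix)
  then have s: "\<bar>s\<bar> \<le> H * r powr \<eta>" using I2 Q1 by simp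
  have "transpose (bmat A m k) *v u = transpose (bmat A 0 i) *v v"
    using bmat_add[of A 0 m k] unfolding i v(1) by (simp only: matrix_vector_mul_assoc matrix_transpose_mul add_0)
  also have "\<dots> = transpose (bmat A 0 i) *v v0 + s *\<^sub>R (transpose (bmat A 0 i) *v q 0)"
    by (simp add: v0_def matrix_vector_mult_diff_distrib matrix_vector_mult_scaleR)
  also have "norm \<dots> \<le> D * (2 * V) + N i * (H * r powr \<eta>)"
  proof (rule norm_triangle_le, rule add_mono)
    show "norm (transpose (bmat A 0 i) *v v0) \<le> D * (2 * V)"
      using dualC(1)[OF \<open>v0 \<bullet> q 0 = 0\<close>] mult_left_mono[OF \<open>norm v0 \<le> 2 * V\<close> dualC(2)] by linarith
    have "norm (transpose (bmat A 0 i) *v q 0) \<le> N i"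
      using norm_mult_vec_le[of "transpose (bmat A 0 i)" "q 0"] norm_q_0 by (simp add: mat_norm_transpose)
    then have "\<bar>s\<bar> * norm (transpose (bmat A 0 i) *v q 0) \<le> H * r powr \<eta> * N i"
      using s by (intro mult_mono) auto
    then show "norm (s *\<^sub>R (transpose (bmat A 0 i) *v q 0)) \<le> N i * (H * r powr \<eta>)" by (simp add: mult.commute)
  qed
  finally have tB: "norm (transpose (bmat A m k) *v u) \<le> D * (2 * V) + N i * (H * r powr \<eta>)" .
  have "\<bar>d $ b\<bar> \<le> 4 * X * r'" for b
  proof -
    have "norm (integral {0..q i $ b} (defect i b)) \<le> 4 * X * (q i $ b - 0)"
      using tdefect qm0 by (intro integral_bound) (auto simp: tileable_def intro: continuous_on_subset)
    also have "\<dots> \<le> 4 * X * r'" using r'[of b] X0 by (intro mult_left_mono) auto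
    finally show ?thesis by (simp add: d_def)
  qed
  then have "(\<Sum>b\<in>UNIV. \<bar>d $ b\<bar>) \<le> (\<Sum>b\<in>(UNIV::'a set). 4 * X * r')" by (intro sum_mono)
  then have d: "norm d \<le> CARD('a) * (4 * X * r')" using norm_le_l1_cart[of d] by simp
  have "u \<bullet> (bmat A m k *v d) = (transpose (bmat A m k) *v u) \<bullet> d"
    by (simp add: dot_lmul_matrix)
  then have "\<bar>u \<bullet> (bmat A m k *v d)\<bar> \<le> norm (transpose (bmat A m k) *v u) * norm d"
    using Cauchy_Schwarz_ineq2 by metis
  also have "\<dots> \<le> (D * (2 * V) + N i * (H * r powr \<eta>)) * (CARD('a) * (4 * X * r'))"
    using tB d norm_ge_zero order_trans by (intro mult_mono) (blast)+
  finally have "\<bar>u \<bullet> (bmat A m k *v d)\<bar> \<le> CARD('a) * (4 * X * r') * (D * (2 * V) + N i * (H * r powr \<eta>))"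
    by (simp only: mult.commute)
  moreover have "H * r powr \<eta> * (4 * X) * ?Q \<le> 4 * X * (H * r powr \<eta>)"
    using mult_left_mono[OF Q1, of "4 * X"] X0 by (simp add: mult_ac)
  ultimately show ?thesis using I1 unfolding V_def by linarith
qed

text \<open>
  The norm at most doubles from a level to the next, so every size between those of level 0 and level \<open>-i\<close> is met up to a constant.
\<close>

lemma scale_level:
  assumes "0 \<le> \<kappa>" "\<kappa> \<le> 1"
  obtains m where "m \<le> i" "N m \<le> CARD('a) * N i powr \<kappa>" "N i powr \<kappa> \<le> 2 * N m"
proof -
  let ?S = "{m. m \<le> i \<and> N m \<le> CARD('a) * N i powr \<kappa>}"
  define m where "m = Max ?S"
  have p1: "N i powr \<kappa> \<ge> 1" using N_ge_1[of i] assms by (simp add: ge_one_powr_ge_zero)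
  have "0 \<in> ?S" using p1 mult_left_mono[of 1 "N i powr \<kappa>" "real CARD('a)"] by (simp add: mat_norm_bmat_0 del: bmat.simps)
  then have m: "m \<in> ?S" unfolding m_def by (intro Max_in) auto
  have "N i powr \<kappa> \<le> 2 * N m"
  proof (cases "m = i")
    case True
    have "N i powr \<kappa> \<le> N i powr 1" using assms N_ge_1 by (intro powr_mono) auto
    then show ?thesis using True N_ge_1[of i] by simp
  next
    case False
    have "Suc m \<notin> ?S"
    proof
      assume "Suc m \<in> ?S"
      then have "Suc m \<le> Max ?S" by (intro Max_ge) auto
      then show False unfolding m_def by simp
    qed
    then have "CARD('a) * N i powr \<kappa> < N (Suc m)" using False m by auto
    moreover have "1 * N i powr \<kappa> \<le> CARD('a) * N i powr \<kappa>" by (intro mult_right_mono) (auto simp: Suc_le_eq)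
    ultimately show ?thesis using mat_norm_Suc_le[of A 0 m] by linarith
  qed
  then show ?thesis using that m by blast
qed

definition admissible :: "real \<Rightarrow> 'a \<Rightarrow> (real \<Rightarrow> real) \<Rightarrow> real \<Rightarrow> real \<Rightarrow> bool" where
  "admissible \<eta> a \<psi> H M \<longleftrightarrow> continuous_on {0..q 0 $ a} \<psi> \<and> holder_bound \<psi> (q 0 $ a) \<eta> H \<and> H \<ge> 0 \<and>
     (\<forall>x\<in>{0..q 0 $ a}. \<bar>\<psi> x\<bar> \<le> M) \<and> integral {0..q 0 $ a} \<psi> = 0"

text \<open>
  The grouping level is chosen with \<open>N m\<close> close to \<open>N i powr \<kappa>\<close>.  The exponent \<open>\<kappa> = \<theta> / (2 (d + 1))\<close> lets the
  factor \<open>N m ^ (d + 1)\<close>, which comes from Cramer's rule and from the number of samples, use up only half of the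
  gain \<open>\<theta>\<close>; the oscillation of \<open>\<psi>\<close> contributes \<open>N i powr (- \<kappa> \<eta> / 2)\<close>.  What remains is \<open>2 \<delta>\<close>, of which the
  subexponential factors take \<open>2 \<epsilon> = \<delta>\<close>.
\<close>

lemma one_step:
  assumes \<eta>: "0 < \<eta>" "\<eta> < 1"
  shows "\<exists>\<delta>>0. \<exists>C>0. \<forall>i a \<psi> H M. admissible \<eta> a \<psi> H M \<longrightarrow>
    \<bar>integral {0..q 0 $ a} (\<lambda>x. \<psi> x * (F (Suc i) a x - F i a x))\<bar> \<le> C * (H + M) * N i powr (- \<delta>)"
proof -
  obtain \<theta>0 D0 where \<theta>0: "\<theta>0 > 0" "D0 > 0" "\<And>k v. v \<bullet> q 0 = 0 \<Longrightarrow>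
      norm (transpose (bmat A 0 k) *v v) \<le> D0 * N k powr (1 - \<theta>0) * norm v"
    using dual by blast
  define \<theta> where "\<theta> = min \<theta>0 1"
  have \<theta>: "0 < \<theta>" "\<theta> \<le> 1" "\<theta> \<le> \<theta>0" using \<theta>0 by (auto simp: \<theta>_def)
  define n where "n = real CARD('a)"
  have n: "n \<ge> 1" by (simp add: n_def Suc_le_eq)
  define \<kappa> where "\<kappa> = \<theta> / (2 * (n + 1))"
  have \<kappa>n: "(n + 1) * \<kappa> = \<theta> / 2" using n by (simp add: \<kappa>_def field_simps)
  have \<kappa>0: "\<kappa> > 0" using \<theta> n by (simp add: \<kappa>_def)
  have "1 * \<kappa> \<le> (n + 1) * \<kappa>" using n \<kappa>0 by (intro mult_right_mono) auto
  then have \<kappa>: "\<kappa> \<le> \<theta> / 2" using \<kappa>n by simp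
  define \<delta> where "\<delta> = \<kappa> * \<eta> / 4"
  have \<delta>: "\<delta> > 0" using \<kappa>0 \<eta> by (simp add: \<delta>_def)
  have "\<kappa> * \<eta> \<le> \<kappa> * 1" using \<kappa>0 \<eta> by (intro mult_left_mono) auto
  then have "\<kappa> * \<eta> \<le> \<theta>" using \<kappa> \<theta> by linarith
  then have \<delta>\<theta>: "2 * \<delta> \<le> \<theta> / 2" by (simp add: \<delta>_def mult.commute)
  define \<epsilon> where "\<epsilon> = \<delta> / 2"
  have \<epsilon>: "\<epsilon> > 0" using \<delta> by (simp add: \<epsilon>_def)
  obtain C1 where C1: "C1 > 0" "\<And>k b. q k $ b \<le> C1 * N k powr (- 1 + 1/2)"
    using positive_orbit_decay[OF q_orbit q_pos, of "1/2"] by auto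
  obtain C2 where C2: "C2 > 0" "\<And>k b. q k $ b \<le> C2 * N k powr (- 1 + \<epsilon>)"
    using positive_orbit_decay[OF q_orbit q_pos \<epsilon>] by auto
  obtain C3 where C3: "C3 > 0" "\<And>k. norm (c k) \<le> C3 * N k powr \<epsilon>"
    using c_small[OF \<epsilon>] by auto
  define X0 where "X0 = C3 * 2 powr \<epsilon>"
  define R where "R = C1 powr \<eta> * 2 powr (\<eta>/2)"
  define K1 where "K1 = D0 * (2 * (n * fact CARD('a) * n)) * n ^ Suc CARD('a)"
  define C where "C = 4 * X0 * R + n * (4 * X0 * C2) * (K1 + R)"
  have pos: "X0 > 0" "R > 0" "K1 > 0" using C1 C3 \<theta>0 n by (simp_all add: X0_def R_def K1_def)
  have "\<bar>integral {0..q 0 $ a} (\<lambda>x. \<psi> x * (F (Suc i) a x - F i a x))\<bar> \<le> C * (H + M) * N i powr (- \<delta>)"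
    if adm: "admissible \<eta> a \<psi> H M" for i a \<psi> H M
  proof -
    have \<psi>: "continuous_on {0..q 0 $ a} \<psi>" "holder_bound \<psi> (q 0 $ a) \<eta> H" "H \<ge> 0"
       "\<And>x. x \<in> {0..q 0 $ a} \<Longrightarrow> \<bar>\<psi> x\<bar> \<le> M" "integral {0..q 0 $ a} \<psi> = 0"
      using adm by (auto simp: admissible_def)
    have M: "M \<ge> 0" using \<psi>(4)[of 0] q_pos[of 0 a] by (metis abs_ge_zero atLeastAtMost_iff less_imp_le order_refl order_trans)
    define y where "y = N i"
    have y: "y \<ge> 1" "y > 0" using N_ge_1 by (auto simp: y_def)
    obtain m where m: "m \<le> i" "N m \<le> n * y powr \<kappa>" "y powr \<kappa> \<le> 2 * N m"
      using scale_level[of \<kappa> i] \<kappa>0 \<kappa> \<theta> unfolding n_def y_def by auto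
    define r where "r = C1 * (y powr \<kappa> / 2) powr (- 1/2)"
    have r: "q m $ b \<le> r" for b
    proof -
      have "q m $ b \<le> C1 * N m powr (- 1/2)" using C1(2)[of m b] by simp
      also have "\<dots> \<le> r" unfolding r_def using m(3) C1(1) y by (intro mult_left_mono powr_mono2') auto
      finally show ?thesis .
    qed
    have rp: "r powr \<eta> = R * y powr (- 2 * \<delta>)"
    proof -
      have "(y powr \<kappa> / 2) powr (- 1/2) = (y powr \<kappa>) powr (- 1/2) * (1/2) powr (- 1/2)"
        by (subst powr_mult[symmetric]) auto
      also have "(y powr \<kappa>) powr (- 1/2) = y powr (- \<kappa>/2)"
        unfolding powr_powr by simp
      also have "(1/2) powr (- 1/2 :: real) = 2 powr (1/2)"
        using powr_minus_divide[of "1/2::real" "1/2"] by (simp add: powr_divide)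
      finally have "r = C1 * (y powr (- \<kappa>/2) * 2 powr (1/2))" unfolding r_def by simp
      then have "r powr \<eta> = C1 powr \<eta> * ((y powr (- \<kappa>/2)) powr \<eta> * (2 powr (1/2)) powr \<eta>)"
        using C1(1) by (simp only: powr_mult)
      also have "\<dots> = R * y powr (- \<kappa>/2 * \<eta>)" unfolding powr_powr R_def by (simp add: mult_ac)
      also have "- \<kappa>/2 * \<eta> = - 2 * \<delta>" by (simp add: \<delta>_def)
      finally show ?thesis .
    qed
    have X: "\<bar>c (Suc i) $ b\<bar> \<le> X0 * y powr \<epsilon>" for b
    proof -
      have "\<bar>c (Suc i) $ b\<bar> \<le> C3 * N (Suc i) powr \<epsilon>"
        using component_le_norm_cart[of "c (Suc i)" b] C3(2)[of "Suc i"] by linarith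
      also have "\<dots> \<le> C3 * (2 * y) powr \<epsilon>"
        using mat_norm_Suc_le[of A 0 i] C3(1) \<epsilon> unfolding y_def by (intro mult_left_mono powr_mono2) (auto simp del: bmat.simps)
      also have "\<dots> = X0 * y powr \<epsilon>" using y by (simp add: X0_def powr_mult)
      finally show ?thesis .
    qed
    have D: "norm (transpose (bmat A 0 i) *v v) \<le> D0 * y powr (1 - \<theta>) * norm v" if "v \<bullet> q 0 = 0" for v
    proof -
      have "y powr (1 - \<theta>0) \<le> y powr (1 - \<theta>)" using y \<theta> by (intro powr_mono) auto
      then have "D0 * y powr (1 - \<theta>0) * norm v \<le> D0 * y powr (1 - \<theta>) * norm v"
        using \<theta>0(2) by (intro mult_right_mono mult_left_mono) auto
      then show ?thesis using \<theta>0(3)[OF that, of i] unfolding y_def by linarith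
    qed
    have D': "D0 * y powr (1 - \<theta>) \<ge> 0" using \<theta>0 by simp
    have rb: "q i $ b \<le> C2 * y powr (- 1 + \<epsilon>)" for b using C2(2)[of i b] by (simp add: y_def)
    (* ?osc: oscillation of \<psi> on the intervals of level m; ?perp and ?par: contributions of the hyperplane
       orthogonal to q 0 and of the direction of q 0; ?pre bounds the norm of the vector of bump integrals *)
    let ?perp = "D0 * y powr (1 - \<theta>) * (2 * (n * fact CARD('a) * N m ^ CARD('a) * (n * (M * N m))))"
    let ?par = "y * (H * (R * y powr (- 2 * \<delta>)))"
    let ?pre = "n * (4 * (X0 * y powr \<epsilon>) * (C2 * y powr (- 1 + \<epsilon>)))"
    let ?I = "\<bar>integral {0..q 0 $ a} (\<lambda>x. \<psi> x * (F (Suc i) a x - F i a x))\<bar>"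
    let ?osc = "4 * (X0 * y powr \<epsilon>) * (H * (R * y powr (- 2 * \<delta>)))"
    have main: "?I \<le> ?osc + ?pre * (?perp + ?par)"
      using step_at_level[OF m(1) X r rb D D' \<psi>(1,2,3) \<eta>(1) \<psi>(4,5)]
      unfolding rp n_def y_def of_nat_mult of_nat_fact by blast
    have e1: "?perp \<le> K1 * M * y powr (1 - 2 * \<delta>)"
    proof -
      have "N m ^ CARD('a) * N m = N m ^ Suc CARD('a)" by simp
      also have "\<dots> \<le> (n * y powr \<kappa>) ^ Suc CARD('a)" using m(2) by (intro power_mono) auto
      also have "\<dots> = n ^ Suc CARD('a) * y powr (\<theta>/2)"
      proof -
        have "(y powr \<kappa>) ^ Suc CARD('a) = (y powr \<kappa>) powr real (Suc CARD('a))"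
          using y by (subst powr_realpow) auto
        also have "\<dots> = y powr (\<theta>/2)"
        proof -
          have "\<kappa> * real (Suc CARD('a)) = \<theta> / 2" unfolding \<kappa>n[symmetric] by (simp add: n_def algebra_simps)
          then show ?thesis unfolding powr_powr by (simp only:)
        qed
        finally show ?thesis by (simp add: power_mult_distrib)
      qed
      finally have "D0 * y powr (1 - \<theta>) * (2 * (n * fact CARD('a) * n * M)) * (N m ^ CARD('a) * N m) \<le> 
         D0 * y powr (1 - \<theta>) * (2 * (n * fact CARD('a) * n * M)) * (n ^ Suc CARD('a) * y powr (\<theta>/2))"
        using \<theta>0 n M by (intro mult_left_mono) auto
      also have "\<dots> = K1 * M * (y powr (1 - \<theta>) * y powr (\<theta>/2))" by (simp add: K1_def mult_ac)
      also have "y powr (1 - \<theta>) * y powr (\<theta>/2) = y powr (1 - \<theta> / 2)" by (simp add: powr_add[symmetric])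
      also have "K1 * M * y powr (1 - \<theta> / 2) \<le> K1 * M * y powr (1 - 2 * \<delta>)"
        using \<delta>\<theta> y pos M by (intro mult_left_mono powr_mono) auto
      finally show ?thesis by (simp add: mult_ac)
    qed
    have e2: "?par = R * H * y powr (1 - 2 * \<delta>)"
    proof -
      have "y powr (1 - 2 * \<delta>) = y powr 1 * y powr (- 2 * \<delta>)" by (simp only: powr_add[symmetric]) simp
      then show ?thesis using y by (simp add: mult_ac)
    qed
    have e3: "y powr \<epsilon> * y powr (- 2 * \<delta>) \<le> y powr (- \<delta>)"
      unfolding powr_add[symmetric] using y \<delta> by (intro powr_mono) (auto simp: \<epsilon>_def)
    have e4: "y powr \<epsilon> * y powr (- 1 + \<epsilon>) * y powr (1 - 2 * \<delta>) = y powr (- \<delta>)"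
      unfolding powr_add[symmetric] by (simp add: \<epsilon>_def)
    have "?osc = 4 * X0 * R * H * (y powr \<epsilon> * y powr (- 2 * \<delta>))"
      by (simp add: mult_ac)
    also have "\<dots> \<le> 4 * X0 * R * H * y powr (- \<delta>)"
      using e3 pos \<psi>(3) by (intro mult_left_mono) auto
    finally have t1: "?osc \<le> 4 * X0 * R * H * y powr (- \<delta>)" .
    have "?pre * (?perp + ?par) \<le> ?pre * (K1 * M * y powr (1 - 2 * \<delta>) + R * H * y powr (1 - 2 * \<delta>))"
      using n pos C2(1) by (intro mult_left_mono[OF add_mono[OF e1 eq_refl[OF e2]]]) auto
    also have "\<dots> = n * (4 * X0 * C2) * (K1 * M + R * H) * (y powr \<epsilon> * y powr (- 1 + \<epsilon>) * y powr (1 - 2 * \<delta>))"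
      by (simp add: algebra_simps)
    also have "\<dots> = n * (4 * X0 * C2) * (K1 * M + R * H) * y powr (- \<delta>)" unfolding e4 ..
    also have "\<dots> \<le> n * (4 * X0 * C2) * ((K1 + R) * (H + M)) * y powr (- \<delta>)"
      using n pos C2 M \<psi>(3) by (intro mult_right_mono mult_left_mono) (auto simp: algebra_simps)
    finally have t2: "?pre * (?perp + ?par) \<le> n * (4 * X0 * C2) * ((K1 + R) * (H + M)) * y powr (- \<delta>)" .
    have "4 * X0 * R * H * y powr (- \<delta>) \<le> 4 * X0 * R * (H + M) * y powr (- \<delta>)"
      using pos M by (intro mult_right_mono mult_left_mono) auto
    then have "?I \<le>
       4 * X0 * R * (H + M) * y powr (- \<delta>) + n * (4 * X0 * C2) * ((K1 + R) * (H + M)) * y powr (- \<delta>)"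
      using main t1 t2 by linarith
    also have "\<dots> = C * (H + M) * y powr (- \<delta>)" by (simp add: C_def algebra_simps)
    finally show ?thesis by (simp add: y_def)
  qed
  moreover have "C > 0" unfolding C_def using pos n C2 by (intro add_pos_pos mult_pos_pos) auto
  ultimately show ?thesis using \<delta> by blast
qed

text \<open>
  Half of the exponent pays for the summation over all later levels.
\<close>

lemma many_steps:
  assumes \<eta>: "0 < \<eta>" "\<eta> < 1"
  shows "\<exists>\<delta>>0. \<exists>C>0. \<forall>k l a \<psi> H M. admissible \<eta> a \<psi> H M \<and> k \<le> l \<longrightarrow>
    \<bar>integral {0..q 0 $ a} (\<lambda>x. \<psi> x * (F l a x - F k a x))\<bar> \<le> C * (H + M) * N k powr (- \<delta>)"
proof -
  obtain \<delta> C where \<delta>: "\<delta> > 0" "C > 0" and single: "\<And>i a \<psi> H M. admissible \<eta> a \<psi> H M \<Longrightarrow>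
    \<bar>integral {0..q 0 $ a} (\<lambda>x. \<psi> x * (F (Suc i) a x - F i a x))\<bar> \<le> C * (H + M) * N i powr (- \<delta>)"
    using one_step[OF \<eta>] by blast
  obtain C' where C': "C' > 0" "\<And>k l. (\<Sum>i=k..<l. N i powr (- (\<delta>/2))) \<le> C'"
    using sum_N_powr_bounded[of "\<delta>/2"] \<delta> by auto
  have "\<bar>integral {0..q 0 $ a} (\<lambda>x. \<psi> x * (F l a x - F k a x))\<bar> \<le> C * C' * (H + M) * N k powr (- (\<delta>/2))"
    if adm: "admissible \<eta> a \<psi> H M" and kl: "k \<le> l" for k l a \<psi> H M
  proof -
    have c: "continuous_on {0..q 0 $ a} \<psi>" using adm by (simp add: admissible_def)
    have HM: "H + M \<ge> 0"
    proof -
      have "\<bar>\<psi> 0\<bar> \<le> M" "H \<ge> 0" using adm q_pos[of 0 a] by (auto simp: admissible_def less_imp_le)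
      then show ?thesis by linarith
    qed
    have int: "(\<lambda>x. \<psi> x * (F j a x - F i a x)) integrable_on {0..q 0 $ a}" for i j
      by (intro integrable_continuous_real continuous_intros c F_continuous)
    have "\<bar>integral {0..q 0 $ a} (\<lambda>x. \<psi> x * (F l a x - F k a x))\<bar> \<le> C * (H + M) * (\<Sum>i=k..<l. N i powr (- \<delta>))"
      using kl
    proof (induction l rule: dec_induct)
      case (step j)
      have "integral {0..q 0 $ a} (\<lambda>x. \<psi> x * (F (Suc j) a x - F k a x)) = 
          integral {0..q 0 $ a} (\<lambda>x. \<psi> x * (F (Suc j) a x - F j a x) + \<psi> x * (F j a x - F k a x))"
        by (intro integral_cong) (simp add: algebra_simps)
      also have "\<dots> = integral {0..q 0 $ a} (\<lambda>x. \<psi> x * (F (Suc j) a x - F j a x)) + 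
          integral {0..q 0 $ a} (\<lambda>x. \<psi> x * (F j a x - F k a x))"
        by (rule Henstock_Kurzweil_Integration.integral_add[OF int int])
      finally show ?case using step single[OF adm, of j]
        by (simp add: distrib_left)
    qed simp
    also have "\<dots> \<le> C * (H + M) * (N k powr (- (\<delta>/2)) * C')"
    proof (rule mult_left_mono)
      have "(\<Sum>i=k..<l. N i powr (- \<delta>)) \<le> (\<Sum>i=k..<l. N k powr (- (\<delta>/2)) * N i powr (- (\<delta>/2)))"
      proof (rule sum_mono)
        fix i assume i: "i \<in> {k..<l}"
        have "N i powr (- \<delta>) = N i powr (- (\<delta>/2)) * N i powr (- (\<delta>/2))" by (simp add: powr_add[symmetric])
        also have "\<dots> \<le> N k powr (- (\<delta>/2)) * N i powr (- (\<delta>/2))"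
          using i \<delta> by (intro mult_right_mono powr_mono2') (auto intro: mat_norm_bmat_mono)
        finally show "N i powr (- \<delta>) \<le> N k powr (- (\<delta>/2)) * N i powr (- (\<delta>/2))" .
      qed
      also have "\<dots> \<le> N k powr (- (\<delta>/2)) * C'"
        unfolding sum_distrib_left[symmetric] by (intro mult_left_mono C') auto
      finally show "(\<Sum>i=k..<l. N i powr (- \<delta>)) \<le> N k powr (- (\<delta>/2)) * C'" .
    qed (use \<delta> HM in auto)
    finally show ?thesis by (simp add: mult_ac)
  qed
  moreover have "\<delta>/2 > 0" "C * C' > 0" using \<delta> C' by auto
  ultimately show ?thesis by blast
qed

end

section \<open>The backward orbit of a typical point\<close>

lemma int_GreatestI:
  assumes "P (m :: int)" "\<And>n. P n \<Longrightarrow> n < b"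
  shows "P (GREATEST n. P n)"
proof -
  let ?S = "{n \<in> {m..b}. P n}"
  have fin: "finite ?S" by (rule finite_subset[of _ "{m..b}"]) auto
  have m: "m \<in> ?S" using assms(1) assms(2)[OF assms(1)] by simp
  have M: "P (Max ?S)" using Max_in[OF fin] m by blast
  have "(GREATEST n. P n) = Max ?S"
  proof (rule Greatest_equality)
    show "P (Max ?S)" by (rule M)
    fix n assume n: "P n"
    show "n \<le> Max ?S"
    proof (cases "n \<ge> m")
      case True
      then show ?thesis using n assms(2)[OF n] fin by (intro Max_ge) auto
    next
      case False
      then show ?thesis using Max_ge[OF fin m] by linarith
    qed
  qed
  then show ?thesis using M by simp
qed

declare n_hat.simps(2) [simp del]

text \<open>
  Here \<open>P i\<close> is the backward orbit of \<open>(\<pi>, \<tau>)\<close>, \<open>A i\<close> the arrow leading from \<open>P (i+1)\<close> to \<open>P i\<close>, and \<open>h i\<close> the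
  heights at level \<open>-i\<close>.
\<close>

locale typical_setup =
  fixes \<pi> :: "'a::finite comb" and len \<tau> :: "real^'a"
  assumes card2: "CARD('a) \<ge> 2" and typical: "typical_point \<pi> len \<tau>" and dRoth: "dual_Roth_type \<pi> \<tau>"
begin

abbreviation \<gamma> :: "int \<Rightarrow> 'a arrow" where "\<gamma> \<equiv> rv_path \<pi> len \<tau>"

definition A :: "nat \<Rightarrow> 'a arrow" where "A i = backward_path \<pi> \<tau> (- int i)"

definition P :: "nat \<Rightarrow> 'a comb \<times> (real^'a)" where "P i = (bwd_pair ^^ i) (\<pi>, \<tau>)"

lemma A_P: "A i = bwd_arrow (fst (P i)) (snd (P i))"
  by (simp add: A_def P_def backward_path_def case_prod_beta)

lemma P_Suc: "P (Suc i) = (fst (A i), augment (A i) (snd (P i)))"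
  unfolding A_P by (simp add: P_def bwd_pair_def Let_def case_prod_beta)

lemma A_\<gamma>: "A i = \<gamma> (- int i)"
  by (simp add: A_def rv_path_def)

lemma typical_facts:
  "comb_data \<pi>" "\<And>\<alpha>. len $ \<alpha> > 0" "\<tau> \<in> suspension_cone \<pi>" "backward_defined \<pi> \<tau>" "oseledets_generic \<gamma>"
  using typical by (simp_all add: typical_point_def Let_def)

lemma P_suspension: "suspension_pair (P i)"
proof (induction i)
  case 0
  show ?case using typical_facts by (simp add: P_def suspension_pair_def)
next
  case (Suc i)
  have "(\<Sum>\<alpha>\<in>UNIV. snd (P i) $ \<alpha>) \<noteq> 0"
    using typical_facts(4) by (simp add: backward_defined_def P_def case_prod_beta)
  then have "suspension_pair (bwd_pair (fst (P i), snd (P i)))"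
    using Suc card2 by (intro bwd_pair_suspension) auto
  then show ?case by (simp add: P_def)
qed

lemma P_predecessor: "predecessor (snd (A i)) (fst (P i)) (fst (P (Suc i))) (winner (A i)) (loser (A i))"
  using bwd_arrow_predecessor[of "fst (P i)" "snd (P i)"] P_suspension[of i] card2
  by (simp add: A_P P_Suc)

lemma P_comb: "comb_data (fst (P i))"
  using P_suspension[of i] by (auto simp: suspension_pair_def)

definition h :: "nat \<Rightarrow> real^'a" where "h i = hvec (P i)"

lemma h_pos: "h i $ b > 0"
  unfolding h_def using hvec_pos[of "fst (P i)" "snd (P i)"] P_suspension[of i] card2 by simp

lemma h_orbit: "h i = arrow_matrix (A i) *v h (Suc i)"
proof -
  have "h i $ b = (arrow_matrix (A i) *v h (Suc i)) $ b" for b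
    using predecessor_translation[OF P_comb P_predecessor, of b i "snd (P i)"]
      predecessor_translation_loser[OF P_comb P_predecessor, of i "snd (P i)"]
    by (auto simp: h_def hvec_def arrow_matrix_mult_vec P_Suc augment_add_entry case_prod_beta)
  then show ?thesis by (simp add: vec_eq_iff)
qed

lemma arrow_source_winner:
  "winner (arrow_source ty \<rho>, ty) = last_letter ((if ty = Top then fst else snd) \<rho>)"
  by (cases ty) auto

lemma winner_A: "winner (A i) = last_letter ((if snd (A i) = Top then fst else snd) (fst (P i)))"
  unfolding A_P bwd_arrow_def Let_def arrow_source_winner by simp

lemma winner_A': "winner (A i) = last_letter ((if snd (A i) = Top then fst else snd) (fst (P (Suc i))))"
  by (cases "A i"; cases "snd (A i)") (auto simp: P_Suc)

lemma loser_A: "loser (A i) = last_letter ((if snd (A i) = Top then snd else fst) (fst (P (Suc i))))"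
  by (cases "A i"; cases "snd (A i)") (auto simp: P_Suc)

text \<open>
  Consecutive arrows share the data \<open>P (i+1)\<close>, target of one and source of the other.  The winner of the
  arrow with this target is one of its two last letters, and these are winner and loser of the arrow with
  this source.
\<close>

lemma chain_A: "winner (A i) \<noteq> winner (A (Suc i)) \<Longrightarrow> loser (A i) = winner (A (Suc i))"
  unfolding winner_A[of "Suc i"] winner_A'[of i] loser_A[of i] by (auto split: if_splits)

lemma same_type_winner: "snd (A i) = snd (A (Suc i)) \<Longrightarrow> winner (A i) = winner (A (Suc i))"
  unfolding winner_A[of "Suc i"] winner_A'[of i] by simp

abbreviation bpath :: "int \<Rightarrow> 'a arrow" where "bpath \<equiv> backward_path \<pi> \<tau>"

abbreviation nh :: "nat \<Rightarrow> int" where "nh \<equiv> n_hat bpath"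

definition t :: "nat \<Rightarrow> nat" where "t k = nat (- nh k)"

text \<open>
  The greatest index in the definition of \<open>n_hat\<close> exists: indices are bounded above, and prolonging a complete
  path of the given decomposition gives one index.
\<close>

lemma nh_step: "nh (Suc k) < nh k \<and> complete_path bpath (nh (Suc k)) (nh k)"
proof -
  have "backward_infinity_complete bpath"
    using dRoth by (simp add: dual_Roth_type_def Let_def)
  then obtain m :: "nat \<Rightarrow> int" where m: "m 0 = 0" "\<And>k. m (Suc k) < m k" 
      "\<And>k. complete_path bpath (m (Suc k)) (m k)"
    by (auto simp: backward_infinity_complete_def)
  have mle: "m k \<le> - int k" for k
  proof (induction k)
    case (Suc k)
    then show ?case using m(2)[of k] by simp
  qed (simp add: m)
  define j where "j = nat (- nh k)"
  have j: "m j \<le> nh k" using mle[of j] by (cases "nh k \<le> 0") (auto simp: j_def)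
  have "complete_path bpath (m (Suc j)) (nh k)"
    unfolding complete_path_def
  proof
    fix \<alpha>
    obtain i where "i \<in> {m (Suc j) + 1..m j}" "winner (bpath i) = \<alpha>"
      using m(3)[of j] unfolding complete_path_def by blast
    then show "\<exists>i\<in>{m (Suc j) + 1..nh k}. winner (bpath i) = \<alpha>"
      using j by (intro bexI[of _ i]) auto
  qed
  moreover have "m (Suc j) < nh k" using m(2)[of j] j by simp
  ultimately have "m (Suc j) < nh k \<and> complete_path bpath (m (Suc j)) (nh k)" by simp
  then show ?thesis
    unfolding n_hat.simps(2) by (rule int_GreatestI) auto
qed

lemma nh_t: "nh k = - int (t k)"
proof -
  have "nh k \<le> 0"
  proof (induction k)
    case (Suc k)
    then show ?case using nh_step[of k] by linarith
  qed simp
  then show ?thesis by (simp add: t_def)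
qed

lemma win_A: "all_win A (t k) (t (Suc k))"
  unfolding all_win_def
proof
  fix b
  obtain i where i: "i \<in> {nh (Suc k) + 1..nh k}" "winner (bpath i) = b"
    using nh_step[of k] unfolding complete_path_def by blast
  then show "\<exists>i\<in>{t k..<t (Suc k)}. winner (A i) = b"
    unfolding nh_t by (intro bexI[of _ "nat (- i)"]) (auto simp: A_def)
qed

lemma path_matrix_A: "path_matrix bpath (- int (j + k)) (- int j) = bmat A j k"
  unfolding path_matrix_bmat A_def ..

lemma bmat_\<gamma>: "path_matrix \<gamma> (- int k) 0 = bmat A 0 k"
proof -
  have "A = (\<lambda>i. \<gamma> (- int i))" using A_\<gamma> by auto
  then show ?thesis using path_matrix_bmat[of \<gamma> 0 k] by simp
qed

lemma roth_A:
  assumes "\<epsilon> > 0"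
  shows "\<exists>C>0. \<forall>k. mat_norm (bmat A (t k) (t (Suc k) - t k)) \<le> C * mat_norm (bmat A 0 (t k)) powr \<epsilon>"
proof -
  obtain C where C: "C > 0" "\<And>k. mat_norm (path_matrix bpath (nh (Suc k)) (nh k)) \<le>
      C * mat_norm (path_matrix bpath (nh k) 0) powr \<epsilon>"
    using dRoth assms unfolding dual_Roth_type_def Let_def by blast
  have "mat_norm (bmat A (t k) (t (Suc k) - t k)) \<le> C * mat_norm (bmat A 0 (t k)) powr \<epsilon>" for k
  proof -
    have "t k < t (Suc k)" using nh_step[of k] unfolding nh_t by simp
    then have "path_matrix bpath (nh (Suc k)) (nh k) = bmat A (t k) (t (Suc k) - t k)"
      using path_matrix_A[of "t k" "t (Suc k) - t k"] by (simp add: nh_t)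
    moreover have "path_matrix bpath (nh k) 0 = bmat A 0 (t k)"
      using path_matrix_A[of 0 "t k"] by (simp add: nh_t)
    ultimately show ?thesis using C(2)[of k] by simp
  qed
  then show ?thesis using C(1) by blast
qed

sublocale roth_chain A t
proof
  show "winner (A i) \<noteq> loser (A i)" for i using predecessor_neq[OF P_predecessor] .
  show "t 0 = 0" by (simp add: t_def)
qed (use chain_A win_A roth_A in blast)+

definition lev :: "nat \<Rightarrow> real^'a \<Rightarrow> real^'a" where
  "lev k v = matrix_inv (bmat A 0 k) *v v"

lemma at_level_lev: "at_level \<pi> len \<tau> (- int k) v = lev k v"
  by (simp add: at_level_def B_mat_def bmat_\<gamma> lev_def)

lemma bmat_inv: "bmat A 0 k ** matrix_inv (bmat A 0 k) = mat 1 \<and> matrix_inv (bmat A 0 k) ** bmat A 0 k = mat 1"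
proof -
  have "invertible (bmat A 0 k)" by (simp add: invertible_det_nz det_bmat)
  then have "\<exists>B. bmat A 0 k ** B = mat 1 \<and> B ** bmat A 0 k = mat 1" by (simp add: invertible_def)
  then show ?thesis unfolding matrix_inv_def by (rule someI_ex)
qed

lemma bmat_lev: "bmat A 0 k *v lev k v = v"
  unfolding lev_def using bmat_inv[of k] by (simp add: matrix_vector_mul_assoc)

lemma lev_eqI: "bmat A 0 k *v w = v \<Longrightarrow> lev k v = w"
  unfolding lev_def using bmat_inv[of k] by (auto simp: matrix_vector_mul_assoc)

lemma lev_orbit: "lev i v = arrow_matrix (A i) *v lev (Suc i) v"
  using bmat_lev[of "Suc i" v] by (intro lev_eqI) (simp add: matrix_vector_mul_assoc)

lemma lev_h: "lev k (h 0) = h k"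
  using bmat_orbit[OF h_orbit, of 0 k] by (intro lev_eqI) simp

lemma lev_0: "lev 0 v = v"
  by (rule lev_eqI) simp

lemma lev_scaleR: "lev k (s *\<^sub>R v) = s *\<^sub>R lev k v"
  by (simp add: lev_def matrix_vector_mult_scaleR)

lemma lev_sum: "lev k (\<Sum>x\<in>S. f x) = (\<Sum>x\<in>S. lev k (f x))"
  unfolding lev_def by (induction S rule: infinite_finite_induct) (simp_all add: matrix_vector_right_distrib)

lemma lev_zero: "lev k v = 0 \<longleftrightarrow> v = 0"
  using bmat_lev[of k v] lev_eqI[of k 0 0] by auto

lemma norm_le_lev: "norm v \<le> N k * norm (lev k v)"
  using norm_mult_vec_le[of "bmat A 0 k" "lev k v"] by (simp add: bmat_lev)

lemma cocycle_lev: "cocycle \<gamma> (- int k) *v v = lev k v"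
proof (cases "k = 0")
  case True
  then show ?thesis by (simp add: cocycle_def path_matrix_def lev_0)
qed (simp add: cocycle_def bmat_\<gamma> lev_def)

text \<open>
  The absolute value of Zorich time at level \<open>-k\<close>.
\<close>

definition z :: "nat \<Rightarrow> real" where "z k = real (num_blocks \<gamma> (- int k) 0)"

lemma zorich_z: "real_of_int (zorich_time \<gamma> (- int k)) = - z k"
proof (cases "k = 0")
  case True
  then show ?thesis by (simp add: zorich_time_def z_def num_blocks_def)
qed (simp add: zorich_time_def z_def)

text \<open>
  As long as the type does not change the winner stays the same, and then no other letter could ever win.
\<close>

lemma infinite_type_changes: "infinite {j. snd (A j) \<noteq> snd (A (Suc j))}"
proof
  assume "finite {j. snd (A j) \<noteq> snd (A (Suc j))}"
  then obtain j0 where j0: "\<And>j. snd (A j) \<noteq> snd (A (Suc j)) \<Longrightarrow> j < j0"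
    unfolding finite_nat_set_iff_bounded by auto
  have w: "winner (A j) = winner (A j0)" if "j0 \<le> j" for j
    using that
  proof (induction j rule: dec_induct)
    case (step j)
    then show ?case using same_type_winner[of j] j0[of j] by force
  qed simp
  obtain k where k: "t k \<le> j0" "j0 < t (Suc k)" by (rule t_bracket)
  obtain b :: 'a where b: "b \<noteq> winner (A j0)"
    using card2 by (metis (full_types) UNIV_eq_I card_1_singleton_iff card_2_iff insert_iff not_less_eq_eq numeral_2_eq_2 One_nat_def empty_iff is_singletonI is_singleton_altdef le_refl)
  obtain i where "i \<in> {t (Suc k)..<t (Suc (Suc k))}" "winner (A i) = b"
    using win_A[of "Suc k"] unfolding all_win_def by blast
  then show False using w[of i] k b by simp
qed

lemma z_at_top: "filterlim z at_top sequentially"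
  unfolding filterlim_at_top
proof
  fix Z :: real
  obtain S where S: "finite S" "card S = nat \<lceil>Z\<rceil>" "S \<subseteq> {j. snd (A j) \<noteq> snd (A (Suc j))}"
    using infinite_arbitrarily_large[OF infinite_type_changes] by blast
  obtain b where b: "\<And>j. j \<in> S \<Longrightarrow> j < b" using S(1) unfolding finite_nat_set_iff_bounded by auto
  have "Z \<le> z k" if "k \<ge> Suc b" for k
  proof -
    let ?T = "{i \<in> {- int k + 1..0}. i = - int k + 1 \<or> snd (\<gamma> i) \<noteq> snd (\<gamma> (i - 1))}"
    have "(\<lambda>j. - int j) ` S \<subseteq> ?T"
    proof
      fix i assume "i \<in> (\<lambda>j. - int j) ` S"
      then obtain j where j: "j \<in> S" "i = - int j" by auto
      have "snd (A j) \<noteq> snd (A (Suc j))" using j S(3) by auto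
      moreover have "- int (Suc j) = i - 1" using j(2) by simp
      ultimately have "snd (\<gamma> i) \<noteq> snd (\<gamma> (i - 1))" unfolding A_\<gamma> by (simp only: j(2) not_False_eq_True)
      then show "i \<in> ?T" using b[OF j(1)] j(2) that by auto
    qed
    moreover have "finite ?T" by (rule finite_subset[of _ "{- int k + 1..0}"]) auto
    ultimately have "card ((\<lambda>j. - int j) ` S) \<le> card ?T" by (intro card_mono)
    moreover have "card ((\<lambda>j. - int j) ` S) = card S" by (intro card_image) (simp add: inj_on_def)
    ultimately have "card S \<le> num_blocks \<gamma> (- int k) 0" by (simp add: num_blocks_def)
    then show ?thesis unfolding z_def S(2) by linarith
  qed
  then show "\<forall>\<^sub>F k in sequentially. Z \<le> z k" by (auto simp: eventually_sequentially)
qed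

text \<open>
  Exponents reverse their sign because levels are counted backwards.
\<close>

lemma oseledets_bounds:
  assumes v: "v \<in> oseledets_space \<gamma> \<theta>" "v \<noteq> 0" and "\<epsilon> > 0"
  shows "\<forall>\<^sub>F k in sequentially. exp ((- \<theta> - \<epsilon>) * z k) \<le> norm (lev k v) \<and> norm (lev k v) \<le> exp ((- \<theta> + \<epsilon>) * z k)"
proof -
  have "((\<lambda>n. ln (norm (cocycle \<gamma> n *v v)) / real_of_int (zorich_time \<gamma> n)) \<longlongrightarrow> \<theta>) at_bot"
    using v by (auto simp: oseledets_space_def)
  moreover have "filterlim (\<lambda>k. - int k) at_bot sequentially"
    unfolding filterlim_at_bot
  proof
    fix Z :: int
    show "\<forall>\<^sub>F k in sequentially. - int k \<le> Z"
      using eventually_ge_at_top[of "nat (- Z)"] by eventually_elim linarith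
  qed
  ultimately have "(\<lambda>k. ln (norm (cocycle \<gamma> (- int k) *v v)) / real_of_int (zorich_time \<gamma> (- int k))) \<longlonglongrightarrow> \<theta>"
    by (rule filterlim_compose)
  then have "(\<lambda>k. ln (norm (lev k v)) / (- z k)) \<longlonglongrightarrow> \<theta>" by (simp only: cocycle_lev zorich_z)
  then have "\<forall>\<^sub>F k in sequentially. dist (ln (norm (lev k v)) / (- z k)) \<theta> < \<epsilon>"
    using assms(3) by (rule tendstoD)
  moreover have "\<forall>\<^sub>F k in sequentially. z k \<ge> 1" using z_at_top by (simp add: filterlim_at_top)
  ultimately show ?thesis
  proof eventually_elim
    case (elim k)
    have n: "norm (lev k v) > 0" using v(2) lev_zero[of k v] by simp
    have "ln (norm (lev k v)) / z k < - \<theta> + \<epsilon>" "ln (norm (lev k v)) / z k > - \<theta> - \<epsilon>"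
      using elim by (auto simp: dist_real_def)
    then have "ln (norm (lev k v)) \<le> (- \<theta> + \<epsilon>) * z k" "ln (norm (lev k v)) \<ge> (- \<theta> - \<epsilon>) * z k"
      using elim by (auto simp: field_simps)
    then show ?case using n by (metis exp_le_cancel_iff exp_ln)
  qed
qed

end

section \<open>Exponents: the top line and the central space\<close>

lemma span_Union_finite_subspaces:
  fixes E :: "'i \<Rightarrow> 'v::real_vector set"
  assumes "finite S" "\<And>i. subspace (E i)" "v \<in> span (\<Union>i\<in>S. E i)"
  obtains f where "\<And>i. f i \<in> E i" "v = (\<Sum>i\<in>S. f i)"
proof -
  let ?T = "{\<Sum>i\<in>S. f i | f. \<forall>i. f i \<in> E i}"
  have "subspace ?T"
    unfolding subspace_def
  proof (intro conjI ballI allI)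
    show "0 \<in> ?T" using assms(2) by (auto intro!: exI[of _ "\<lambda>_. 0"] simp: subspace_0)
    fix x y assume "x \<in> ?T" "y \<in> ?T"
    then obtain f g where "\<forall>i. f i \<in> E i" "\<forall>i. g i \<in> E i" "x = (\<Sum>i\<in>S. f i)" "y = (\<Sum>i\<in>S. g i)" by auto
    then show "x + y \<in> ?T" using assms(2)
      by (auto intro!: exI[of _ "\<lambda>i. f i + g i"] simp: sum.distrib subspace_add)
  next
    fix c x assume "x \<in> ?T"
    then obtain f where "\<forall>i. f i \<in> E i" "x = (\<Sum>i\<in>S. f i)" by auto
    then show "c *\<^sub>R x \<in> ?T" using assms(2)
      by (auto intro!: exI[of _ "\<lambda>i. c *\<^sub>R f i"] simp: scaleR_sum_right subspace_scale)
  qed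
  moreover have "(\<Union>i\<in>S. E i) \<subseteq> ?T"
  proof
    fix x assume "x \<in> (\<Union>i\<in>S. E i)"
    then obtain i where i: "i \<in> S" "x \<in> E i" by auto
    have "x = (\<Sum>j\<in>S. if j = i then x else 0)" using i assms(1) by simp
    then show "x \<in> ?T" using i assms(2) by (auto intro!: exI[of _ "\<lambda>j. if j = i then x else 0"] simp: subspace_0)
  qed
  ultimately have "span (\<Union>i\<in>S. E i) \<subseteq> ?T" by (rule span_minimal[rotated])
  then show ?thesis using assms(3) that by blast
qed

context typical_setup
begin

abbreviation E :: "real \<Rightarrow> (real^'a) set" where "E \<equiv> oseledets_space \<gamma>"
abbreviation S :: "real set" where "S \<equiv> lyapunov_spectrum \<gamma>"
abbreviation \<Lambda> :: real where "\<Lambda> \<equiv> top_exponent \<gamma>"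

lemma S_facts: "finite S" "subspace (E \<theta>)" "span (\<Union>\<theta>\<in>S. E \<theta>) = UNIV" "(\<Sum>\<theta>\<in>S. dim (E \<theta>)) = CARD('a)"
  using typical_facts(5) by (simp_all add: oseledets_generic_def)

lemma S_dim: "\<theta> \<in> S \<Longrightarrow> dim (E \<theta>) \<ge> 1"
proof -
  assume "\<theta> \<in> S"
  then have "E \<theta> \<noteq> {0}" by (simp add: lyapunov_spectrum_def)
  moreover have "0 \<in> E \<theta>" using S_facts(2) by (rule subspace_0)
  ultimately have "dim (E \<theta>) \<noteq> 0" by (auto simp: dim_eq_0)
  then show ?thesis by linarith
qed

lemma S_nonempty: "S \<noteq> {}"
  using S_facts(4) card2 by (auto simp: card_eq_0_iff)

lemma top_mem: "\<Lambda> \<in> S"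
  unfolding top_exponent_def using S_facts(1) S_nonempty by (rule Max_in)

lemma top_ge: "\<theta> \<in> S \<Longrightarrow> \<theta> \<le> \<Lambda>"
  unfolding top_exponent_def using S_facts(1) by (rule Max_ge)

lemma dim_top: "dim (E \<Lambda>) = 1"
  using typical by (simp add: typical_point_def Let_def)

text \<open>
  If no exponent were positive, the genus would be \<open>0\<close>, no exponent would be negative either, and the only
  exponent \<open>0\<close> would have multiplicity \<open>d \<ge> 2\<close>, contrary to the simplicity of the largest one.
\<close>

lemma top_pos: "\<Lambda> > 0"
proof (rule ccontr)
  assume "\<not> \<Lambda> > 0"
  then have le: "\<theta> \<le> 0" if "\<theta> \<in> S" for \<theta> using top_ge[OF that] by simp
  have g: "(\<Sum>\<theta>\<in>{\<theta> \<in> S. \<theta> > 0}. dim (E \<theta>)) = genus \<pi>" "(\<Sum>\<theta>\<in>{\<theta> \<in> S. \<theta> < 0}. dim (E \<theta>)) = genus \<pi>"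
    using typical by (simp_all add: typical_point_def Let_def)
  have "{\<theta> \<in> S. \<theta> > 0} = {}" using le by force
  then have "genus \<pi> = 0" using g(1) by (metis sum.empty)
  then have s0: "(\<Sum>\<theta>\<in>{\<theta> \<in> S. \<theta> < 0}. dim (E \<theta>)) = 0" using g(2) by (simp only:)
  have "\<not> \<theta> < 0" if "\<theta> \<in> S" for \<theta>
  proof
    assume "\<theta> < 0"
    then have "dim (E \<theta>) \<le> (\<Sum>\<theta>\<in>{\<theta> \<in> S. \<theta> < 0}. dim (E \<theta>))"
      using that S_facts(1) by (intro member_le_sum) auto
    then show False using S_dim[OF that] s0 by linarith
  qed
  then have zero: "\<theta> = 0" if "\<theta> \<in> S" for \<theta> using le[OF that] that by fastforce
  have S0: "S = {0}"
  proof (intro set_eqI iffI)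
    fix x assume "x \<in> {0 :: real}"
    then show "x \<in> S" using top_mem zero[OF top_mem] by (metis singletonD)
  qed (simp add: zero)
  have "dim (E 0) = 1" using dim_top unfolding zero[OF top_mem] .
  then show False using S_facts(4) card2 unfolding S0 by simp
qed

text \<open>
  A vector of the top line is contracted by \<open>B(-k,0)\<close> inverse at the top rate, so that \<open>B(-k,0)\<close> expands at least as much.
\<close>

lemma N_ge_exp:
  assumes "\<epsilon> > 0"
  shows "\<exists>a>0. \<forall>\<^sub>F k in sequentially. a * exp ((\<Lambda> - \<epsilon>) * z k) \<le> N k"
proof -
  obtain w where w: "w \<in> E \<Lambda>" "w \<noteq> 0" 
    using top_mem S_facts(2)[of \<Lambda>] subspace_0 unfolding lyapunov_spectrum_def by blast
  have "\<forall>\<^sub>F k in sequentially. norm w * exp ((\<Lambda> - \<epsilon>) * z k) \<le> N k"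
    using oseledets_bounds[OF w assms]
  proof eventually_elim
    case (elim k)
    have "N k * norm (lev k w) \<le> N k * exp ((- \<Lambda> + \<epsilon>) * z k)"
      by (intro mult_left_mono conjunct2[OF elim]) simp
    then have "norm w \<le> N k * exp ((- \<Lambda> + \<epsilon>) * z k)"
      using norm_le_lev[of w k] by linarith
    then have "norm w * exp ((\<Lambda> - \<epsilon>) * z k) \<le> (N k * exp ((- \<Lambda> + \<epsilon>) * z k)) * exp ((\<Lambda> - \<epsilon>) * z k)"
      by (intro mult_right_mono) auto
    also have "\<dots> = N k" by (simp add: mult.assoc exp_add[symmetric] distrib_right[symmetric])
    finally show ?case .
  qed
  then show ?thesis using w by (intro exI[of _ "norm w"]) auto
qed

text \<open>
  Subexponential in Zorich time means subpolynomial in the norm, since the norm grows exponentially in Zorich time.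
\<close>

lemma central_small:
  assumes "c \<in> E 0" "\<epsilon> > 0"
  shows "\<exists>C>0. \<forall>k. norm (lev k c) \<le> C * N k powr \<epsilon>"
proof (cases "c = 0")
  case True
  then have "lev k c = 0" for k by (simp add: lev_zero)
  then show ?thesis by (intro exI[of _ 1]) auto
next
  case False
  have L2: "\<Lambda> / 2 > 0" using top_pos by simp
  obtain a where a: "a > 0" "\<forall>\<^sub>F k in sequentially. a * exp ((\<Lambda> - \<Lambda> / 2) * z k) \<le> N k"
    using N_ge_exp[OF L2] by auto
  have "\<epsilon> * \<Lambda> / 2 > 0" using assms(2) top_pos by simp
  from oseledets_bounds[OF assms(1) False this] a(2)
  have "\<forall>\<^sub>F k in sequentially. norm (lev k c) \<le> (1 / a) powr \<epsilon> * N k powr \<epsilon>"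
  proof eventually_elim
    case (elim k)
    have "norm (lev k c) \<le> exp (\<epsilon> * \<Lambda> / 2 * z k)" using elim by simp
    also have "\<dots> = exp ((\<Lambda> - \<Lambda>/2) * z k) powr \<epsilon>" by (simp add: powr_def field_simps)
    also have "\<dots> \<le> (1 / a * N k) powr \<epsilon>" using elim a(1) assms(2) by (intro powr_mono2) (auto simp: field_simps)
    also have "\<dots> = (1 / a) powr \<epsilon> * N k powr \<epsilon>" using a(1) by (subst powr_mult) auto
    finally show ?case .
  qed
  then obtain K where K: "\<And>k. k \<ge> K \<Longrightarrow> norm (lev k c) \<le> (1 / a) powr \<epsilon> * N k powr \<epsilon>"
    by (auto simp: eventually_sequentially)
  define D where "D = (1 / a) powr \<epsilon> + (\<Sum>k<K. norm (lev k c))"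
  have "norm (lev k c) \<le> D * N k powr \<epsilon>" for k
  proof (cases "k \<ge> K")
    case True
    have "(1 / a) powr \<epsilon> * N k powr \<epsilon> \<le> D * N k powr \<epsilon>"
      by (intro mult_right_mono) (auto simp: D_def intro: sum_nonneg)
    then show ?thesis using K[OF True] by linarith
  next
    case False
    then have "norm (lev k c) \<le> (\<Sum>k<K. norm (lev k c))" by (intro member_le_sum) auto
    also have "\<dots> \<le> D * 1" by (simp add: D_def)
    also have "\<dots> \<le> D * N k powr \<epsilon>"
      using N_ge_1[of k] assms(2) by (intro mult_left_mono) (auto simp: D_def ge_one_powr_ge_zero intro!: add_nonneg_nonneg sum_nonneg)
    finally show ?thesis .
  qed
  moreover have "D > 0" using a(1) by (auto simp: D_def intro!: add_pos_nonneg sum_nonneg)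
  ultimately show ?thesis by blast
qed

text \<open>
  By positivity and balance of the columns, \<open>h k\<close> decays almost like \<open>1 / N k\<close>, hence backwards in time at
  (almost) the rate of the top exponent.  A component of \<open>h 0\<close> in an Oseledets space of a smaller exponent
  would decay more slowly; the smallest exponent \<open>\<theta>0\<close> present would dominate all others.  The gap \<open>g\<close> separates
  \<open>\<theta>0\<close> from the other exponents present and from \<open>\<Lambda>\<close>.
\<close>

lemma h_top: "h 0 \<in> E \<Lambda>"
proof -
  obtain f where f: "\<And>\<theta>. f \<theta> \<in> E \<theta>" "h 0 = (\<Sum>\<theta>\<in>S. f \<theta>)"
    by (rule span_Union_finite_subspaces[of S E "h 0"]) (auto simp: S_facts)
  define T where "T = {\<theta> \<in> S. f \<theta> \<noteq> 0}"
  have finT: "finite T" using S_facts(1) by (simp add: T_def)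
  have hT: "h 0 = (\<Sum>\<theta>\<in>T. f \<theta>)" unfolding f(2) T_def using S_facts(1) by (intro sum.mono_neutral_right) auto
  have "T \<subseteq> {\<Lambda>}"
  proof (rule ccontr)
    assume "\<not> T \<subseteq> {\<Lambda>}"
    then obtain \<theta>' where \<theta>': "\<theta>' \<in> T" "\<theta>' \<noteq> \<Lambda>" by auto
    define \<theta>0 where "\<theta>0 = Min T"
    have \<theta>0: "\<theta>0 \<in> T" using finT \<theta>' unfolding \<theta>0_def by (intro Min_in) auto
    have "\<theta>0 \<le> \<theta>'" using finT \<theta>' by (simp add: \<theta>0_def)
    then have less: "\<theta>0 < \<Lambda>" using top_ge[of \<theta>'] \<theta>' by (auto simp: T_def)
    (* \<Lambda> itself is inserted to make e below at most 1. *)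
    define g where "g = Min (insert \<Lambda> (insert (\<Lambda> - \<theta>0) ((\<lambda>\<theta>. \<theta> - \<theta>0) ` (T - {\<theta>0}))))"
    have "g \<in> insert \<Lambda> (insert (\<Lambda> - \<theta>0) ((\<lambda>\<theta>. \<theta> - \<theta>0) ` (T - {\<theta>0})))"
      unfolding g_def using finT by (intro Min_in) auto
    then have "g = \<Lambda> \<or> g = \<Lambda> - \<theta>0 \<or> (\<exists>\<theta>\<in>T - {\<theta>0}. g = \<theta> - \<theta>0)" by blast
    moreover have above: "\<theta> > \<theta>0" if "\<theta> \<in> T - {\<theta>0}" for \<theta>
      using that finT by (auto simp: \<theta>0_def order.strict_iff_order)
    ultimately have g0: "g > 0" using top_pos less by (elim disjE bexE) (auto dest!: above)
    have g: "g \<le> \<Lambda>" "g \<le> \<Lambda> - \<theta>0" "\<And>\<theta>. \<theta> \<in> T - {\<theta>0} \<Longrightarrow> g \<le> \<theta> - \<theta>0"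
      unfolding g_def using finT by (intro Min_le; simp)+
    define e where "e = g / (4 * \<Lambda>)"
    have e: "e > 0" "e * \<Lambda> = g / 4" "e \<le> 1" using g0 g(1) top_pos by (auto simp: e_def field_simps)
    have g4: "g / 4 > 0" using g0 by simp
    obtain C where C: "C > 0" "\<And>k b. h k $ b \<le> C * N k powr (- 1 + e)"
      using positive_orbit_decay[OF h_orbit h_pos e(1)] by auto
    obtain a where a: "a > 0" "\<forall>\<^sub>F k in sequentially. a * exp ((\<Lambda> - g / 4) * z k) \<le> N k"
      using N_ge_exp[OF g4] by auto
    define C' where "C' = CARD('a) * C * a powr (- 1 + e)"
    define n where "n = real (card (T - {\<theta>0}))"
    have hk: "norm (h k) \<le> CARD('a) * (C * N k powr (- 1 + e))" for k
    proof -
      have "norm (h k) \<le> (\<Sum>b\<in>UNIV. \<bar>h k $ b\<bar>)" by (rule norm_le_l1_cart)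
      also have "\<dots> \<le> (\<Sum>b\<in>(UNIV::'a set). C * N k powr (- 1 + e))"
        using C(2)[of k] h_pos[of k] by (intro sum_mono) (simp add: abs_of_pos)
      finally show ?thesis by simp
    qed
    have ev: "\<forall>\<^sub>F k in sequentially. \<forall>\<theta>\<in>T. exp ((- \<theta> - g/4) * z k) \<le> norm (lev k (f \<theta>)) \<and> norm (lev k (f \<theta>)) \<le> exp ((- \<theta> + g/4) * z k)"
      using finT f(1) g4 by (intro eventually_ball_finite ballI oseledets_bounds) (auto simp: T_def)
    have z1: "\<forall>\<^sub>F k in sequentially. z k \<ge> 0" using z_at_top by (simp add: filterlim_at_top)
    from ev a(2) z1 have "\<forall>\<^sub>F k in sequentially. 1 \<le> C' * exp (- (g/4 * z k)) + n * exp (- (g/2 * z k))"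
    proof eventually_elim
      case (elim k)
      have "lev k (f \<theta>0) = h k - (\<Sum>\<theta>\<in>T - {\<theta>0}. lev k (f \<theta>))"
        using sum.remove[OF finT \<theta>0, of "\<lambda>\<theta>. lev k (f \<theta>)"] lev_h[of k] unfolding hT lev_sum by simp
      then have "norm (lev k (f \<theta>0)) \<le> norm (h k) + (\<Sum>\<theta>\<in>T - {\<theta>0}. norm (lev k (f \<theta>)))"
        using norm_triangle_ineq4[of "h k"] norm_sum[of "\<lambda>\<theta>. lev k (f \<theta>)" "T - {\<theta>0}"] by (smt (verit))
      also have "(\<Sum>\<theta>\<in>T - {\<theta>0}. norm (lev k (f \<theta>))) \<le> (\<Sum>\<theta>\<in>T - {\<theta>0}. exp ((- \<theta>0 - 3 * g / 4) * z k))"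
      proof (rule sum_mono)
        fix \<theta> assume t: "\<theta> \<in> T - {\<theta>0}"
        have "norm (lev k (f \<theta>)) \<le> exp ((- \<theta> + g/4) * z k)" using t elim by auto
        also have "\<dots> \<le> exp ((- \<theta>0 - 3 * g / 4) * z k)"
          using g(3)[OF t] elim unfolding exp_le_cancel_iff by (intro mult_right_mono) auto
        finally show "norm (lev k (f \<theta>)) \<le> exp ((- \<theta>0 - 3 * g / 4) * z k)" .
      qed
      also have "\<dots> = n * exp ((- \<theta>0 - 3 * g / 4) * z k)" by (simp add: n_def)
      also have "norm (h k) \<le> C' * exp ((- \<theta>0 - g / 2) * z k)"
      proof -
        have "N k powr (- 1 + e) \<le> (a * exp ((\<Lambda> - g / 4) * z k)) powr (- 1 + e)"
          using elim e a(1) by (intro powr_mono2') auto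
        also have "\<dots> = a powr (- 1 + e) * exp ((- 1 + e) * ((\<Lambda> - g / 4) * z k))"
          using a(1) by (simp add: powr_mult exp_powr_real mult.commute)
        also have "\<dots> \<le> a powr (- 1 + e) * exp ((- \<theta>0 - g / 2) * z k)"
        proof -
          have "(- 1 + e) * (\<Lambda> - g / 4) = - \<Lambda> + g / 4 + e * \<Lambda> - e * g / 4"
            by (simp add: field_simps)
          also have "\<dots> \<le> - \<theta>0 - g / 2" using g(2) mult_pos_pos[OF e(1) g0] unfolding e(2) by linarith
          finally have "(- 1 + e) * (\<Lambda> - g / 4) * z k \<le> (- \<theta>0 - g / 2) * z k"
            using elim by (intro mult_right_mono) auto
          then show ?thesis by (intro mult_left_mono) (auto simp: mult.assoc)
        qed
        finally have "CARD('a) * (C * N k powr (- 1 + e)) \<le> CARD('a) * (C * (a powr (- 1 + e) * exp ((- \<theta>0 - g / 2) * z k)))"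
          using C(1) by (intro mult_left_mono) auto
        from order_trans[OF hk[of k] this] show ?thesis by (simp only: C'_def mult.assoc)
      qed
      finally have "exp ((- \<theta>0 - g/4) * z k) \<le> C' * exp ((- \<theta>0 - g / 2) * z k) + n * exp ((- \<theta>0 - 3 * g / 4) * z k)"
        using elim \<theta>0 by (smt (verit))
      (* divide by the lower bound for the slowest component *)
      then have "exp ((\<theta>0 + g/4) * z k) * exp ((- \<theta>0 - g/4) * z k) \<le> exp ((\<theta>0 + g/4) * z k) * (C' * exp ((- \<theta>0 - g / 2) * z k) + n * exp ((- \<theta>0 - 3 * g / 4) * z k))"
        by (intro mult_left_mono) auto
      then show ?case
        by (simp add: distrib_left mult.left_commute[of "exp _"] exp_add[symmetric] algebra_simps)
    qed
    moreover have "(\<lambda>k. C' * exp (- (g/4 * z k)) + n * exp (- (g/2 * z k))) \<longlonglongrightarrow> C' * 0 + n * 0"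
    proof (intro tendsto_intros)
      have lim: "((\<lambda>k. exp (- (s * z k))) \<longlonglongrightarrow> 0)" if "s > 0" for s
      proof -
        have "filterlim (\<lambda>k. s * z k) at_top sequentially"
          using that z_at_top by (intro filterlim_tendsto_pos_mult_at_top[OF tendsto_const])
        then have "filterlim (\<lambda>k. - (s * z k)) at_bot sequentially" by (simp add: filterlim_uminus_at_top)
        then show ?thesis by (rule filterlim_compose[OF exp_at_bot])
      qed
      show "(\<lambda>k. exp (- (g/4 * z k))) \<longlonglongrightarrow> 0" by (rule lim) (use g0 in simp)
      show "(\<lambda>k. exp (- (g/2 * z k))) \<longlonglongrightarrow> 0" by (rule lim) (use g0 in simp)
    qed
    ultimately have "1 \<le> C' * 0 + n * 0"
      by (intro tendsto_lowerbound) auto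
    then show False by simp
  qed
  then show ?thesis
    using hT f(1)[of \<Lambda>] S_facts(2)[of \<Lambda>] subspace_0 by (cases "T = {}") (auto simp: subset_singleton_iff)
qed

lemma norm_h0: "norm (h 0) > 0"
  using h_pos[of 0 undefined] by (metis less_irrefl zero_index zero_less_norm_iff)

lemma E_top: "E \<Lambda> = span {h 0}"
proof -
  have h0: "h 0 \<noteq> 0" using h_pos[of 0 undefined] by (metis less_irrefl zero_index)
  have "span {h 0} = E \<Lambda>"
  proof (rule subspace_dim_equal)
    show "span {h 0} \<subseteq> E \<Lambda>" using h_top S_facts(2) by (intro span_minimal) auto
    show "dim (span {h 0}) \<ge> dim (E \<Lambda>)" using h0 by (simp add: dim_top)
  qed (simp_all add: S_facts)
  then show ?thesis ..
qed

text \<open>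
  The top line thus contains a positive vector, which makes the definite description of \<open>q_vec\<close> meaningful.
\<close>

lemma q_vec_h: "q_vec \<pi> len \<tau> = (1 / norm (h 0)) *\<^sub>R h 0"
proof -
  note h0 = norm_h0
  let ?u = "(1 / norm (h 0)) *\<^sub>R h 0"
  show ?thesis
    unfolding q_vec_def Let_def
  proof (rule the_equality)
    have "span {?u} = span {h 0}"
    proof -
      have "h 0 = norm (h 0) *\<^sub>R (?u)" using h0 by simp
      then have "h 0 \<in> span {?u}" by (metis span_scale span_base singletonI)
      then show ?thesis unfolding span_eq by (simp add: span_scale span_base)
    qed
    then show "(\<forall>\<alpha>. (?u) $ \<alpha> > 0) \<and> norm (?u) = 1 \<and>
        span {?u} = E \<Lambda>"
      using h0 h_pos E_top by auto
    fix q assume q: "(\<forall>\<alpha>. q $ \<alpha> > 0) \<and> norm q = 1 \<and> span {q} = E \<Lambda>"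
    then have "q \<in> span {h 0}" using E_top by (metis span_base singletonI)
    then obtain s where s: "q = s *\<^sub>R h 0" by (auto simp: span_singleton)
    have "q $ undefined = s * h 0 $ undefined" by (simp add: s)
    moreover have "q $ undefined > 0" using q by blast
    ultimately have "s > 0" using h_pos[of 0 undefined] zero_less_mult_pos2[of s "h 0 $ undefined"] by simp
    then have "s * norm (h 0) = 1" using q unfolding s by simp
    then have "s = 1 / norm (h 0)" using h0 by (simp add: field_simps)
    then show "q = ?u" using s by simp
  qed
qed

text \<open>
  The second Roth condition read off from the restricted operator norm, by scaling to unit vectors.
\<close>

lemma dual_A:
  "\<exists>\<theta>>0. \<exists>C>0. \<forall>k v. v \<bullet> q_vec \<pi> len \<tau> = 0 \<longrightarrow>
      norm (transpose (bmat A 0 k) *v v) \<le> C * N k powr (1 - \<theta>) * norm v"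
proof -
  obtain \<theta> C where C: "\<theta> > 0" "C > 0" "\<And>n. n \<le> 0 \<Longrightarrow>
     restricted_norm (transpose (path_matrix bpath n 0)) (dual_hyperplane \<pi> \<tau>)
       \<le> C * mat_norm (transpose (path_matrix bpath n 0)) powr (1 - \<theta>)"
    using dRoth unfolding dual_Roth_type_def Let_def by blast
  note h0 = norm_h0
  have "norm (transpose (bmat A 0 k) *v v) \<le> C * N k powr (1 - \<theta>) * norm v" if v: "v \<bullet> q_vec \<pi> len \<tau> = 0" for k v
  proof (cases "v = 0")
    case False
    let ?X = "transpose (bmat A 0 k)" and ?H = "dual_hyperplane \<pi> \<tau>"
    define u where "u = (1 / norm v) *\<^sub>R v"
    have "v \<bullet> h 0 = 0" using v h0 by (simp add: q_vec_h)
    then have "u \<bullet> h 0 = 0" by (simp add: u_def)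
    moreover have "h 0 = - (Omega_mat \<pi> *v \<tau>)" using hvec_eq[OF typical_facts(1), of \<tau>] by (simp add: h_def P_def)
    ultimately have u: "u \<in> {v \<in> ?H. norm v \<le> 1}" using False by (simp add: dual_hyperplane_def inner_vec_def u_def)
    have "norm (?X *v u) \<le> restricted_norm ?X ?H"
      unfolding restricted_norm_def
    proof (rule cSUP_upper[OF u])
      show "bdd_above ((\<lambda>v. norm (?X *v v)) ` {v \<in> ?H. norm v \<le> 1})"
      proof (rule bdd_aboveI2)
        fix x assume "x \<in> {v \<in> ?H. norm v \<le> 1}"
        then show "norm (?X *v x) \<le> mat_norm ?X"
          using norm_mult_vec_le[of ?X x] mult_left_mono[of "norm x" 1 "mat_norm ?X"] by simp
      qed
    qed
    also have "\<dots> \<le> C * N k powr (1 - \<theta>)"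
      using C(3)[of "- int k"] path_matrix_A[of 0 k] by (simp add: mat_norm_transpose)
    finally have "norm (?X *v u) * norm v \<le> C * N k powr (1 - \<theta>) * norm v" by (rule mult_right_mono) simp
    moreover have "?X *v v = norm v *\<^sub>R (?X *v u)" using False by (simp add: u_def matrix_vector_mult_scaleR del: transpose_matrix_vector)
    ultimately show ?thesis by (simp add: mult.commute del: transpose_matrix_vector)
  qed simp
  then show ?thesis using C by blast
qed

end

section \<open>The piecewise affine functions of the theorem\<close>

lemma holder_on_continuous:
  assumes "holder_on \<eta> S \<psi>" "\<eta> > 0"
  shows "continuous_on S \<psi>"
proof -
  obtain C where C: "\<And>x y. x \<in> S \<Longrightarrow> y \<in> S \<Longrightarrow> \<bar>\<psi> x - \<psi> y\<bar> \<le> C * \<bar>x - y\<bar> powr \<eta>"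
    using assms(1) by (auto simp: holder_on_def)
  show ?thesis
    unfolding continuous_on_def
  proof
    fix x assume x: "x \<in> S"
    have "((\<lambda>y. \<psi> y - \<psi> x) \<longlongrightarrow> 0) (at x within S)"
    proof (rule Lim_null_comparison)
      show "\<forall>\<^sub>F y in at x within S. norm (\<psi> y - \<psi> x) \<le> C * \<bar>y - x\<bar> powr \<eta>"
        using C x by (auto simp: eventually_at_filter)
      have "((\<lambda>y. \<bar>y - x\<bar>) \<longlongrightarrow> \<bar>x - x\<bar>) (at x within S)" by (intro tendsto_intros)
      then have "((\<lambda>y. \<bar>y - x\<bar> powr \<eta>) \<longlongrightarrow> 0) (at x within S)"
        using assms(2) by (intro tendsto_zero_powrI[where b = \<eta>]) auto
      then show "((\<lambda>y. C * \<bar>y - x\<bar> powr \<eta>) \<longlongrightarrow> 0) (at x within S)"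
        using tendsto_mult_right_zero by blast
    qed
    then show "(\<psi> \<longlongrightarrow> \<psi> x) (at x within S)" by (simp add: LIM_zero_iff)
  qed
qed

text \<open>
  Both suprema in the norm are over bounded sets, so that they bound \<open>\<psi>\<close> and its difference quotients.
\<close>

lemma holder_norm_split:
  assumes "holder_on \<eta> {0..Q} \<psi>" "\<eta> > 0" "Q \<ge> 0"
  obtains H M where "holder_bound \<psi> Q \<eta> H" "H \<ge> 0" "\<And>x. x \<in> {0..Q} \<Longrightarrow> \<bar>\<psi> x\<bar> \<le> M"
    "holder_norm \<eta> {0..Q} \<psi> = H + M"
proof -
  obtain C where C: "\<And>x y. x \<in> {0..Q} \<Longrightarrow> y \<in> {0..Q} \<Longrightarrow> \<bar>\<psi> x - \<psi> y\<bar> \<le> C * \<bar>x - y\<bar> powr \<eta>"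
    using assms(1) unfolding holder_on_def by blast
  define R where "R = (\<lambda>(x, y). \<bar>\<psi> x - \<psi> y\<bar> / \<bar>x - y\<bar> powr \<eta>)"
  define H where "H = (SUP p\<in>{0..Q} \<times> {0..Q}. R p)"
  define M where "M = (SUP x\<in>{0..Q}. \<bar>\<psi> x\<bar>)"
  have bR: "bdd_above (R ` ({0..Q} \<times> {0..Q}))"
  proof (rule bdd_aboveI2)
    fix p assume p: "p \<in> {0..Q} \<times> {0..Q}"
    obtain x y where xy: "p = (x, y)" by (cases p)
    show "R p \<le> \<bar>C\<bar>"
    proof (cases "x = y")
      case False
      have "\<bar>\<psi> x - \<psi> y\<bar> \<le> C * \<bar>x - y\<bar> powr \<eta>" using p xy C by auto
      also have "\<dots> \<le> \<bar>C\<bar> * \<bar>x - y\<bar> powr \<eta>" by (intro mult_right_mono) auto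
      finally show ?thesis using False by (simp add: R_def xy field_simps)
    qed (simp add: R_def xy)
  qed
  have RH: "R (x, y) \<le> H" if "x \<in> {0..Q}" "y \<in> {0..Q}" for x y
    unfolding H_def using that by (intro cSUP_upper bR) auto
  have "compact ((\<lambda>x. \<bar>\<psi> x\<bar>) ` {0..Q})"
    by (intro compact_continuous_image continuous_intros holder_on_continuous[OF assms(1,2)]) auto
  then have bM: "bdd_above ((\<lambda>x. \<bar>\<psi> x\<bar>) ` {0..Q})"
    by (intro bounded_imp_bdd_above compact_imp_bounded)
  show ?thesis
  proof
    show "H \<ge> 0" using RH[of 0 0] assms(3) by (simp add: R_def)
    show "holder_bound \<psi> Q \<eta> H"
      unfolding holder_bound_def
    proof (intro ballI)
      fix x y assume xy: "x \<in> {0..Q}" "y \<in> {0..Q}"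
      show "\<bar>\<psi> x - \<psi> y\<bar> \<le> H * \<bar>x - y\<bar> powr \<eta>"
        using RH[OF xy] by (cases "x = y") (auto simp: R_def field_simps)
    qed
    show "\<bar>\<psi> x\<bar> \<le> M" if "x \<in> {0..Q}" for x
      unfolding M_def using that bM by (rule cSUP_upper)
    show "holder_norm \<eta> {0..Q} \<psi> = H + M" by (simp add: holder_norm_def H_def M_def R_def)
  qed
qed

text \<open>
  From here on \<open>L k\<close> denotes the lengths at level \<open>-k\<close>, and \<open>q k\<close> and \<open>chi k\<close> are the vectors \<open>q\<close> and \<open>c\<close> pulled back to that level.
\<close>

locale central_setup = typical_setup \<pi> len \<tau> for \<pi> :: "'a::finite comb" and len \<tau> :: "real^'a" +
  fixes c :: "real^'a"
  assumes central: "c \<in> central_space \<pi> len \<tau>"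
begin

abbreviation q :: "nat \<Rightarrow> real^'a" where "q k \<equiv> lev k (q_vec \<pi> len \<tau>)"
abbreviation chi :: "nat \<Rightarrow> real^'a" where "chi k \<equiv> lev k c"

sublocale dual_roth_chain A t q chi
proof
  show "q i = arrow_matrix (A i) *v q (Suc i)" for i by (rule lev_orbit)
  show "chi i = arrow_matrix (A i) *v chi (Suc i)" for i by (rule lev_orbit)
  show "q i $ b > 0" for i b
    unfolding q_vec_h lev_scaleR lev_h using norm_h0 h_pos[of i b] by simp
  show "norm (q 0) = 1" unfolding q_vec_h lev_0 using norm_h0 by simp
  show "\<exists>C>0. \<forall>k. norm (chi k) \<le> C * N k powr \<epsilon>" if "\<epsilon> > 0" for \<epsilon>
    using central_small[OF _ that, of c] central by (simp add: central_space_def)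
  show "\<exists>\<theta>>0. \<exists>C>0. \<forall>k v. v \<bullet> q 0 = 0 \<longrightarrow> norm (transpose (bmat A 0 k) *v v) \<le> C * N k powr (1 - \<theta>) * norm v"
    unfolding lev_0 by (rule dual_A)
qed

primrec L :: "nat \<Rightarrow> real^'a" where
  "L 0 = len"
| "L (Suc k) = augment (A k) (L k)"

lemma L_pos: "L k $ b > 0"
proof (induction k arbitrary: b)
  case (Suc k)
  show ?case using Suc by (auto simp: augment_def intro: add_pos_pos)
qed (simp add: typical_facts)

lemma orbit_bwd: "rv_orbit \<pi> len \<tau> (- int k) = (fst (P k), L k, snd (P k))"
proof -
  have "(bwd_step ^^ k) (\<pi>, len, \<tau>) = (fst (P k), L k, snd (P k))"
  proof (induction k)
    case 0
    show ?case by (simp add: P_def)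
  next
    case (Suc k)
    then show ?case by (simp add: bwd_step_def Let_def P_Suc A_P)
  qed
  then show ?thesis by (cases "k = 0") (auto simp: rv_orbit_def)
qed

lemma follows_word:
  assumes "x \<in> top_interval \<pi> len a"
  shows "follows (fst (P k)) (L k) (word A 0 k a) x"
proof (induction k)
  case 0
  then show ?case using assms by (simp add: P_def)
next
  case (Suc k)
  have "A k = (fst (P (Suc k)), snd (A k))" by (simp add: P_Suc)
  then show ?case
    using predecessor_follows[OF P_comb P_predecessor L_pos Suc]
    by (simp add: augment_add_entry)
qed

text \<open>
  The letter in the definite description is unique because the interval of \<open>a\<close> is not empty and the top intervals are disjoint.
\<close>

lemma itinerary_word:
  assumes j: "j < length (word A 0 k a)"
  shows "itinerary \<pi> len \<tau> (- int k) a j = word A 0 k a ! j"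
proof -
  let ?T = "iem (fst (P k)) (L k)" and ?I = "top_interval (fst (P k)) (L k)"
  have sub: "(?T ^^ j) ` top_interval \<pi> len a \<subseteq> ?I (word A 0 k a ! j)"
    using follows_nth[OF follows_word j] by auto
  have "itinerary \<pi> len \<tau> (- int k) a j = (THE \<beta>. (?T ^^ j) ` top_interval \<pi> len a \<subseteq> ?I \<beta>)"
    by (simp add: itinerary_def orbit_bwd)
  also have "\<dots> = word A 0 k a ! j"
  proof (rule the_equality)
    show "(?T ^^ j) ` top_interval \<pi> len a \<subseteq> ?I (word A 0 k a ! j)" by (rule sub)
    fix \<beta> assume \<beta>: "(?T ^^ j) ` top_interval \<pi> len a \<subseteq> ?I \<beta>"
    have "top_interval \<pi> len a \<noteq> {}"
      using typical_facts(2)[of a] by (simp add: top_interval_row_sum)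
    then obtain x where "x \<in> top_interval \<pi> len a" by auto
    then have "(?T ^^ j) x \<in> ?I \<beta>" "(?T ^^ j) x \<in> ?I (word A 0 k a ! j)" using sub \<beta> by auto
    then show "\<beta> = word A 0 k a ! j"
      using L_pos by (intro top_intervals_disjoint[OF P_comb]) (auto intro: less_imp_le)
  qed
  finally show ?thesis .
qed

lemma return_time_word: "return_time \<pi> len \<tau> (- int k) a = length (word A 0 k a)"
  by (simp add: return_time_def B_mat_def bmat_\<gamma> bmat_row_sum)

lemma Sq_word:
  "l \<le> length (word A 0 k a) \<Longrightarrow> Sq \<pi> len \<tau> (- int k) a l = total (($) (q k)) (take l (word A 0 k a))"
proof (induction l)
  case (Suc l)
  then show ?case by (simp add: Sq_def at_level_lev itinerary_word take_Suc_conv_app_nth)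
qed (simp add: Sq_def)

abbreviation Q :: "'a \<Rightarrow> real" where "Q a \<equiv> q_vec \<pi> len \<tau> $ a"

definition mean :: "nat \<Rightarrow> 'a \<Rightarrow> real" where "mean k a = integral {0..Q a} (F k a) / Q a"

lemma Q_pos: "Q a > 0"
  using q_pos[of 0 a] by (simp add: lev_0)

lemma F_affine:
  assumes "l < length (word A 0 k a)"
  defines "W \<equiv> word A 0 k a" and "node \<equiv> \<lambda>l. total (($) (q k)) (take l (word A 0 k a))"
  shows "node (Suc l) = node l + q k $ (W ! l)" and "node l < node (Suc l)"
    and "\<And>x. x \<in> {node l..node (Suc l)} \<Longrightarrow> F k a x = total (($) (chi k)) (take l W) + chi k $ (W ! l) * ((x - node l) / q k $ (W ! l))"
    and "F k a (node (Suc l)) - F k a (node l) = chi k $ (W ! l)"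
proof -
  show d: "node (Suc l) = node l + q k $ (W ! l)"
    using assms(1) by (simp add: node_def W_def take_Suc_conv_app_nth)
  then show "node l < node (Suc l)" using q_pos by simp
  show a: "F k a x = total (($) (chi k)) (take l W) + chi k $ (W ! l) * ((x - node l) / q k $ (W ! l))"
    if "x \<in> {node l..node (Suc l)}" for x
    unfolding F_def W_def node_def using that assms(1)
    by (intro tile_ramp_at q_pos) (auto simp: node_def)
  show "F k a (node (Suc l)) - F k a (node l) = chi k $ (W ! l)"
    using a[of "node l"] a[of "node (Suc l)"] d q_pos[of k "W ! l"] by simp
qed

lemma S_last: "total (($) (q k)) (take (length (word A 0 k a)) (word A 0 k a)) = Q a"
  using total_q[of 0 k a] by (simp add: lev_0)

text \<open>
  Prescribed increments over the nodes and affinity between them determine a function up to a constant,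
  and the constant is fixed by the mean.
\<close>

lemma is_Omega_fun_iff:
  "is_Omega_fun \<pi> len \<tau> c (- int k) a f \<longleftrightarrow> (\<forall>x\<in>{0..Q a}. f x = F k a x - mean k a)"
proof -
  define W where "W = word A 0 k a"
  define node where "node l = total (($) (q k)) (take l W)" for l
  have aff: "node l < node (Suc l)"
    "\<And>x. x \<in> {node l..node (Suc l)} \<Longrightarrow> F k a x = total (($) (chi k)) (take l W) + chi k $ (W ! l) * ((x - node l) / q k $ (W ! l))"
    "F k a (node (Suc l)) - F k a (node l) = chi k $ (W ! l)"
    "node (Suc l) - node l = q k $ (W ! l)" if "l < length W" for l
    using F_affine[of l k a] that by (auto simp: node_def W_def)
  have S_le: "node l \<le> node m" if "l \<le> m" "m \<le> length W" for l m
    using that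
  proof (induction m rule: dec_induct)
    case (step m)
    then show ?case using aff(1)[of m] by simp
  qed simp
  have S0: "node 0 = 0" by (simp add: node_def)
  have SN: "node (length W) = Q a" unfolding node_def W_def by (rule S_last)
  have def: "is_Omega_fun \<pi> len \<tau> c (- int k) a f \<longleftrightarrow> continuous_on {0..Q a} f \<and>
     (\<forall>l < length W. (\<exists>r s. \<forall>x\<in>{node l..node (Suc l)}. f x = r * x + s) \<and>
         f (node (Suc l)) - f (node l) = chi k $ (W ! l)) \<and> integral {0..Q a} f = 0" for f
    unfolding is_Omega_fun_def Let_def return_time_word at_level_lev
    by (auto simp: Sq_word itinerary_word W_def node_def)
  have intF: "F k a integrable_on {0..Q a}" by (intro integrable_continuous_real F_continuous)
  show ?thesis
  proof
    assume "is_Omega_fun \<pi> len \<tau> c (- int k) a f"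
    then have f: "\<And>l. l < length W \<Longrightarrow> \<exists>r s. \<forall>x\<in>{node l..node (Suc l)}. f x = r * x + s"
      "\<And>l. l < length W \<Longrightarrow> f (node (Suc l)) - f (node l) = chi k $ (W ! l)" "integral {0..Q a} f = 0"
      unfolding def by auto
    define d where "d = f 0 - F k a 0"
    have "\<forall>x\<in>{0..node l}. f x = F k a x + d" if "l \<le> length W" for l
      using that
    proof (induction l)
      case 0
      then show ?case by (auto simp: S0 d_def)
    next
      case (Suc l)
      then have l: "l < length W" by simp
      have IH: "\<And>x. x \<in> {0..node l} \<Longrightarrow> f x = F k a x + d" using Suc by auto
      have "0 \<le> node l" using S_le[of 0 l] l by (simp add: S0)
      then have fl: "f (node l) = F k a (node l) + d" using IH by simp
      show ?case
      proof
        fix x assume x: "x \<in> {0..node (Suc l)}"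
        show "f x = F k a x + d"
        proof (cases "x \<le> node l")
          case True
          then show ?thesis using IH x by simp
        next
          case False
          obtain r s where ab: "\<And>x. x \<in> {node l..node (Suc l)} \<Longrightarrow> f x = r * x + s" using f(1)[OF l] by auto
          let ?s = "chi k $ (W ! l) / q k $ (W ! l)"
          have fF: "f (node (Suc l)) - f (node l) = ?s * (node (Suc l) - node l)"
            unfolding f(2)[OF l] aff(4)[OF l] using q_pos[of k "W ! l"] by simp
          have "f (node (Suc l)) - f (node l) = r * (node (Suc l) - node l)"
            using ab aff(1)[OF l] by (simp add: algebra_simps)
          then have "r * (node (Suc l) - node l) = ?s * (node (Suc l) - node l)" using fF by (simp only:)
          then have as: "r = ?s" unfolding mult_cancel_right using aff(1)[OF l] by simp
          have "f x - f (node l) = r * (x - node l)" using ab x False aff(1)[OF l] by (simp add: algebra_simps)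
          moreover have "F k a x - F k a (node l) = ?s * (x - node l)" 
            using aff(2)[OF l, of x] aff(2)[OF l, of "node l"] x False aff(1)[OF l] by simp
          ultimately show ?thesis using as fl by simp
        qed
      qed
    qed
    from this[of "length W"] have fd: "\<forall>x\<in>{0..Q a}. f x = F k a x + d" by (simp add: SN)
    then have "integral {0..Q a} f = integral {0..Q a} (\<lambda>x. F k a x + d)" by (intro integral_cong) auto
    also have "\<dots> = integral {0..Q a} (F k a) + d * Q a"
      using intF Q_pos[of a] by (subst Henstock_Kurzweil_Integration.integral_add) auto
    finally have "d = - mean k a" using f(3) Q_pos[of a] by (simp add: mean_def field_simps)
    then show "\<forall>x\<in>{0..Q a}. f x = F k a x - mean k a" using fd by simp
  next
    assume f: "\<forall>x\<in>{0..Q a}. f x = F k a x - mean k a"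
    have in01: "x \<in> {0..Q a}" if "l < length W" "x \<in> {node l..node (Suc l)}" for x l
      using S_le[of 0 l] S_le[of "Suc l" "length W"] that by (auto simp: S0 SN)
    show "is_Omega_fun \<pi> len \<tau> c (- int k) a f"
      unfolding def
    proof (intro conjI allI impI)
      have "continuous_on {0..Q a} (\<lambda>x. F k a x - mean k a)" by (intro continuous_intros F_continuous)
      then show "continuous_on {0..Q a} f" using f by (subst continuous_on_cong[OF refl]) auto
      have "integral {0..Q a} f = integral {0..Q a} (\<lambda>x. F k a x - mean k a)" using f by (intro integral_cong) auto
      also have "\<dots> = integral {0..Q a} (F k a) - mean k a * Q a"
        using intF Q_pos[of a] by (subst Henstock_Kurzweil_Integration.integral_diff) auto
      also have "\<dots> = 0" using Q_pos[of a] by (simp add: mean_def)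
      finally show "integral {0..Q a} f = 0" .
      fix l assume l: "l < length W"
      show "f (node (Suc l)) - f (node l) = chi k $ (W ! l)"
        using f in01[OF l, of "node l"] in01[OF l, of "node (Suc l)"] aff(1,3)[OF l] by simp
      let ?s = "chi k $ (W ! l) / q k $ (W ! l)"
      show "\<exists>r s. \<forall>x\<in>{node l..node (Suc l)}. f x = r * x + s"
      proof (rule exI[of _ ?s], rule exI[of _ "total (($) (chi k)) (take l W) - ?s * node l - mean k a"], rule ballI)
        fix x assume x: "x \<in> {node l..node (Suc l)}"
        have "f x = F k a x - mean k a" using f in01[OF l x] by blast
        also have "F k a x = total (($) (chi k)) (take l W) + ?s * (x - node l)"
          using aff(2)[OF l x] by simp
        finally show "f x = ?s * x + (total (($) (chi k)) (take l W) - ?s * node l - mean k a)"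
          by (simp only: right_diff_distrib)
      qed
    qed
  qed
qed

abbreviation Om :: "int \<Rightarrow> 'a \<Rightarrow> real \<Rightarrow> real" where "Om \<equiv> Omega_fun \<pi> len \<tau> c"

lemma Omega_fun_eq:
  assumes "x \<in> {0..Q a}"
  shows "Om (- int k) a x = F k a x - mean k a"
proof -
  have "Om (- int k) a = (\<lambda>x. if x \<in> {0..Q a} then F k a x - mean k a else 0)"
    unfolding Omega_fun_def is_Omega_fun_iff
    by (rule the_equality) (auto simp: fun_eq_iff)
  then show ?thesis using assms by simp
qed

text \<open>
  Additive constants disappear against a function of mean 0.
\<close>

lemma integral_Omega:
  assumes "continuous_on {0..Q a} \<psi>" "integral {0..Q a} \<psi> = 0"
  shows "integral {0..Q a} (\<lambda>x. \<psi> x * Om (- int k) a x) = integral {0..Q a} (\<lambda>x. \<psi> x * F k a x)" (is ?A)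
    and "integral {0..Q a} (\<lambda>x. \<psi> x * (Om (- int l) a x - Om (- int k) a x))
      = integral {0..Q a} (\<lambda>x. \<psi> x * (F l a x - F k a x))" (is ?B)
proof -
  have shift: "integral {0..Q a} (\<lambda>x. g x - \<psi> x * m) = integral {0..Q a} g" if "continuous_on {0..Q a} g" for g m
    using that assms by (subst Henstock_Kurzweil_Integration.integral_diff)
      (auto intro!: integrable_continuous_real continuous_intros)
  have "integral {0..Q a} (\<lambda>x. \<psi> x * Om (- int k) a x) = integral {0..Q a} (\<lambda>x. \<psi> x * F k a x - \<psi> x * mean k a)"
    by (intro integral_cong) (simp only: Omega_fun_eq right_diff_distrib)
  also have "\<dots> = integral {0..Q a} (\<lambda>x. \<psi> x * F k a x)"
    by (intro shift continuous_intros assms F_continuous)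
  finally show ?A .
  have "integral {0..Q a} (\<lambda>x. \<psi> x * (Om (- int l) a x - Om (- int k) a x)) =
     integral {0..Q a} (\<lambda>x. \<psi> x * (F l a x - F k a x) - \<psi> x * (mean l a - mean k a))"
    by (intro integral_cong) (simp only: Omega_fun_eq, simp add: algebra_simps)
  also have "\<dots> = integral {0..Q a} (\<lambda>x. \<psi> x * (F l a x - F k a x))"
    by (intro shift continuous_intros assms F_continuous)
  finally show ?B .
qed

lemma holder_estimate:
  assumes \<eta>: "0 < \<eta>" "\<eta> < 1"
  shows "\<exists>\<delta>>0. \<exists>C>0. \<forall>k l a \<psi>. holder_on \<eta> {0..Q a} \<psi> \<and> integral {0..Q a} \<psi> = 0 \<and> k \<le> l \<longrightarrow>
    \<bar>integral {0..Q a} (\<lambda>x. \<psi> x * (F l a x - F k a x))\<bar> \<le> C * holder_norm \<eta> {0..Q a} \<psi> * N k powr (- \<delta>)"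
proof -
  obtain \<delta> C where \<delta>: "\<delta> > 0" "C > 0" and est: "\<And>k l a \<psi> H M. admissible \<eta> a \<psi> H M \<Longrightarrow> k \<le> l \<Longrightarrow>
    \<bar>integral {0..Q a} (\<lambda>x. \<psi> x * (F l a x - F k a x))\<bar> \<le> C * (H + M) * N k powr (- \<delta>)"
    using many_steps[OF \<eta>] unfolding lev_0 by blast
  have "\<bar>integral {0..Q a} (\<lambda>x. \<psi> x * (F l a x - F k a x))\<bar> \<le> C * holder_norm \<eta> {0..Q a} \<psi> * N k powr (- \<delta>)"
    if \<psi>: "holder_on \<eta> {0..Q a} \<psi>" "integral {0..Q a} \<psi> = 0" and kl: "k \<le> l" for k l a \<psi>
  proof -
    obtain H M where HM: "holder_bound \<psi> (Q a) \<eta> H" "H \<ge> 0" "\<And>x. x \<in> {0..Q a} \<Longrightarrow> \<bar>\<psi> x\<bar> \<le> M"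
      "holder_norm \<eta> {0..Q a} \<psi> = H + M"
      using holder_norm_split[OF \<psi>(1) \<eta>(1) less_imp_le[OF Q_pos]] by blast
    have "admissible \<eta> a \<psi> H M"
      unfolding admissible_def lev_0 using HM \<psi> holder_on_continuous[OF \<psi>(1) \<eta>(1)] by blast
    from est[OF this kl] show ?thesis by (simp add: HM(4))
  qed
  then show ?thesis using \<delta> by blast
qed

lemma holder_norm_pos:
  assumes "holder_on \<eta> {0..Q a} \<psi>" "\<eta> > 0" "x \<in> {0..Q a}" "\<psi> x \<noteq> 0"
  shows "holder_norm \<eta> {0..Q a} \<psi> > 0"
proof -
  obtain H M where HM: "holder_bound \<psi> (Q a) \<eta> H" "H \<ge> 0" "\<And>x. x \<in> {0..Q a} \<Longrightarrow> \<bar>\<psi> x\<bar> \<le> M"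
      "holder_norm \<eta> {0..Q a} \<psi> = H + M"
    using holder_norm_split[OF assms(1,2) less_imp_le[OF Q_pos]] by blast
  have "0 < \<bar>\<psi> x\<bar>" using assms(4) by simp
  then show ?thesis using HM(3)[OF assms(3)] HM(2,4) by linarith
qed

lemma B_N: "mat_norm (B_mat \<pi> len \<tau> (- int k) 0) = N k"
  by (simp add: B_mat_def bmat_\<gamma>)

lemma integrals_converge:
  assumes \<eta>: "0 < \<eta>" "\<eta> < 1" and \<psi>: "holder_on \<eta> {0..Q a} \<psi>" "integral {0..Q a} \<psi> = 0"
  shows "\<exists>L. ((\<lambda>n. integral {0..Q a} (\<lambda>x. \<psi> x * Om n a x)) \<longlongrightarrow> L) at_bot"
proof -
  note cont = holder_on_continuous[OF \<psi>(1) \<eta>(1)]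
  define X where "X k = integral {0..Q a} (\<lambda>x. \<psi> x * F k a x)" for k
  obtain \<delta> C where \<delta>: "\<delta> > 0" and est: "\<And>k l. k \<le> l \<Longrightarrow>
    \<bar>integral {0..Q a} (\<lambda>x. \<psi> x * (F l a x - F k a x))\<bar> \<le> C * holder_norm \<eta> {0..Q a} \<psi> * N k powr (- \<delta>)"
    using holder_estimate[OF \<eta>] \<psi> by blast
  have diff: "\<bar>X l - X k\<bar> \<le> C * holder_norm \<eta> {0..Q a} \<psi> * N k powr (- \<delta>)" if "k \<le> l" for k l
  proof -
    have "X l - X k = integral {0..Q a} (\<lambda>x. \<psi> x * F l a x - \<psi> x * F k a x)"
      unfolding X_def by (intro Henstock_Kurzweil_Integration.integral_diff[symmetric] integrable_continuous_real continuous_intros cont F_continuous)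
    then show ?thesis using est[OF that] by (simp add: right_diff_distrib)
  qed
  have "(\<lambda>k. C * holder_norm \<eta> {0..Q a} \<psi> * N k powr (- \<delta>)) \<longlonglongrightarrow> C * holder_norm \<eta> {0..Q a} \<psi> * 0"
    using \<delta> by (intro tendsto_intros tendsto_neg_powr N_unbounded) auto
  then have lim: "(\<lambda>k. C * holder_norm \<eta> {0..Q a} \<psi> * N k powr (- \<delta>)) \<longlonglongrightarrow> 0" by simp
  have "Cauchy X"
  proof (rule CauchyI')
    fix e :: real assume "e > 0"
    then obtain K where K: "\<And>k. k \<ge> K \<Longrightarrow> \<bar>C * holder_norm \<eta> {0..Q a} \<psi> * N k powr (- \<delta>)\<bar> < e"
      using lim unfolding LIMSEQ_iff by fastforce
    show "\<exists>M. \<forall>m\<ge>M. \<forall>n>m. dist (X m) (X n) < e"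
    proof (intro exI allI impI)
      fix m n assume "K \<le> m" "m < n"
      then show "dist (X m) (X n) < e" using diff[of m n] K[of m] by (simp add: dist_real_def)
    qed
  qed
  then obtain L where L: "X \<longlonglongrightarrow> L" by (auto simp: Cauchy_convergent_iff convergent_def)
  have "filterlim (\<lambda>n::int. nat (- n)) sequentially at_bot"
    unfolding filterlim_at_top
  proof
    fix Z :: nat
    show "\<forall>\<^sub>F n in at_bot. Z \<le> nat (- n)"
      using eventually_le_at_bot[of "- int Z"] by eventually_elim linarith
  qed
  from filterlim_compose[OF L this] have "((\<lambda>n. X (nat (- n))) \<longlongrightarrow> L) at_bot" .
  moreover have "\<forall>\<^sub>F n in at_bot. X (nat (- n)) = integral {0..Q a} (\<lambda>x. \<psi> x * Om n a x)"
    using eventually_le_at_bot[of 0]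
  proof eventually_elim
    case (elim n)
    then show ?case using integral_Omega(1)[OF cont \<psi>(2), of "nat (- n)"] by (simp add: X_def)
  qed
  ultimately show ?thesis by (blast intro: Lim_transform_eventually)
qed

lemma convergence_rate:
  assumes \<eta>: "0 < \<eta>" "\<eta> < 1"
  shows "\<exists>\<delta>>0. \<exists>C. \<forall>a \<psi> n n'.
     holder_on \<eta> {0..Q a} \<psi> \<and> integral {0..Q a} \<psi> = 0 \<and> (\<exists>x\<in>{0..Q a}. \<psi> x \<noteq> 0) \<and> n' \<le> n \<and> n \<le> 0 \<longrightarrow>
     \<bar>integral {0..Q a} (\<lambda>x. \<psi> x * (Om n' a x - Om n a x))\<bar>
       < C * holder_norm \<eta> {0..Q a} \<psi> * mat_norm (B_mat \<pi> len \<tau> n 0) powr (- \<delta> / 4)"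
proof -
  obtain \<delta> C where \<delta>: "\<delta> > 0" "C > 0" and est: "\<And>k l a \<psi>. holder_on \<eta> {0..Q a} \<psi> \<Longrightarrow> integral {0..Q a} \<psi> = 0 \<Longrightarrow> k \<le> l \<Longrightarrow>
    \<bar>integral {0..Q a} (\<lambda>x. \<psi> x * (F l a x - F k a x))\<bar> \<le> C * holder_norm \<eta> {0..Q a} \<psi> * N k powr (- \<delta>)"
    using holder_estimate[OF \<eta>] by blast
  have "\<bar>integral {0..Q a} (\<lambda>x. \<psi> x * (Om n' a x - Om n a x))\<bar>
       < (C + 1) * holder_norm \<eta> {0..Q a} \<psi> * mat_norm (B_mat \<pi> len \<tau> n 0) powr (- (4 * \<delta>) / 4)"
    if \<psi>: "holder_on \<eta> {0..Q a} \<psi>" "integral {0..Q a} \<psi> = 0" "\<exists>x\<in>{0..Q a}. \<psi> x \<noteq> 0" and n: "n' \<le> n" "n \<le> 0" for a \<psi> n n'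
  proof -
    define k l where "k = nat (- n)" and "l = nat (- n')"
    have kl: "n = - int k" "n' = - int l" "k \<le> l" using n by (auto simp: k_def l_def)
    have pos: "holder_norm \<eta> {0..Q a} \<psi> > 0" using holder_norm_pos[OF \<psi>(1) \<eta>(1)] \<psi>(3) by blast
    have "\<bar>integral {0..Q a} (\<lambda>x. \<psi> x * (Om n' a x - Om n a x))\<bar>
      \<le> C * holder_norm \<eta> {0..Q a} \<psi> * N k powr (- \<delta>)"
      unfolding kl integral_Omega(2)[OF holder_on_continuous[OF \<psi>(1) \<eta>(1)] \<psi>(2)] by (rule est[OF \<psi>(1,2) kl(3)])
    also have "\<dots> < (C + 1) * holder_norm \<eta> {0..Q a} \<psi> * N k powr (- \<delta>)"
      using pos N_pos[of k] by (intro mult_strict_right_mono) (simp_all add: less_imp_neq[THEN not_sym] del: N_pos)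
    finally show ?thesis by (simp add: kl(1) B_N)
  qed
  then show ?thesis using \<delta> by (intro exI[of _ "4 * \<delta>"] conjI exI[of _ "C + 1"]) auto
qed

end

theorem theorem5p6:
  fixes \<pi> :: "'a::finite comb" and len \<tau> c :: "real^'a"
  defines "q \<equiv> q_vec \<pi> len \<tau>"
    and "\<Omega> \<equiv> Omega_fun \<pi> len \<tau> c"
    and "B \<equiv> B_mat \<pi> len \<tau>"
  assumes "CARD('a) \<ge> 2"
    and "typical_point \<pi> len \<tau>"
    and "num_sing \<pi> > 1"
    and "c \<in> central_space \<pi> len \<tau>"
    and "dual_Roth_type \<pi> \<tau>"
  shows "(\<forall>\<alpha> \<psi> \<eta>. 0 < \<eta> \<and> \<eta> < 1 \<and> holder_on \<eta> {0..q $ \<alpha>} \<psi> \<and> integral {0..q $ \<alpha>} \<psi> = 0 \<longrightarrow>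
            (\<exists>L. ((\<lambda>n. integral {0..q $ \<alpha>} (\<lambda>x. \<psi> x * \<Omega> n \<alpha> x)) \<longlongrightarrow> L) at_bot)) \<and>
         (\<forall>\<eta>. 0 < \<eta> \<and> \<eta> < 1 \<longrightarrow>
            (\<exists>\<delta>>0. \<exists>C. \<forall>\<alpha> \<psi> n n'.
               holder_on \<eta> {0..q $ \<alpha>} \<psi> \<and> integral {0..q $ \<alpha>} \<psi> = 0 \<and>
               (\<exists>x\<in>{0..q $ \<alpha>}. \<psi> x \<noteq> 0) \<and> n' \<le> n \<and> n \<le> 0 \<longrightarrow>
               \<bar>integral {0..q $ \<alpha>} (\<lambda>x. \<psi> x * (\<Omega> n' \<alpha> x - \<Omega> n \<alpha> x))\<bar>
                 < C * holder_norm \<eta> {0..q $ \<alpha>} \<psi> * mat_norm (B n 0) powr (- \<delta> / 4)))"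
proof -
  interpret central_setup \<pi> len \<tau> c
    using assms by unfold_locales auto
  show ?thesis
    unfolding q_def \<Omega>_def B_def using integrals_converge convergence_rate by blast
qed

end
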